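(* Let $0<p<\infty$, $0<\theta\le\infty$, $L\in\mathbb N$, and $\mathbf r$ a smoothness vector as in the context with $r_1>1/p$. Choose $\boldsymbol\nu\in\mathbb R^d$ with $\nu_s=r_s$ for $s\le\mu$ and $r_1<\nu_s<r_s$ for $s>\mu$, and put $\boldsymbol\eta=\boldsymbol\nu-1/p$. Then there is $C>0$ such that for all $m\in\mathbb N$ and all $f\in S^{\mathbf r}_{p,\theta}F(\mathbb T^d)$ $$\|f-T^{L,\boldsymbol\eta}_mf\|_{L_\infty(\mathbb T^d)}\le C\,m^{(\mu-1)(1-1/p)_+}2^{-m(r_1-1/p)}\|f|S^{\mathbf r}_{p,\theta}F(\mathbb T^d)\|.$$
   Context: $a_+=\max\{a,0\}$. Smoothness vector: $\mathbf r=(r_1,\dots,r_d)$ with $r_1=\dots=r_\mu<r_{\mu+1}\le\dots\le r_d<\infty$ for some $\mu\in\{1,\dots,d\}$. $\mathbb T^d=[-\pi,\pi]^d$ with opposite points identified. Spaces: with an admissible system $(\varphi_j)\subset C_0^\infty(\mathbb R)$ ($\mathrm{supp}\,\varphi_0\subset[-A,A]$, $\mathrm{supp}\,\varphi_j\subset\{B2^j\le|\xi|\le C2^j\}$, $\sup_{\xi,j}2^{jr}|D^r\varphi_j|<\infty$, $\sum\varphi_j\equiv1$), $\delta_{\mathbf j}[f]=\sum_{\mathbf k}\varphi_{j_1}(k_1)\cdots\varphi_{j_d}(k_d)\hat f(\mathbf k)e^{i\mathbf k\cdot\mathbf x}$ and $\|f|S^{\mathbf r}_{p,\theta}F\|=\|(\sum_{\mathbf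 j}2^{\theta\mathbf r\cdot\mathbf j}|\delta_{\mathbf j}[f]|^\theta)^{1/\theta}\|_{L_p}$ (sup if $\theta=\infty$). Kernels: $\mathrm{sinc}(x)=\sin x/x$, $\mathrm{sinc}(0)=1$; for $L\ge2$, $K^L(x)=\prod_{\ell=1}^L\mathrm{sinc}(2^{-\ell}x)$, $K^L_{\pi,j}(x)=\sum_{k}K^L(2^j(x+2\pi k))$; $K^1_{\pi,0}\equiv1$, $K^1_{\pi,j}(x)=2^{-j}\sum_{k=-2^{j-1}}^{2^{j-1}-1}e^{ikx}$. With $U_0=\{0\}$, $U_j=\{-2^{j-1},\dots,2^{j-1}-1\}$: $I^L_j[f](x)=\sum_{u\in U_j}f(2\pi u/2^j)K^L_{\pi,j}(x-2\pi u/2^j)$; $\eta^L_0=I^L_0$, $\eta^L_j=I^L_j-I^L_{j-1}$; $q^L_{\mathbf j}[f]=(\eta^L_{j_1}\otimes\cdots\otimes\eta^L_{j_d})f$ (the $i$-th factor acts in the $i$-th variable). Smolyak operator: for $\boldsymbol\eta\in(0,\infty)^d$, $T^{L,\boldsymbol\eta}_mf=\sum_{\mathbf j\in\mathbb N_0^d:\ \boldsymbol\eta\cdot\mathbf j\le\eta_1m}q^L_{\mathbf j}[f]$. *)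

theory Defs
  imports "HOL-Analysis.Analysis" "HOL-Probability.Probability"
begin

(* Points of T^d are represented as functions x :: nat => real, of which only the
   coordinates x 0, ..., x (d-1) matter (0-based indexing: coordinate i here is
   coordinate i+1 of the paper). *)

definition tsinc :: "real \<Rightarrow> real" where
  "tsinc x = (if x = 0 then 1 else sin x / x)"

definition KL :: "nat \<Rightarrow> real \<Rightarrow> real" where
  "KL L x = (\<Prod>l\<in>{1..L}. tsinc (x / 2 ^ l))"

definition Kpi :: "nat \<Rightarrow> nat \<Rightarrow> real \<Rightarrow> complex" where
  "Kpi L j x =
     (if L = 1 then
        (if j = 0 then 1
         else of_real (1 / 2 ^ j) *
              (\<Sum>k\<in>{-(2 ^ (j - 1))..2 ^ (j - 1) - 1 :: int}. exp (\<i> * of_real (real_of_int k * x))))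
      else of_real (\<Sum>\<^sub>\<infinity>k::int. KL L (2 ^ j * (x + 2 * pi * real_of_int k))))"

definition Ugrid :: "nat \<Rightarrow> int set" where
  "Ugrid j = (if j = 0 then {0} else {-(2 ^ (j - 1))..2 ^ (j - 1) - 1})"

definition Iop :: "nat \<Rightarrow> nat \<Rightarrow> nat \<Rightarrow> ((nat \<Rightarrow> real) \<Rightarrow> complex) \<Rightarrow> (nat \<Rightarrow> real) \<Rightarrow> complex" where
  "Iop L j i g x = (\<Sum>u\<in>Ugrid j.
      g (x(i := 2 * pi * real_of_int u / 2 ^ j)) * Kpi L j (x i - 2 * pi * real_of_int u / 2 ^ j))"

definition etaop :: "nat \<Rightarrow> nat \<Rightarrow> nat \<Rightarrow> ((nat \<Rightarrow> real) \<Rightarrow> complex) \<Rightarrow> (nat \<Rightarrow> real) \<Rightarrow> complex" where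
  "etaop L j i g x = (if j = 0 then Iop L 0 i g x else Iop L j i g x - Iop L (j - 1) i g x)"

definition qop :: "nat \<Rightarrow> nat \<Rightarrow> (nat \<Rightarrow> nat) \<Rightarrow> ((nat \<Rightarrow> real) \<Rightarrow> complex) \<Rightarrow> (nat \<Rightarrow> real) \<Rightarrow> complex" where
  "qop d L jj f = foldr (\<lambda>i g. etaop L (jj i) i g) [0..<d] f"

definition multi_idx :: "nat \<Rightarrow> (nat \<Rightarrow> nat) set" where
  "multi_idx d = {jj. \<forall>i\<ge>d. jj i = 0}"

definition smolyak :: "nat \<Rightarrow> nat \<Rightarrow> (nat \<Rightarrow> real) \<Rightarrow> nat \<Rightarrow> ((nat \<Rightarrow> real) \<Rightarrow> complex) \<Rightarrow> (nat \<Rightarrow> real) \<Rightarrow> complex" where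
  "smolyak d L eta m f x =
     (\<Sum>jj\<in>{jj\<in>multi_idx d. (\<Sum>i<d. eta i * real (jj i)) \<le> eta 0 * real m}. qop d L jj f x)"

definition admissible :: "(nat \<Rightarrow> real \<Rightarrow> real) \<Rightarrow> bool" where
  "admissible phi \<longleftrightarrow>
     (\<forall>j k x. ((deriv ^^ k) (phi j) has_real_derivative (deriv ^^ Suc k) (phi j) x) (at x)) \<and>
     (\<exists>A B C. A > 0 \<and> B > 0 \<and> C > 0 \<and>
        (\<forall>x. phi 0 x \<noteq> 0 \<longrightarrow> \<bar>x\<bar> \<le> A) \<and>
        (\<forall>j\<ge>1. \<forall>x. phi j x \<noteq> 0 \<longrightarrow> B * 2 ^ j \<le> \<bar>x\<bar> \<and> \<bar>x\<bar> \<le> C * 2 ^ j)) \<and>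
     (\<forall>r. \<exists>M. \<forall>j x. 2 ^ (j * r) * \<bar>(deriv ^^ r) (phi j) x\<bar> \<le> M) \<and>
     (\<forall>x. (\<lambda>j. phi j x) sums 1)"

(* normalised Lebesgue measure space on T^d = [-pi,pi]^d (unnormalised; constants only) *)
definition torus_measure :: "nat \<Rightarrow> (nat \<Rightarrow> real) measure" where
  "torus_measure d = PiM {..<d} (\<lambda>_. restrict_space lborel {-pi..pi})"

definition torus_cube :: "nat \<Rightarrow> (nat \<Rightarrow> real) set" where
  "torus_cube d = {x. \<forall>i<d. x i \<in> {-pi..pi}}"

definition torus_fun :: "nat \<Rightarrow> ((nat \<Rightarrow> real) \<Rightarrow> complex) \<Rightarrow> bool" where
  "torus_fun d f \<longleftrightarrow> continuous_on UNIV f \<and>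
     (\<forall>x y. (\<forall>i<d. x i = y i) \<longrightarrow> f x = f y) \<and>
     (\<forall>x i. i < d \<longrightarrow> f (x(i := x i + 2 * pi)) = f x)"

definition fourier_coeff :: "nat \<Rightarrow> ((nat \<Rightarrow> real) \<Rightarrow> complex) \<Rightarrow> (nat \<Rightarrow> int) \<Rightarrow> complex" where
  "fourier_coeff d f k = (\<integral>x. f x * exp (- \<i> * of_real (\<Sum>i<d. real_of_int (k i) * x i)) \<partial>torus_measure d)
       / of_real ((2 * pi) ^ d)"

(* delta_j[f] (the sum over k has only finitely many nonzero terms) *)
definition delta_op :: "(nat \<Rightarrow> real \<Rightarrow> real) \<Rightarrow> nat \<Rightarrow> (nat \<Rightarrow> nat) \<Rightarrow> ((nat \<Rightarrow> real) \<Rightarrow> complex) \<Rightarrow> (nat \<Rightarrow> real) \<Rightarrow> complex" where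
  "delta_op phi d jj f x = (\<Sum>\<^sub>\<infinity>k\<in>{k::nat\<Rightarrow>int. \<forall>i\<ge>d. k i = 0}.
      of_real (\<Prod>i<d. phi (jj i) (real_of_int (k i))) * fourier_coeff d f k *
      exp (\<i> * of_real (\<Sum>i<d. real_of_int (k i) * x i)))"

(* a^e for a in [0,infinity], e > 0 *)
definition epow :: "ennreal \<Rightarrow> real \<Rightarrow> ennreal" where
  "epow a e = (if a = \<infinity> then \<infinity> else ennreal (enn2real a powr e))"

definition Fsq :: "(nat \<Rightarrow> real \<Rightarrow> real) \<Rightarrow> nat \<Rightarrow> (nat \<Rightarrow> real) \<Rightarrow> ennreal \<Rightarrow> ((nat \<Rightarrow> real) \<Rightarrow> complex) \<Rightarrow> (nat \<Rightarrow> real) \<Rightarrow> ennreal" where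
  "Fsq phi d r \<theta> f x =
     (if \<theta> = \<infinity> then
        (SUP jj\<in>multi_idx d. ennreal (2 powr (\<Sum>i<d. r i * real (jj i)) * norm (delta_op phi d jj f x)))
      else epow (\<Sum>\<^sub>\<infinity>jj\<in>multi_idx d.
              ennreal ((2 powr (\<Sum>i<d. r i * real (jj i)) * norm (delta_op phi d jj f x)) powr enn2real \<theta>))
             (1 / enn2real \<theta>))"

definition SF_norm :: "(nat \<Rightarrow> real \<Rightarrow> real) \<Rightarrow> nat \<Rightarrow> (nat \<Rightarrow> real) \<Rightarrow> real \<Rightarrow> ennreal \<Rightarrow> ((nat \<Rightarrow> real) \<Rightarrow> complex) \<Rightarrow> ennreal" where
  "SF_norm phi d r p \<theta> f = epow (\<integral>\<^sup>+ x. epow (Fsq phi d r \<theta> f x) p \<partial>torus_measure d) (1 / p)"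

(* sup norm (= L_infinity norm for continuous functions) *)
definition Linf_norm :: "nat \<Rightarrow> ((nat \<Rightarrow> real) \<Rightarrow> complex) \<Rightarrow> ennreal" where
  "Linf_norm d g = (SUP x\<in>torus_cube d. ennreal (norm (g x)))"

end

theory Submission
  imports Defs "HOL-Computational_Algebra.Polynomial"
begin

text \<open>
  Write \<open>f\<close> as the sum of its Littlewood-Paley blocks \<open>\<delta>\<^bsub>j\<^esub> f\<close>; the sum converges to \<open>f\<close> everywhere
  on the cube by uniqueness of Fourier coefficients. A block is a trigonometric polynomial with
  frequencies of order \<open>2 powr j\<close>, and the \<open>L\<close>-fold sinc interpolation reproduces low frequencies (a
  sampling theorem for \<open>KL\<close>). Hence \<open>q\<^bsub>k\<^esub>\<close> annihilates \<open>\<delta>\<^bsub>j\<^esub> f\<close> unless \<open>k \<le> j + c\<close> coordinatewise, and the error of the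
  Smolyak operator on \<open>\<delta>\<^bsub>j\<^esub> f\<close> is a sum of the few \<open>q\<^bsub>k\<^esub> \<delta>\<^bsub>j\<^esub> f\<close> with \<open>k \<le> j + c\<close> outside the Smolyak index set.
  Each of these is bounded by the \<open>\<ell>\<^sub>q\<close> norm \<open>Q\<^bsub>j\<^esub>\<close> of the samples of \<open>\<delta>\<^bsub>j\<^esub> f\<close>, for a fixed large finite \<open>q\<close>.

  The key estimate is the Jawerth type embedding \<open>\<Sum>\<^bsub>j\<^esub> (2 powr ((r - 1/p) \<cdot> j) * Q\<^bsub>j\<^esub>) powr p \<le> C * N powr p\<close>, where
  \<open>N\<close> is the \<open>F\<close>-norm. By a discrete Peetre inequality the samples to the power \<open>p / 2\<close> are dominated by
  averages over dyadic boxes of the samples on a common fine grid, for which the embedding is an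
  \<open>L\<^sub>2\<close> orthogonality argument iterated over the coordinates; the fine grid sums are
  Riemann sums of the \<open>L\<^sub>p\<close> integral. Finally Hoelder's inequality (or \<open>\<ell>\<^sub>p \<subseteq> \<ell>\<^sub>1\<close> when \<open>p \<le> 1\<close>) and the
  count of indices on the layers \<open>\<eta> \<cdot> j \<approx> \<eta>\<^sub>1 m\<close> give the power of \<open>m\<close>.
\<close>

section \<open>Dyadic averages\<close>

text \<open>The blocks are measured by \<ell>_q norms of samples rather than by sup norms because of
  \<open>L = 1\<close>: that kernel decays only like the inverse distance, so its absolute sums over
  the nodes grow with the level, whereas its \<ell>_s sums are bounded for every
  \<open>s > 1\<close>. Hoelder with a finite \<open>q\<close> therefore treats all \<open>L\<close>
  alike. The other demand on \<open>q\<close> is \<open>q > p\<close>: the powers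
  \<open>p / 2\<close> of the samples are taken in \<ell>_\<kappa> with
  \<open>\<kappa> = 2 * q / p\<close>, and passing between dyadic levels is a contraction only for
  \<open>\<kappa> > 2\<close>. For \<open>p < 1\<close> there is no triangle inequality in \<ell>_p;
  comparing the powers \<open>p / 2\<close> with one common majorant and squaring confines Minkowski
  to exponents where it holds.

  The gap \<open>r s - \<nu> s > 0\<close> for \<open>s \<ge> \<mu>\<close> gives summable decay in
  those directions, and one of the \<mu> equal directions is absorbed by the layer itself; this is
  the origin of \<open>\<mu> - 1\<close>. The number of indices \<open>k \<le> j + c\<close> beyond
  the layer is unbounded in \<open>j\<close>, but it grows at most like the square root of the decay
  available beyond the layer, so the other half of that decay still sums the layers.\<close>

lemma holder_sum:
  fixes f g :: "'a \<Rightarrow> real"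
  assumes fin: "finite A" and q: "q > 1" and qq: "1/q + 1/q' = 1"
    and f: "\<And>i. i \<in> A \<Longrightarrow> 0 \<le> f i" and g: "\<And>i. i \<in> A \<Longrightarrow> 0 \<le> g i"
  shows "(\<Sum>i\<in>A. f i * g i) \<le> (\<Sum>i\<in>A. f i powr q) powr (1/q) * (\<Sum>i\<in>A. g i powr q') powr (1/q')"
proof -
  define F where "F = (\<Sum>i\<in>A. f i powr q)"
  define G where "G = (\<Sum>i\<in>A. g i powr q')"
  have q'1: "q' > 1"
  proof -
    have "1/q' = 1 - 1/q" using qq by simp
    moreover have "0 < 1 - 1/q" "1 - 1/q < 1" using q by auto
    ultimately have "0 < 1/q'" "1/q' < 1" by auto
    then show ?thesis by (simp add: divide_less_eq split: if_splits)
  qed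
  have F0: "F \<ge> 0" "G \<ge> 0" unfolding F_def G_def by (auto intro: sum_nonneg)
  show ?thesis
  proof (cases "F = 0 \<or> G = 0")
    case True
    then have "f i * g i = 0" if "i \<in> A" for i
    proof
      assume "F = 0"
      then have "f i powr q = 0" using that fin unfolding F_def
        by (simp add: sum_nonneg_eq_0_iff)
      then show ?thesis by simp
    next
      assume "G = 0"
      then have "g i powr q' = 0" using that fin unfolding G_def
        by (simp add: sum_nonneg_eq_0_iff)
      then show ?thesis by simp
    qed
    then have "(\<Sum>i\<in>A. f i * g i) = 0" by (intro sum.neutral ballI)
    then show ?thesis by simp
  next
    case False
    then have pos: "F > 0" "G > 0" using F0 by auto
    define a b where "a = F powr (1/q)" and "b = G powr (1/q')"
    have ab: "a > 0" "b > 0" using pos by (auto simp: a_def b_def)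
    have aq: "a powr q = F" "b powr q' = G" using pos q q'1 by (auto simp: a_def b_def powr_powr)
    have "(\<Sum>i\<in>A. (f i / a) * (g i / b)) \<le> (\<Sum>i\<in>A. (f i / a) powr q / q + (g i / b) powr q' / q')"
      by (rule sum_mono, rule Youngs_inequality) (use q q'1 qq f g ab in auto)
    also have "\<dots> = (\<Sum>i\<in>A. f i powr q / (F * q)) + (\<Sum>i\<in>A. g i powr q' / (G * q'))"
      unfolding sum.distrib by (intro arg_cong2[where f="(+)"] sum.cong refl)
         (use ab f g in \<open>auto simp: powr_divide aq\<close>)
    also have "\<dots> = F / (F*q) + G / (G*q')"
      by (simp add: F_def G_def flip: sum_divide_distrib)
    also have "\<dots> = 1" using pos qq by simp
    finally have "(\<Sum>i\<in>A. f i * g i) / (a*b) \<le> 1"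
      by (simp add: sum_divide_distrib)
    then have "(\<Sum>i\<in>A. f i * g i) \<le> a * b" using ab by (simp add: pos_divide_le_eq)
    then show ?thesis by (simp add: a_def b_def F_def G_def)
  qed
qed

text \<open>Hoelder applied to the splitting \<open>w i = w i powr (1/s) * w i powr (1/q')\<close>.
  This is Jensen's inequality for weights of arbitrary total mass, whence the power
  \<open>s - 1\<close> of that mass.\<close>

lemma weighted_power_mean:
  fixes w x :: "'a \<Rightarrow> real"
  assumes fin: "finite A" and s: "s \<ge> 1"
    and w: "\<And>i. i \<in> A \<Longrightarrow> 0 \<le> w i" and x: "\<And>i. i \<in> A \<Longrightarrow> 0 \<le> x i"
  shows "(\<Sum>i\<in>A. w i * x i) powr s \<le> (\<Sum>i\<in>A. w i) powr (s - 1) * (\<Sum>i\<in>A. w i * x i powr s)"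
proof (cases "s = 1")
  case True
  have nn: "(\<Sum>i\<in>A. w i * x i) \<ge> 0" by (intro sum_nonneg mult_nonneg_nonneg w x)
  show ?thesis
  \<comment> \<open>Since \<open>0 powr 0 = 0\<close>, for \<open>s = 1\<close> the first factor on
    the right is 0 instead of 1 when all weights vanish.\<close>
  proof (cases "(\<Sum>i\<in>A. w i) = 0")
    case True
    then have "w i = 0" if "i \<in> A" for i using that fin w by (simp add: sum_nonneg_eq_0_iff)
    then show ?thesis by simp
  next
    case False
    then show ?thesis using nn \<open>s = 1\<close> x w by (simp add: sum_nonneg cong: sum.cong)
  qed
next
  case False
  then have s1: "s > 1" using s by simp
  define q' where "q' = s / (s - 1)"
  have q: "1/s + 1/q' = 1" "1/q' = (s-1)/s" using s1 by (auto simp: q'_def field_simps)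
  have q'0: "q' > 0" using s1 by (simp add: q'_def)
  have "(\<Sum>i\<in>A. w i * x i) = (\<Sum>i\<in>A. (w i powr (1/s) * x i) * w i powr (1/q'))"
  proof (rule sum.cong)
    fix i assume "i \<in> A"
    have "w i powr (1/s) * w i powr (1/q') = w i" using w[OF \<open>i \<in> A\<close>] q by (simp flip: powr_add)
    then show "w i * x i = (w i powr (1/s) * x i) * w i powr (1/q')" by (metis mult.commute mult.left_commute)
  qed simp
  also have "\<dots> \<le> (\<Sum>i\<in>A. (w i powr (1/s) * x i) powr s) powr (1/s) * (\<Sum>i\<in>A. (w i powr (1/q')) powr q') powr (1/q')"
    by (rule holder_sum) (use fin s1 q w x in auto)
  also have "(\<Sum>i\<in>A. (w i powr (1/s) * x i) powr s) = (\<Sum>i\<in>A. w i * x i powr s)"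
    by (rule sum.cong) (use w x s1 in \<open>auto simp: powr_mult powr_powr\<close>)
  also have "(\<Sum>i\<in>A. (w i powr (1/q')) powr q') = (\<Sum>i\<in>A. w i)"
    by (rule sum.cong) (use w q'0 in \<open>auto simp: powr_powr\<close>)
  finally have *: "(\<Sum>i\<in>A. w i * x i) \<le> (\<Sum>i\<in>A. w i * x i powr s) powr (1/s) * (\<Sum>i\<in>A. w i) powr (1/q')" .
  have "(\<Sum>i\<in>A. w i * x i) powr s \<le> ((\<Sum>i\<in>A. w i * x i powr s) powr (1/s) * (\<Sum>i\<in>A. w i) powr (1/q')) powr s"
    by (rule powr_mono2) (use s1 * w x in \<open>auto intro!: sum_nonneg\<close>)
  also have "\<dots> = (\<Sum>i\<in>A. w i * x i powr s) * (\<Sum>i\<in>A. w i) powr (s - 1)"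
    using s1 w x by (simp add: powr_mult powr_powr q sum_nonneg)
  finally show ?thesis by (simp add: mult.commute)
qed

definition lnorm :: "real \<Rightarrow> 'a set \<Rightarrow> ('a \<Rightarrow> real) \<Rightarrow> real" where
  "lnorm s A f = (\<Sum>i\<in>A. f i powr s) powr (1/s)"

lemma lnorm_nonneg [simp]: "0 \<le> lnorm s A f"
  by (simp add: lnorm_def)

lemma lnorm_powr: "s > 0 \<Longrightarrow> lnorm s A f powr s = (\<Sum>i\<in>A. f i powr s)"
  by (simp add: lnorm_def powr_powr sum_nonneg)

lemma lnorm_mono:
  assumes "s > 0" "\<And>i. i \<in> A \<Longrightarrow> 0 \<le> f i" "\<And>i. i \<in> A \<Longrightarrow> f i \<le> g i"
  shows "lnorm s A f \<le> lnorm s A g"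
  unfolding lnorm_def
  using assms by (intro powr_mono2 sum_mono sum_nonneg) auto

lemma lnorm_add:
  assumes fin: "finite A" and s: "s > 1"
    and f: "\<And>i. i \<in> A \<Longrightarrow> 0 \<le> f i" and g: "\<And>i. i \<in> A \<Longrightarrow> 0 \<le> g i"
  shows "lnorm s A (\<lambda>i. f i + g i) \<le> lnorm s A f + lnorm s A g"
proof (cases "lnorm s A (\<lambda>i. f i + g i) = 0")
  case True then show ?thesis by (simp add: add_nonneg_nonneg)
next
  case False
  define N where "N = lnorm s A (\<lambda>i. f i + g i)"
  have N: "N > 0" using False by (simp add: N_def order_less_le)
  define q' where "q' = s / (s - 1)"
  have q: "1/s + 1/q' = 1" "1/q' = (s-1)/s" using s by (auto simp: q'_def field_simps)
  have *: "(\<Sum>i\<in>A. h i * (f i + g i) powr (s-1)) \<le> lnorm s A h * N powr (s-1)"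
    if h: "\<And>i. i \<in> A \<Longrightarrow> 0 \<le> h i" for h
  proof -
    have "(\<Sum>i\<in>A. h i * (f i + g i) powr (s-1)) \<le> (\<Sum>i\<in>A. h i powr s) powr (1/s)
       * (\<Sum>i\<in>A. ((f i + g i) powr (s-1)) powr q') powr (1/q')"
      by (rule holder_sum) (use fin s q h in auto)
    also have "(\<Sum>i\<in>A. ((f i + g i) powr (s-1)) powr q') = (\<Sum>i\<in>A. (f i + g i) powr s)"
      using s by (simp add: powr_powr q'_def)
    also have "\<dots> powr (1/q') = N powr (s-1)"
      using s by (simp add: N_def lnorm_def powr_powr q)
    finally show ?thesis by (simp add: lnorm_def)
  qed
  have "N powr s = (\<Sum>i\<in>A. (f i + g i) * (f i + g i) powr (s-1))"
    unfolding N_def using s f g by (subst lnorm_powr) (auto intro!: sum.cong simp: powr_mult_base)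
  also have "\<dots> \<le> (lnorm s A f + lnorm s A g) * N powr (s-1)"
    using add_mono[OF *[of f] *[of g]] f g by (simp add: distrib_right sum.distrib)
  finally have "N * N powr (s-1) \<le> (lnorm s A f + lnorm s A g) * N powr (s-1)"
    using N by (simp add: powr_mult_base)
  then show ?thesis using N by (simp add: N_def)
qed

lemma lnorm_scale:
  assumes "s > 0" "c \<ge> 0" "\<And>i. i \<in> A \<Longrightarrow> 0 \<le> f i"
  shows "lnorm s A (\<lambda>i. c * f i) = c * lnorm s A f"
proof -
  have "(\<Sum>i\<in>A. (c * f i) powr s) = c powr s * (\<Sum>i\<in>A. f i powr s)"
    unfolding sum_distrib_left by (rule sum.cong) (use assms in \<open>auto simp: powr_mult\<close>)
  then show ?thesis using assms by (simp add: lnorm_def powr_mult powr_powr sum_nonneg)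
qed

lemma lnorm_sum:
  assumes fin: "finite A" and s: "s > 1" and T: "finite T"
    and f: "\<And>i t. i \<in> A \<Longrightarrow> t \<in> T \<Longrightarrow> 0 \<le> f t i"
  shows "lnorm s A (\<lambda>i. \<Sum>t\<in>T. f t i) \<le> (\<Sum>t\<in>T. lnorm s A (f t))"
  using T f
proof (induction T)
  case empty then show ?case by (simp add: lnorm_def)
next
  case (insert t T)
  have "lnorm s A (\<lambda>i. \<Sum>t\<in>insert t T. f t i) = lnorm s A (\<lambda>i. f t i + (\<Sum>t\<in>T. f t i))"
    using insert by simp
  also have "\<dots> \<le> lnorm s A (f t) + lnorm s A (\<lambda>i. \<Sum>t\<in>T. f t i)"
    by (rule lnorm_add) (use fin s insert in \<open>auto intro!: sum_nonneg\<close>)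
  finally show ?case using insert by fastforce
qed

text \<open>Each entry is at most the \<ell>_s norm, so the surplus power \<open>t - s\<close> can
  be pulled out of the sum.\<close>

lemma lnorm_antimono:
  assumes fin: "finite A" and s: "0 < s" "s \<le> t"
    and f: "\<And>i. i \<in> A \<Longrightarrow> 0 \<le> f i"
  shows "lnorm t A f \<le> lnorm s A f"
proof -
  define S where "S = (\<Sum>i\<in>A. f i powr s)"
  have S0: "S \<ge> 0" by (auto simp: S_def intro: sum_nonneg)
  have le: "f i \<le> S powr (1/s)" if "i \<in> A" for i
  proof -
    have "f i powr s \<le> S" unfolding S_def by (rule member_le_sum) (use that fin in auto)
    then have "(f i powr s) powr (1/s) \<le> S powr (1/s)" by (rule powr_mono2[rotated 2]) (use s in auto)
    then show ?thesis using f[OF that] s by (simp add: powr_powr)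
  qed
  have "(\<Sum>i\<in>A. f i powr t) \<le> (\<Sum>i\<in>A. f i powr s * (S powr (1/s)) powr (t - s))"
  proof (rule sum_mono)
    fix i assume i: "i \<in> A"
    have "f i powr t = f i powr s * f i powr (t - s)" by (simp flip: powr_add)
    also have "\<dots> \<le> f i powr s * (S powr (1/s)) powr (t - s)"
      by (intro mult_left_mono powr_mono2) (use le[OF i] f[OF i] s in auto)
    finally show "f i powr t \<le> f i powr s * (S powr (1/s)) powr (t - s)" .
  qed
  also have "\<dots> = S * S powr ((t-s)/s)"
    by (simp add: S_def powr_powr flip: sum_distrib_right)
  also have "\<dots> = S powr (t/s)"
    using S0 s by (simp add: powr_mult_base diff_divide_distrib)
  finally have "(\<Sum>i\<in>A. f i powr t) powr (1/t) \<le> (S powr (t/s)) powr (1/t)"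
    by (rule powr_mono2[rotated 2]) (use s in \<open>auto intro: sum_nonneg\<close>)
  also have "\<dots> = S powr (1/s)" using s by (simp add: powr_powr)
  finally show ?thesis by (simp add: lnorm_def S_def)
qed

lemma sum_dyadic_Suc:
  fixes f :: "nat \<Rightarrow> 'b::comm_monoid_add"
  shows "(\<Sum>n<2^Suc j. f n) = (\<Sum>n<2^j. f (2*n) + f (2*n+1))"
proof -
  have "(\<Sum>n<2*m. f n) = (\<Sum>n<m. f (2*n) + f (2*n+1))" for m
    by (induction m) (auto simp: algebra_simps)
  then show ?thesis by simp
qed

text \<open>The differences \<open>a (Suc j) n - a j (n div 2)\<close> are orthogonal in \<open>\<ell>\<^sub>2\<close>, and passing to the finer level
  costs the factor \<open>\<gamma>\<close> in the normalised \<open>\<ell>\<^sub>\<kappa>\<close> norm, which is \<open>< 1\<close> exactly because \<open>\<kappa> > 2\<close>.\<close>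

lemma dyadic_embedding_1d:
  fixes a :: "nat \<Rightarrow> nat \<Rightarrow> real"
  assumes k: "\<kappa> > 2"
    and a: "\<And>j n. a j n \<ge> 0"
    and rec: "\<And>j n. j < J \<Longrightarrow> n < 2^j \<Longrightarrow> a j n = (a (Suc j) (2*n) + a (Suc j) (2*n+1)) / 2"
  defines "\<gamma> \<equiv> 2 powr (1/\<kappa> - 1/2)"
  shows "(\<Sum>j\<le>J. (lnorm \<kappa> {..<2^j} (a j))\<^sup>2 / 2^j) \<le> (\<Sum>n<2^J. (a J n)\<^sup>2) / 2^J / (1 - \<gamma>)\<^sup>2"
proof -
  have "1/\<kappa> < 1/2" using k by (simp add: field_simps)
  then have g: "0 < \<gamma>" "\<gamma> < 1" by (auto simp: \<gamma>_def powr_less_one)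
  define b where "b j n = \<bar>a (Suc j) n - a j (n div 2)\<bar>" for j n
  define \<alpha> where "\<alpha> j = lnorm \<kappa> {..<2^j} (a j) / 2 powr (j/2)" for j :: nat
  define \<beta> where "\<beta> j = lnorm 2 {..<2^Suc j} (b j) / 2 powr (Suc j/2)" for j :: nat
  have sq2: "(x / 2 powr (real m/2))\<^sup>2 = x\<^sup>2 / 2^m" for x m
    by (simp add: power_divide powr_half_sqrt_powr powr_realpow)
  have ln2: "(lnorm 2 A f)\<^sup>2 = (\<Sum>i\<in>A. (f i)\<^sup>2)" if "\<And>i. i \<in> A \<Longrightarrow> 0 \<le> f i" for A :: "nat set" and f
  proof -
    have "(lnorm 2 A f)\<^sup>2 = lnorm 2 A f powr 2" by simp
    also have "\<dots> = (\<Sum>i\<in>A. (f i)\<^sup>2)" using that by (subst lnorm_powr) auto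
    finally show ?thesis .
  qed
  have \<alpha>2: "(\<alpha> j)\<^sup>2 = (lnorm \<kappa> {..<2^j} (a j))\<^sup>2 / 2^j" for j unfolding \<alpha>_def sq2 ..
  have \<beta>2: "(\<beta> j)\<^sup>2 = (\<Sum>n<2^Suc j. (b j n)\<^sup>2) / 2^Suc j" for j
    unfolding \<beta>_def sq2 by (subst ln2) (auto simp: b_def)
  \<comment> \<open>Parallelogram law for each pair of siblings: their mean is the parent value, so
    the cross terms between parent and differences cancel.\<close>
  have pyth: "(\<Sum>n<2^Suc j. (a (Suc j) n)\<^sup>2) / 2^Suc j = (\<Sum>n<2^j. (a j n)\<^sup>2) / 2^j + (\<beta> j)\<^sup>2" if "j < J" for j
  proof -
    have "(\<Sum>n<2^Suc j. (a (Suc j) n)\<^sup>2) = (\<Sum>n<2^j. 2 * (a j n)\<^sup>2) + (\<Sum>n<2^Suc j. (b j n)\<^sup>2)"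
      unfolding sum_dyadic_Suc sum.distrib[symmetric]
      by (rule sum.cong) (auto simp: b_def rec[OF that] power2_eq_square field_simps)
    then show ?thesis by (simp add: \<beta>2 add_divide_distrib flip: sum_distrib_left)
  qed
  have tot: "(\<Sum>n<2^m. (a m n)\<^sup>2) / 2^m = (a 0 0)\<^sup>2 + (\<Sum>j<m. (\<beta> j)\<^sup>2)" if "m \<le> J" for m
    using that
  proof (induction m)
    case (Suc m)
    then show ?case using pyth[of m] by simp
  qed simp
  have step: "\<alpha> (Suc j) \<le> \<gamma> * \<alpha> j + \<beta> j" if "j < J" for j
  proof -
    have "lnorm \<kappa> {..<2^Suc j} (a (Suc j)) \<le> lnorm \<kappa> {..<2^Suc j} (\<lambda>n. a j (n div 2) + b j n)"
      by (rule lnorm_mono) (use k a in \<open>auto simp: b_def\<close>)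
    also have "\<dots> \<le> lnorm \<kappa> {..<2^Suc j} (\<lambda>n. a j (n div 2)) + lnorm \<kappa> {..<2^Suc j} (b j)"
      by (rule lnorm_add) (use k a in \<open>auto simp: b_def\<close>)
    also have "lnorm \<kappa> {..<2^Suc j} (\<lambda>n. a j (n div 2)) = 2 powr (1/\<kappa>) * lnorm \<kappa> {..<2^j} (a j)"
      unfolding lnorm_def sum_dyadic_Suc
      by (simp add: powr_mult sum_nonneg flip: sum_distrib_left mult_2)
    also have "lnorm \<kappa> {..<2^Suc j} (b j) \<le> lnorm 2 {..<2^Suc j} (b j)"
      by (rule lnorm_antimono) (use k in \<open>auto simp: b_def\<close>)
    finally have "\<alpha> (Suc j) \<le> (2 powr (1/\<kappa>) * lnorm \<kappa> {..<2^j} (a j) + lnorm 2 {..<2^Suc j} (b j)) / 2 powr (Suc j/2)"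
      unfolding \<alpha>_def by (intro divide_right_mono) auto
    also have "\<dots> = \<gamma> * \<alpha> j + \<beta> j"
      by (simp add: \<gamma>_def \<alpha>_def \<beta>_def add_divide_distrib powr_diff powr_add)
    finally show ?thesis .
  qed
  have step2: "(\<alpha> (Suc j))\<^sup>2 \<le> \<gamma> * (\<alpha> j)\<^sup>2 + (\<beta> j)\<^sup>2 / (1-\<gamma>)" if "j < J" for j
  proof -
    have "(\<alpha> (Suc j))\<^sup>2 \<le> (\<gamma> * \<alpha> j + \<beta> j)\<^sup>2"
      by (rule power_mono) (use step[OF that] in \<open>auto simp: \<alpha>_def\<close>)
    \<comment> \<open>Convexity of the square with weights \<open>\<gamma>\<close> and
      \<open>1-\<gamma>\<close> at the points \<open>\<alpha> j\<close> and
      \<open>\<beta> j / (1-\<gamma>)\<close>. A single factor \<open>\<gamma> < 1\<close> survives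
      in front of the square, which keeps the recursion summable.\<close>
    also have "\<dots> \<le> \<gamma> * (\<alpha> j)\<^sup>2 + (\<beta> j)\<^sup>2 / (1-\<gamma>)"
    proof -
      have "\<gamma> * (\<alpha> j)\<^sup>2 + (\<beta> j)\<^sup>2 / (1-\<gamma>) - (\<gamma> * \<alpha> j + \<beta> j)\<^sup>2 = \<gamma> / (1-\<gamma>) * ((1-\<gamma>) * \<alpha> j - \<beta> j)\<^sup>2"
        using g by (simp add: field_simps power2_eq_square)
      also have "\<dots> \<ge> 0" using g by simp
      finally show ?thesis by simp
    qed
    finally show ?thesis .
  qed
  have "\<alpha> 0 = a 0 0"
    using a[of 0 0] k by (simp add: \<alpha>_def lnorm_def powr_powr lessThan_Suc)
  \<comment> \<open>The extra \<open>\<gamma> * (\<alpha> m)\<^sup>2\<close> on the left is the term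
    that \<open>step2\<close> consumes at the next level.\<close>
  have "(\<Sum>j\<le>m. (\<alpha> j)\<^sup>2) * (1-\<gamma>) + \<gamma> * (\<alpha> m)\<^sup>2 \<le> ((a 0 0)\<^sup>2 + (\<Sum>j<m. (\<beta> j)\<^sup>2)) / (1-\<gamma>)" if "m \<le> J" for m
    using that
  proof (induction m)
    case 0
    have "1 \<le> 1 / (1-\<gamma>)" using g by simp
    then have "(a 0 0)\<^sup>2 * 1 \<le> (a 0 0)\<^sup>2 * (1 / (1-\<gamma>))" by (intro mult_left_mono) auto
    then show ?case by (simp add: \<open>\<alpha> 0 = a 0 0\<close> algebra_simps)
  next
    case (Suc m)
    then show ?case using step2[of m] by (simp add: algebra_simps add_divide_distrib)
  qed
  from this[of J] have "(\<Sum>j\<le>J. (\<alpha> j)\<^sup>2) * (1-\<gamma>) \<le> (\<Sum>n<2^J. (a J n)\<^sup>2) / 2^J / (1-\<gamma>)"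
    using g by (simp add: tot) (smt (verit) mult_nonneg_nonneg zero_le_power2)
  then have "(\<Sum>j\<le>J. (\<alpha> j)\<^sup>2) \<le> (\<Sum>n<2^J. (a J n)\<^sup>2) / 2^J / (1-\<gamma>)\<^sup>2"
    using g by (simp add: power2_eq_square pos_le_divide_eq mult_ac)
  then show ?thesis unfolding \<alpha>2 .
qed

section \<open>Product grids and multivariate dyadic averages\<close>

lemma sum_PiE_insert:
  fixes F :: "('i \<Rightarrow> 'b) \<Rightarrow> 'c::comm_monoid_add"
  assumes a: "a \<notin> A"
  shows "(\<Sum>v\<in>PiE (insert a A) S. F v) = (\<Sum>t\<in>S a. \<Sum>v\<in>PiE A S. F (v(a := t)))"
proof -
  have inj: "inj_on (\<lambda>(y, g). g(a := y)) (S a \<times> PiE A S)"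
  proof (rule inj_onI, clarify)
    fix y y' g g' assume g: "g \<in> PiE A S" "g' \<in> PiE A S" and eq: "g(a := y) = g'(a := y')"
    have "y = y'" using fun_cong[OF eq, of a] by simp
    moreover have "g i = g' i" for i
    proof (cases "i = a")
      case True then show ?thesis using g a by (auto simp: PiE_def extensional_def)
    next
      case False then show ?thesis using fun_cong[OF eq, of i] by simp
    qed
    ultimately show "y = y' \<and> g = g'" by auto
  qed
  have "PiE (insert a A) S = (\<lambda>(y, g). g(a := y)) ` (S a \<times> PiE A S)"
    by (rule PiE_insert_eq)
  then show ?thesis
    using sum.reindex[OF inj, of F] by (simp add: sum.cartesian_product split_beta comp_def)
qed

lemma sum_PiE_Suc:
  fixes F :: "(nat \<Rightarrow> 'b) \<Rightarrow> 'c::comm_monoid_add"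
  shows "(\<Sum>v\<in>PiE {..<Suc d} S. F v) = (\<Sum>t\<in>S d. \<Sum>v\<in>PiE {..<d} S. F (v(d := t)))"
  unfolding lessThan_Suc by (rule sum_PiE_insert) simp

text \<open>A function \<open>A\<close> on the finest grid \<open>dgrid d (\<lambda>_. J)\<close> stands for a step function on the cube;
  \<open>bavg d J l A n\<close> is its mean over the dyadic box number \<open>n\<close> of level \<open>l\<close>. All of this is meant for
  \<open>l i \<le> J\<close>, since \<open>J - l i\<close> is truncated.\<close>

definition dgrid :: "nat \<Rightarrow> (nat \<Rightarrow> nat) \<Rightarrow> (nat \<Rightarrow> nat) set" where
  "dgrid d l = PiE {..<d} (\<lambda>i. {..<2 ^ l i})"

definition dblock :: "nat \<Rightarrow> nat \<Rightarrow> nat \<Rightarrow> nat set" where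
  "dblock J m k = {k * 2 ^ (J - m)..<Suc k * 2 ^ (J - m)}"

definition bavg :: "nat \<Rightarrow> nat \<Rightarrow> (nat \<Rightarrow> nat) \<Rightarrow> ((nat \<Rightarrow> nat) \<Rightarrow> real) \<Rightarrow> (nat \<Rightarrow> nat) \<Rightarrow> real" where
  "bavg d J l A n = (\<Sum>v\<in>PiE {..<d} (\<lambda>i. dblock J (l i) (n i)). A v) / 2 ^ (\<Sum>i<d. J - l i)"

lemma finite_dgrid [simp]: "finite (dgrid d l)"
  unfolding dgrid_def by (rule finite_PiE) auto

lemma finite_dblock [simp]: "finite (dblock J m k)"
  unfolding dblock_def by auto

lemma bavg_nonneg: "(\<And>v. 0 \<le> A v) \<Longrightarrow> 0 \<le> bavg d J l A n"
  unfolding bavg_def by (intro divide_nonneg_nonneg sum_nonneg) auto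

lemma dgrid_cong: "(\<And>i. i < d \<Longrightarrow> l i = l' i) \<Longrightarrow> dgrid d l = dgrid d l'"
  unfolding dgrid_def by (rule PiE_cong) auto

lemma bavg_cong: "(\<And>i. i < d \<Longrightarrow> l i = l' i) \<Longrightarrow> (\<And>i. i < d \<Longrightarrow> n i = n' i) \<Longrightarrow> bavg d J l A n = bavg d J l' A n'"
  unfolding bavg_def by (intro arg_cong2[where f="(/)"] arg_cong2[where f="sum"] arg_cong2[where f="power"] PiE_cong sum.cong) auto

lemma bavg_Suc:
  "bavg (Suc d) J l A n = (\<Sum>t\<in>dblock J (l d) (n d). bavg d J l (\<lambda>v. A (v(d := t))) n) / 2 ^ (J - l d)"
  unfolding bavg_def sum_PiE_Suc by (simp add: power_add flip: sum_divide_distrib)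

lemma sum_dblock_split:
  fixes f :: "nat \<Rightarrow> real"
  assumes "m < J"
  shows "(\<Sum>t\<in>dblock J m k. f t) = (\<Sum>t\<in>dblock J (Suc m) (2*k). f t) + (\<Sum>t\<in>dblock J (Suc m) (2*k+1). f t)"
proof -
  have p: "(2::nat) ^ (J - m) = 2 * 2 ^ (J - Suc m)" using assms by (metis Suc_diff_Suc power_Suc)
  have "dblock J m k = dblock J (Suc m) (2*k) \<union> dblock J (Suc m) (2*k+1)"
    unfolding dblock_def p by (auto simp: algebra_simps)
  moreover have "dblock J (Suc m) (2*k) \<inter> dblock J (Suc m) (2*k+1) = {}"
    unfolding dblock_def by auto
  ultimately show ?thesis by (simp add: sum.union_disjoint)
qed

text \<open>Induction over the coordinates with the last variable \<open>t\<close> split off.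
  Minkowski moves the \<ell>_\<kappa> norm in the first \<open>d\<close> variables inside the
  average over \<open>t\<close>, so the slice norms \<open>B l t\<close> act as one function of
  \<open>t\<close>, to which the one-dimensional case applies. The induction hypothesis then treats
  every slice \<open>At t\<close>. Each coordinate costs the factor \<open>C\<close>, independently
  of \<open>J\<close>.\<close>

lemma dyadic_embedding:
  fixes A :: "(nat \<Rightarrow> nat) \<Rightarrow> real"
  assumes k: "\<kappa> > 2" and A: "\<And>v. A v \<ge> 0"
  defines "C \<equiv> 1 / (1 - 2 powr (1/\<kappa> - 1/2))\<^sup>2"
  shows "(\<Sum>l\<in>PiE {..<d} (\<lambda>_. {..J}). (lnorm \<kappa> (dgrid d l) (bavg d J l A))\<^sup>2 / 2 ^ (\<Sum>i<d. l i))
     \<le> C ^ d * ((\<Sum>v\<in>dgrid d (\<lambda>_. J). (A v)\<^sup>2) / 2 ^ (J * d))"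
  using A
proof (induction d arbitrary: A)
  case 0
  show ?case using k 0 by (simp add: dgrid_def bavg_def lnorm_def powr_powr)
next
  case (Suc d)
  define At where "At t v = A (v(d := t))" for t v
  define B where "B l t = lnorm \<kappa> (dgrid d l) (bavg d J l (At t))" for l t
  define a where "a l m k = (\<Sum>t\<in>dblock J m k. B l t) / 2 ^ (J - m)" for l m k
  have At: "At t v \<ge> 0" for t v by (simp add: At_def Suc.prems)
  have C0: "C \<ge> 0" by (simp add: C_def)
  have le: "lnorm \<kappa> (dgrid (Suc d) (l(d := m))) (bavg (Suc d) J (l(d := m)) A) \<le> lnorm \<kappa> {..<2^m} (a l m)" for l m
  proof -
    let ?l = "l(d := m)"
    have g: "dgrid d ?l = dgrid d l" by (rule dgrid_cong) auto
    have b: "bavg d J ?l A' (n(d := k)) = bavg d J l A' n" for A' n k by (rule bavg_cong) auto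
    have "(\<Sum>n\<in>dgrid (Suc d) ?l. bavg (Suc d) J ?l A n powr \<kappa>)
        = (\<Sum>k<2^m. \<Sum>n\<in>dgrid d l. ((\<Sum>t\<in>dblock J m k. bavg d J l (At t) n) / 2 ^ (J - m)) powr \<kappa>)"
      unfolding dgrid_def sum_PiE_Suc using g[unfolded dgrid_def] by (simp add: bavg_Suc b At_def[abs_def])
    also have "\<dots> \<le> (\<Sum>k<2^m. a l m k powr \<kappa>)"
    proof (rule sum_mono)
      fix k
      have "(\<Sum>n\<in>dgrid d l. ((\<Sum>t\<in>dblock J m k. bavg d J l (At t) n) / 2 ^ (J - m)) powr \<kappa>)
         = lnorm \<kappa> (dgrid d l) (\<lambda>n. 1 / 2 ^ (J - m) * (\<Sum>t\<in>dblock J m k. bavg d J l (At t) n)) powr \<kappa>"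
        using \<open>\<kappa> > 2\<close> by (subst lnorm_powr) auto
      also have "\<dots> \<le> a l m k powr \<kappa>"
      proof (rule powr_mono2)
        have "lnorm \<kappa> (dgrid d l) (\<lambda>n. 1 / 2 ^ (J - m) * (\<Sum>t\<in>dblock J m k. bavg d J l (At t) n))
          = 1 / 2 ^ (J - m) * lnorm \<kappa> (dgrid d l) (\<lambda>n. (\<Sum>t\<in>dblock J m k. bavg d J l (At t) n))"
          by (rule lnorm_scale) (use \<open>\<kappa> > 2\<close> in \<open>auto intro!: sum_nonneg bavg_nonneg At\<close>)
        also have "\<dots> \<le> 1 / 2 ^ (J - m) * (\<Sum>t\<in>dblock J m k. B l t)"
          unfolding B_def
          by (intro mult_left_mono lnorm_sum) (use \<open>\<kappa> > 2\<close> in \<open>auto intro!: bavg_nonneg At\<close>)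
        finally show "lnorm \<kappa> (dgrid d l) (\<lambda>n. 1 / 2 ^ (J - m) * (\<Sum>t\<in>dblock J m k. bavg d J l (At t) n)) \<le> a l m k"
          by (simp add: a_def)
      qed (use \<open>\<kappa> > 2\<close> in auto)
      finally show "(\<Sum>n\<in>dgrid d l. ((\<Sum>t\<in>dblock J m k. bavg d J l (At t) n) / 2 ^ (J - m)) powr \<kappa>) \<le> a l m k powr \<kappa>" .
    qed
    finally show ?thesis unfolding lnorm_def
      by (rule powr_mono2[rotated 2]) (use \<open>\<kappa> > 2\<close> in \<open>auto intro!: sum_nonneg\<close>)
  qed
  have one: "(\<Sum>m\<le>J. (lnorm \<kappa> {..<2^m} (a l m))\<^sup>2 / 2^m) \<le> C * ((\<Sum>t<2^J. (B l t)\<^sup>2) / 2^J)" for l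
  proof -
    have "(\<Sum>m\<le>J. (lnorm \<kappa> {..<2^m} (a l m))\<^sup>2 / 2^m) \<le> (\<Sum>n<2^J. (a l J n)\<^sup>2) / 2^J / (1 - 2 powr (1/\<kappa> - 1/2))\<^sup>2"
    proof (rule dyadic_embedding_1d)
      fix m k assume "m < J"
      have p: "(2::real) ^ (J - m) = 2 * 2 ^ (J - Suc m)" using \<open>m < J\<close> by (metis Suc_diff_Suc power_Suc)
      show "a l m k = (a l (Suc m) (2 * k) + a l (Suc m) (2 * k + 1)) / 2"
        unfolding a_def sum_dblock_split[OF \<open>m < J\<close>] p by (simp add: field_simps)
    qed (use \<open>\<kappa> > 2\<close> in \<open>auto simp: a_def B_def intro!: sum_nonneg divide_nonneg_nonneg\<close>)
    moreover have "a l J n = B l n" for n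
      by (simp add: a_def dblock_def)
    ultimately show ?thesis by (simp add: C_def mult.commute)
  qed
  have "(\<Sum>l\<in>PiE {..<Suc d} (\<lambda>_. {..J}). (lnorm \<kappa> (dgrid (Suc d) l) (bavg (Suc d) J l A))\<^sup>2 / 2 ^ (\<Sum>i<Suc d. l i))
     = (\<Sum>m\<le>J. \<Sum>l\<in>PiE {..<d} (\<lambda>_. {..J}). (lnorm \<kappa> (dgrid (Suc d) (l(d := m))) (bavg (Suc d) J (l(d := m)) A))\<^sup>2 / (2 ^ (\<Sum>i<d. l i) * 2^m))"
    unfolding sum_PiE_Suc by (simp add: power_add)
  also have "\<dots> \<le> (\<Sum>m\<le>J. \<Sum>l\<in>PiE {..<d} (\<lambda>_. {..J}). (lnorm \<kappa> {..<2^m} (a l m))\<^sup>2 / (2 ^ (\<Sum>i<d. l i) * 2^m))"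
    by (intro sum_mono divide_right_mono power_mono le) auto
  also have "\<dots> = (\<Sum>l\<in>PiE {..<d} (\<lambda>_. {..J}). (\<Sum>m\<le>J. (lnorm \<kappa> {..<2^m} (a l m))\<^sup>2 / 2^m) / 2 ^ (\<Sum>i<d. l i))"
    by (subst sum.swap) (simp add: sum_divide_distrib mult.commute)
  also have "\<dots> \<le> (\<Sum>l\<in>PiE {..<d} (\<lambda>_. {..J}). C * ((\<Sum>t<2^J. (B l t)\<^sup>2) / 2^J) / 2 ^ (\<Sum>i<d. l i))"
    by (intro sum_mono divide_right_mono one) auto
  also have "\<dots> = C / 2^J * (\<Sum>t<2^J. \<Sum>l\<in>PiE {..<d} (\<lambda>_. {..J}). (B l t)\<^sup>2 / 2 ^ (\<Sum>i<d. l i))"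
    by (subst sum.swap) (simp add: sum_divide_distrib sum_distrib_left mult_ac)
  also have "\<dots> \<le> C / 2^J * (\<Sum>t<2^J. C ^ d * ((\<Sum>v\<in>dgrid d (\<lambda>_. J). (At t v)\<^sup>2) / 2 ^ (J * d)))"
    unfolding B_def by (intro mult_left_mono sum_mono Suc.IH At divide_nonneg_nonneg C0) auto
  also have "\<dots> = C ^ Suc d * ((\<Sum>t<2^J. \<Sum>v\<in>dgrid d (\<lambda>_. J). (At t v)\<^sup>2) / 2 ^ (J * Suc d))"
    by (simp add: power_add sum_distrib_left sum_divide_distrib mult_ac)
  also have "(\<Sum>t<2^J. \<Sum>v\<in>dgrid d (\<lambda>_. J). (At t v)\<^sup>2) = (\<Sum>v\<in>dgrid (Suc d) (\<lambda>_. J). (A v)\<^sup>2)"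
    unfolding dgrid_def sum_PiE_Suc At_def ..
  finally show ?case .
qed

section \<open>Peetre's inequality on dyadic grids\<close>

text \<open>A distance on the circle that is periodic without a choice of representatives. By
  \<open>chord_eq_1\<close> it is also the quantity that controls geometric sums of
  exponentials.\<close>

definition chord :: "real \<Rightarrow> real \<Rightarrow> real" where
  "chord x y = norm (cis x - cis y)"

lemma chord_nonneg [simp]: "0 \<le> chord x y"
  by (simp add: chord_def)

lemma chord_commute: "chord x y = chord y x"
  by (simp add: chord_def norm_minus_commute)

lemma chord_triangle: "chord x z \<le> chord x y + chord y z"
  unfolding chord_def using norm_triangle_ineq[of "cis x - cis y" "cis y - cis z"] by simp

lemma chord_sin: "chord x y = 2 * \<bar>sin ((x - y) / 2)\<bar>"
proof -
  have "(chord x y)\<^sup>2 = (cos x - cos y)\<^sup>2 + (sin x - sin y)\<^sup>2"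
    unfolding chord_def cmod_power2 by simp
  also have "\<dots> = 2 - 2 * cos (x - y)"
    using sin_cos_squared_add[of x] sin_cos_squared_add[of y] by (simp add: cos_diff power2_diff algebra_simps)
  also have "\<dots> = (2 * \<bar>sin ((x - y) / 2)\<bar>)\<^sup>2"
  proof -
    have "2 * ((x - y) / 2) = x - y" by (simp add: field_simps)
    from cos_double_sin[of "(x-y)/2", unfolded this] show ?thesis
      by (simp add: power_mult_distrib)
  qed
  finally show ?thesis by (rule power2_eq_imp_eq) auto
qed

lemma chord_le: "chord x y \<le> \<bar>x - y\<bar>"
  unfolding chord_sin using abs_sin_x_le_abs_x[of "(x-y)/2"] by simp

lemma chord_eq_1: "norm (cis (x - y) - 1) = chord x y"
proof -
  have "cis (x - y) - 1 = (cis x - cis y) * cis (- y)"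
    by (simp add: algebra_simps cis_mult)
  then show ?thesis by (simp add: chord_def norm_mult)
qed

text \<open>Jordan's inequality: sine is concave on \<open>{0..pi/2}\<close> and hence lies above
  its secant there.\<close>

lemma sin_lower_bound:
  fixes x :: real
  assumes "\<bar>x\<bar> \<le> pi / 2"
  shows "2 / pi * \<bar>x\<bar> \<le> \<bar>sin x\<bar>"
proof -
  have conc: "concave_on {0..pi/2} (sin :: real \<Rightarrow> real)"
  proof (rule f''_le0_imp_concave)
    show "(sin has_real_derivative cos x) (at x)" for x :: real by (rule DERIV_sin)
    show "(cos has_real_derivative - sin x) (at x)" for x :: real by (rule DERIV_cos)
    show "- sin x \<le> 0" if "x \<in> {0..pi/2}" for x :: real using that by (auto intro!: sin_ge_zero)
  qed auto
  have *: "2 / pi * y \<le> sin y" if "0 \<le> y" "y \<le> pi / 2" for y :: real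
    using concave_onD_Icc'[OF conc, of y] that by (simp add: mult.commute)
  show ?thesis
    using *[of x] *[of "-x"] assms by (cases "x \<ge> 0") (auto simp: abs_if split: if_splits)
qed

lemma chord_ge:
  assumes "\<bar>x - y\<bar> \<le> pi"
  shows "2 / pi * \<bar>x - y\<bar> \<le> chord x y"
  unfolding chord_sin using sin_lower_bound[of "(x-y)/2"] assms by simp

lemma sum_periodic_int:
  fixes f :: "int \<Rightarrow> real"
  assumes "\<And>n. f (n + N) = f n" "N \<ge> 0"
  shows "(\<Sum>n\<in>{a..<a+N}. f n) = (\<Sum>n\<in>{0..<N}. f n)"
proof -
  have step: "(\<Sum>n\<in>{a+1..<a+1+N}. f n) = (\<Sum>n\<in>{a..<a+N}. f n)" for a
  proof (cases "N = 0")
    case False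
    then have N: "N \<ge> 1" using assms by simp
    have "{a..<a+N} = insert a {a+1..<a+N}" "{a+1..<a+1+N} = insert (a+N) {a+1..<a+N}" using N by auto
    then show ?thesis using assms(1)[of a] by simp
  qed simp
  show ?thesis
  proof (induction a rule: int_induct[where k=0])
    case base then show ?case by simp
  next
    case (step1 i) then show ?case using step[of i] by simp
  next
    case (step2 i) then show ?case using step[of "i - 1"] by simp
  qed
qed

lemma int_powr_sum_bound:
  fixes s :: real
  assumes s: "s > 1"
  obtains C where "C > 0" "\<And>F :: int set. finite F \<Longrightarrow> (\<Sum>i\<in>F. (max 1 \<bar>real_of_int i\<bar>) powr (-s)) \<le> C"
proof
  define g where "g i = (max 1 \<bar>real_of_int i\<bar>) powr (-s)" for i
  define S where "S = (\<Sum>n. real n powr (-s))"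
  have sm: "summable (\<lambda>n. real n powr (-s))" using s by (simp add: summable_real_powr_iff)
  have S0: "S \<ge> 0" unfolding S_def by (rule suminf_nonneg[OF sm]) auto
  show "1 + 2 * S > 0" using S0 by simp
  fix F :: "int set" assume F: "finite F"
  obtain K :: nat where K: "F \<subseteq> {-int K..int K}"
  proof (cases "F = {}")
    case False
    have "finite (abs ` F)" using F by simp
    then have "\<bar>i\<bar> \<le> Max (abs ` F)" if "i \<in> F" for i using that by simp
    then have "F \<subseteq> {-int (nat (Max (abs ` F)))..int (nat (Max (abs ` F)))}" by fastforce
    then show ?thesis by (rule that)
  qed (use that in auto)
  \<comment> \<open>The term \<open>n = 0\<close> on the right vanishes because
    \<open>0 powr (-s) = 0\<close>; the central term on the left is 1 because of the
    \<open>max\<close>.\<close>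
  have eq: "(\<Sum>i\<in>{-int K..int K}. g i) = 1 + 2 * (\<Sum>n<Suc K. real n powr (-s))" for K
  proof (induction K)
    case 0 then show ?case by (simp add: g_def)
  next
    case (Suc K)
    have "{-int (Suc K)..int (Suc K)} = insert (-int (Suc K)) (insert (int (Suc K)) {-int K..int K})" by auto
    then have "(\<Sum>i\<in>{-int (Suc K)..int (Suc K)}. g i) = g (-int (Suc K)) + g (int (Suc K)) + (\<Sum>i\<in>{-int K..int K}. g i)"
      by simp
    moreover have "g (-int (Suc K)) = real (Suc K) powr (-s)" "g (int (Suc K)) = real (Suc K) powr (-s)"
      by (simp_all add: g_def max_def add.commute)
    ultimately show ?case using Suc by (simp del: of_nat_Suc)
  qed
  have "(\<Sum>i\<in>F. g i) \<le> (\<Sum>i\<in>{-int K..int K}. g i)"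
    by (rule sum_mono2) (use K in \<open>auto simp: g_def\<close>)
  also have "\<dots> \<le> 1 + 2 * S"
    unfolding eq S_def using sum_le_suminf[OF sm, of "{..<Suc K}"] by auto
  finally show "(\<Sum>i\<in>F. (max 1 \<bar>real_of_int i\<bar>) powr (-s)) \<le> 1 + 2 * S" by (simp add: g_def)
qed

definition pt :: "nat \<Rightarrow> nat \<Rightarrow> real" where
  "pt l n = - pi + 2 * pi * real n / 2 ^ l"

text \<open>By periodicity the sum may run over any \<open>2 ^ l\<close> consecutive indices. For
  the window centred at \<open>z\<close> all points are within half a turn, where chord and arc are
  comparable, and a convergent series over the integers dominates the sum.\<close>

lemma chord_sum_bound:
  fixes s :: real
  assumes s: "s > 1"
  obtains C where "C > 0" "\<And>l z. (\<Sum>n<2^l. (1 + 2 ^ l * chord z (pt l n)) powr (-s)) \<le> C"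
proof -
  obtain C where C: "C > 0" "\<And>F :: int set. finite F \<Longrightarrow> (\<Sum>i\<in>F. (max 1 \<bar>real_of_int i\<bar>) powr (-s)) \<le> C"
    using int_powr_sum_bound[OF s] by blast
  show ?thesis
  proof (rule that[OF C(1)])
    fix l z
    define N :: int where "N = 2 ^ l"
    have N: "N > 0" by (simp add: N_def)
    define p where "p n = - pi + 2 * pi * real_of_int n / N" for n :: int
    define f where "f n = (1 + N * chord z (p n)) powr (-s)" for n
    have per: "f (n + N) = f n" for n
    proof -
      have "p (n + N) = p n + 2 * pi" using N by (simp add: p_def field_simps)
      then show ?thesis by (simp add: f_def chord_def cis.ctr)
    qed
    \<comment> \<open>\<open>x\<close> is the real-valued index of \<open>z\<close> on the grid,
      \<open>{a..<a+N}\<close> the window centred at it, and \<open>m\<close> the integer next to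
      \<open>x\<close> that takes the place of \<open>x\<close> in the comparison series.\<close>
    define x where "x = (z + pi) * N / (2 * pi)"
    define a where "a = \<lceil>x - N/2\<rceil>"
    define m where "m = \<lfloor>x\<rfloor>"
    have "(\<Sum>n<2^l. (1 + 2 ^ l * chord z (pt l n)) powr (-s)) = (\<Sum>n\<in>{0..<N}. f n)"
      by (rule sum.reindex_bij_witness[of _ nat int]) (auto simp: N_def f_def p_def pt_def nat_less_iff)
    also have "\<dots> = (\<Sum>n\<in>{a..<a+N}. f n)" using sum_periodic_int[of f N a] per N by simp
    also have "\<dots> \<le> (\<Sum>n\<in>{a..<a+N}. (max 1 \<bar>real_of_int (n - m)\<bar>) powr (-s))"
    proof (rule sum_mono)
      fix n assume n: "n \<in> {a..<a+N}"
      have "real_of_int a < x - N/2 + 1" "real_of_int a \<ge> x - N/2" unfolding a_def by linarith+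
      moreover have "real_of_int a \<le> n" "real_of_int n \<le> a + N - 1" using n by (auto simp flip: of_int_le_iff)
      ultimately have d: "\<bar>x - n\<bar> \<le> N / 2" by linarith
      have zp: "z - p n = 2 * pi / N * (x - n)" using N by (simp add: p_def x_def field_simps)
      have "\<bar>z - p n\<bar> = 2 * pi / N * \<bar>x - n\<bar>" unfolding zp using N by (simp add: abs_mult)
      moreover have "\<dots> \<le> 2 * pi / N * (N / 2)" using d N by (intro mult_left_mono) auto
      ultimately have "\<bar>z - p n\<bar> \<le> pi" using N by simp
      \<comment> \<open>The constant 4 is the \<open>2 / pi\<close> of \<open>chord_ge\<close> times
        the mesh size \<open>2 * pi / N\<close>, times \<open>N\<close>.\<close>
      from chord_ge[OF this] have "4 * \<bar>x - n\<bar> \<le> N * chord z (p n)"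
        using N \<open>\<bar>z - p n\<bar> = _\<close> by (simp add: field_simps)
      moreover have "max 1 \<bar>real_of_int (n - m)\<bar> \<le> 1 + 4 * \<bar>x - n\<bar>"
      proof -
        have m: "real_of_int m \<le> x" "x < real_of_int m + 1" unfolding m_def by linarith+
        have "\<bar>real_of_int (n - m)\<bar> \<le> 1 + \<bar>x - n\<bar>" using m by linarith
        then show ?thesis using abs_ge_zero[of "x - n"]
          by (intro max.boundedI) (simp, rule order_trans, assumption, simp)
      qed
      ultimately show "f n \<le> (max 1 \<bar>real_of_int (n - m)\<bar>) powr (-s)"
        unfolding f_def using s N by (intro powr_mono2') (auto intro!: mult_nonneg_nonneg)
    qed
    also have "\<dots> = (\<Sum>i\<in>(\<lambda>n. n - m) ` {a..<a+N}. (max 1 \<bar>real_of_int i\<bar>) powr (-s))"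
      by (subst sum.reindex) (auto simp: inj_on_def)
    also have "\<dots> \<le> C" by (rule C) auto
    finally show "(\<Sum>n<2^l. (1 + 2 ^ l * chord z (pt l n)) powr (-s)) \<le> C" .
  qed
qed

text \<open>The weight of Peetre's inequality at anisotropic scale \<open>l\<close>. A product over
  the coordinates makes sums over product grids factorise, and
  \<open>(1 + s) * (1 + t) \<ge> 1 + s + t\<close> in each factor gives the submultiplicativity that
  \<open>peetre\<close> requires.\<close>

definition cdist :: "nat \<Rightarrow> (nat \<Rightarrow> nat) \<Rightarrow> (nat \<Rightarrow> real) \<Rightarrow> (nat \<Rightarrow> real) \<Rightarrow> real" where
  "cdist d l x y = (\<Prod>i<d. 1 + 2 ^ l i * chord (x i) (y i))"

definition gpt :: "(nat \<Rightarrow> nat) \<Rightarrow> (nat \<Rightarrow> nat) \<Rightarrow> nat \<Rightarrow> real" where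
  "gpt l n i = pt (l i) (n i)"

lemma cdist_ge_1: "1 \<le> cdist d l x y"
  unfolding cdist_def by (rule prod_ge_1) auto

lemma cdist_pos: "0 < cdist d l x y"
  using cdist_ge_1[of d l x y] by linarith

lemma cdist_commute: "cdist d l x y = cdist d l y x"
  unfolding cdist_def by (simp add: chord_commute)

lemma cdist_refl [simp]: "cdist d l x x = 1"
  by (simp add: cdist_def chord_def)

lemma cdist_mult: "cdist d l x z \<le> cdist d l x y * cdist d l y z"
  unfolding cdist_def prod.distrib[symmetric]
proof (rule prod_mono, safe)
  fix i
  have "2 ^ l i * chord (x i) (z i) \<le> 2 ^ l i * chord (x i) (y i) + 2 ^ l i * chord (y i) (z i)"
    using chord_triangle[of "x i" "z i" "y i"] by (simp flip: distrib_left)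
  moreover have "0 \<le> (2 ^ l i * chord (x i) (y i)) * (2 ^ l i * chord (y i) (z i))" by (intro mult_nonneg_nonneg) auto
  ultimately show "1 + 2 ^ l i * chord (x i) (z i) \<le> (1 + 2 ^ l i * chord (x i) (y i)) * (1 + 2 ^ l i * chord (y i) (z i))"
    unfolding distrib_left distrib_right mult_1 mult_1_right by linarith
qed auto

lemma cdist_powr: "cdist d l x y powr s = (\<Prod>i<d. (1 + 2 ^ l i * chord (x i) (y i)) powr s)"
  unfolding cdist_def by (simp add: prod_powr_distrib)

lemma sum_cdist_bound:
  fixes s :: real
  assumes s: "s > 1"
  obtains C where "C > 0" "\<And>d l z. (\<Sum>n\<in>dgrid d l. cdist d l z (gpt l n) powr (-s)) \<le> C ^ d"
proof -
  obtain C where C: "C > 0" "\<And>l z. (\<Sum>n<2^l. (1 + 2 ^ l * chord z (pt l n)) powr (-s)) \<le> C"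
    using chord_sum_bound[OF s] by blast
  show ?thesis
  proof (rule that[OF C(1)])
    fix d l z
    have "(\<Sum>n\<in>dgrid d l. cdist d l z (gpt l n) powr (-s))
       = (\<Prod>i<d. \<Sum>n<2^l i. (1 + 2 ^ l i * chord (z i) (pt (l i) n)) powr (-s))"
      unfolding dgrid_def cdist_powr gpt_def by (subst prod_sum_PiE) auto
    also have "\<dots> \<le> (\<Prod>i<d. C)" by (intro prod_mono conjI C sum_nonneg) auto
    finally show "(\<Sum>n\<in>dgrid d l. cdist d l z (gpt l n) powr (-s)) \<le> C ^ d" by simp
  qed
qed

lemma dblock_partition:
  fixes f :: "nat \<Rightarrow> 'c::comm_monoid_add"
  assumes "m \<le> J"
  shows "(\<Sum>t<2^J. f t) = (\<Sum>k<2^m. \<Sum>t\<in>dblock J m k. f t)"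
proof -
  have "(\<Sum>t<K*M. f t) = (\<Sum>k<K. \<Sum>t\<in>{k*M..<Suc k*M}. f t)" for K M :: nat
  proof (induction K)
    case (Suc K)
    have "{..<Suc K*M} = {..<K*M} \<union> {K*M..<Suc K*M}" "{..<K*M} \<inter> {K*M..<Suc K*M} = {}" by auto
    then show ?case using Suc by (simp add: sum.union_disjoint)
  qed simp
  from this[of "2^m" "2^(J-m)"] show ?thesis using assms by (simp add: dblock_def flip: power_add)
qed

lemma dgrid_partition:
  fixes F :: "(nat \<Rightarrow> nat) \<Rightarrow> 'c::comm_monoid_add"
  assumes "\<And>i. i < d \<Longrightarrow> l i \<le> J"
  shows "(\<Sum>v\<in>dgrid d (\<lambda>_. J). F v) = (\<Sum>m\<in>dgrid d l. \<Sum>v\<in>PiE {..<d} (\<lambda>i. dblock J (l i) (m i)). F v)"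
  using assms
proof (induction d arbitrary: F)
  case 0 then show ?case by (simp add: dgrid_def)
next
  case (Suc d)
  have cong: "PiE {..<d} (\<lambda>i. dblock J (l i) ((m(d := k)) i)) = PiE {..<d} (\<lambda>i. dblock J (l i) (m i))" for m k
    by (rule PiE_cong) auto
  have "(\<Sum>v\<in>dgrid (Suc d) (\<lambda>_. J). F v) = (\<Sum>t<2^J. \<Sum>v\<in>dgrid d (\<lambda>_. J). F (v(d := t)))"
    unfolding dgrid_def sum_PiE_Suc ..
  also have "\<dots> = (\<Sum>t<2^J. \<Sum>m\<in>dgrid d l. \<Sum>v\<in>PiE {..<d} (\<lambda>i. dblock J (l i) (m i)). F (v(d := t)))"
    using Suc by simp
  also have "\<dots> = (\<Sum>k<2^l d. \<Sum>t\<in>dblock J (l d) k. \<Sum>m\<in>dgrid d l. \<Sum>v\<in>PiE {..<d} (\<lambda>i. dblock J (l i) (m i)). F (v(d := t)))"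
    using Suc.prems[of d] by (subst dblock_partition) auto
  also have "\<dots> = (\<Sum>k<2^l d. \<Sum>m\<in>dgrid d l. \<Sum>t\<in>dblock J (l d) k. \<Sum>v\<in>PiE {..<d} (\<lambda>i. dblock J (l i) (m i)). F (v(d := t)))"
    by (intro sum.cong refl sum.swap)
  also have "\<dots> = (\<Sum>m\<in>dgrid (Suc d) l. \<Sum>v\<in>PiE {..<Suc d} (\<lambda>i. dblock J (l i) (m i)). F v)"
    unfolding dgrid_def sum_PiE_Suc by (simp only: cong fun_upd_same)
  finally show ?case .
qed

lemma pt_block:
  assumes "m \<le> J" "t \<in> dblock J m k"
  shows "\<bar>pt J t - pt m k\<bar> \<le> 2 * pi / 2 ^ m"
proof -
  have p: "(2::real) ^ J = 2 ^ m * 2 ^ (J - m)" using assms by (simp flip: power_add)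
  have t: "real k * 2 ^ (J - m) \<le> t" "real t \<le> (real k + 1) * 2 ^ (J - m)"
  proof -
    have "k * 2 ^ (J - m) \<le> t" "t \<le> Suc k * 2 ^ (J - m)" using assms(2) unfolding dblock_def by auto
    then show "real k * 2 ^ (J - m) \<le> t" "real t \<le> (real k + 1) * 2 ^ (J - m)"
      by (metis of_nat_mono of_nat_mult of_nat_numeral of_nat_power, metis of_nat_mono of_nat_mult of_nat_numeral of_nat_power of_nat_Suc add.commute)
  qed
  have "pt J t - pt m k = 2 * pi / 2 ^ m * (t / 2 ^ (J - m) - k)"
    by (simp add: pt_def p field_simps)
  moreover have "0 \<le> t / 2 ^ (J - m) - k" "t / 2 ^ (J - m) - k \<le> 1" using t by (auto simp: field_simps)
  ultimately have "\<bar>pt J t - pt m k\<bar> \<le> 2 * pi / 2 ^ m * 1"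
    unfolding \<open>pt J t - pt m k = _\<close> abs_mult by (intro mult_mono) auto
  then show ?thesis by simp
qed

text \<open>Inside a box of level \<open>l\<close> the points stay within
  \<open>2 * pi / 2 ^ l i\<close> of the corner in every coordinate, so the weight varies by a
  factor of at most \<open>(1 + 2 * pi) ^ d\<close> and may be frozen at the corner. What remains of
  the sum over a box is its mean.\<close>

lemma block_sum_le:
  fixes s :: real
  assumes l: "\<And>i. i < d \<Longrightarrow> l i \<le> J" and A: "\<And>v. A v \<ge> 0" and s: "s \<ge> 0"
  shows "2 ^ (\<Sum>i<d. l i) / 2 ^ (J * d) * (\<Sum>v\<in>dgrid d (\<lambda>_. J). A v * cdist d l z (gpt (\<lambda>_. J) v) powr (-s))
     \<le> (1 + 2 * pi) powr (d * s) * (\<Sum>m\<in>dgrid d l. bavg d J l A m * cdist d l z (gpt l m) powr (-s))"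
proof -
  have c: "cdist d l z (gpt (\<lambda>_. J) v) powr (-s) \<le> (1 + 2 * pi) powr (d * s) * cdist d l z (gpt l m) powr (-s)"
    if v: "v \<in> PiE {..<d} (\<lambda>i. dblock J (l i) (m i))" for v m
  proof -
    have "cdist d l (gpt (\<lambda>_. J) v) (gpt l m) \<le> (\<Prod>i<d. 1 + 2 * pi)"
      unfolding cdist_def
    proof (rule prod_mono, safe)
      fix i assume i: "i < d"
      have "chord (gpt (\<lambda>_. J) v i) (gpt l m i) \<le> 2 * pi / 2 ^ l i"
        using chord_le[of "gpt (\<lambda>_. J) v i" "gpt l m i"] pt_block[of "l i" J "v i" "m i"] l[OF i] v i
        by (fastforce simp: gpt_def PiE_def Pi_def)
      then show "1 + 2 ^ l i * chord (gpt (\<lambda>_. J) v i) (gpt l m i) \<le> 1 + 2 * pi"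
        by (simp add: field_simps)
    qed auto
    then have "cdist d l z (gpt l m) \<le> cdist d l z (gpt (\<lambda>_. J) v) * (1 + 2 * pi) ^ d"
      by (intro order_trans[OF cdist_mult mult_left_mono]) (auto intro: less_imp_le[OF cdist_pos])
    then have "cdist d l z (gpt l m) powr s \<le> (cdist d l z (gpt (\<lambda>_. J) v) * (1 + 2 * pi) ^ d) powr s"
      using s cdist_pos[of d l z "gpt l m"] by (intro powr_mono2) auto
    also have "\<dots> = cdist d l z (gpt (\<lambda>_. J) v) powr s * (1 + 2 * pi) powr (d * s)"
      using cdist_pos[of d l z "gpt (\<lambda>_. J) v"] by (simp add: powr_mult powr_powr powr_realpow[symmetric] add_pos_pos)
    finally show ?thesis
      using cdist_pos[of d l z "gpt (\<lambda>_. J) v"] cdist_pos[of d l z "gpt l m"]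
      by (simp add: powr_minus field_simps)
  qed
  have e: "(2::real) ^ (\<Sum>i<d. l i) / 2 ^ (J * d) = 1 / 2 ^ (\<Sum>i<d. J - l i)"
  proof -
    have "(\<Sum>i<d. l i) + (\<Sum>i<d. J - l i) = J * d"
      unfolding sum.distrib[symmetric] using l by (simp add: mult.commute)
    then show ?thesis by (simp add: field_simps flip: power_add)
  qed
  have "(\<Sum>v\<in>dgrid d (\<lambda>_. J). A v * cdist d l z (gpt (\<lambda>_. J) v) powr (-s))
     = (\<Sum>m\<in>dgrid d l. \<Sum>v\<in>PiE {..<d} (\<lambda>i. dblock J (l i) (m i)). A v * cdist d l z (gpt (\<lambda>_. J) v) powr (-s))"
    by (rule dgrid_partition) (rule l)
  also have "\<dots> \<le> (\<Sum>m\<in>dgrid d l. \<Sum>v\<in>PiE {..<d} (\<lambda>i. dblock J (l i) (m i)). A v * ((1 + 2 * pi) powr (d * s) * cdist d l z (gpt l m) powr (-s)))"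
    by (intro sum_mono mult_left_mono c A)
  also have "\<dots> = (1 + 2 * pi) powr (d * s) * (\<Sum>m\<in>dgrid d l. (\<Sum>v\<in>PiE {..<d} (\<lambda>i. dblock J (l i) (m i)). A v) * cdist d l z (gpt l m) powr (-s))"
    by (simp add: sum_distrib_left sum_distrib_right mult_ac)
  also have "\<dots> = (1 + 2 * pi) powr (d * s) * (\<Sum>m\<in>dgrid d l. (bavg d J l A m * 2 ^ (\<Sum>i<d. J - l i)) * cdist d l z (gpt l m) powr (-s))"
    by (simp add: bavg_def)
  also have "\<dots> = (1 + 2 * pi) powr (d * s) * (\<Sum>m\<in>dgrid d l. bavg d J l A m * cdist d l z (gpt l m) powr (-s)) * 2 ^ (\<Sum>i<d. J - l i)"
    unfolding mult.assoc sum_distrib_right by (simp add: mult_ac)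
  finally show ?thesis unfolding e by (simp add: pos_divide_le_eq)
qed

text \<open>The maximum \<open>G\<close> of \<open>h v * w z v powr (-a)\<close> is attained at some \<open>x\<close>; in \<open>hyp\<close> at \<open>x\<close> write
  \<open>h v = h v powr \<rho> * h v powr (1 - \<rho>)\<close>, bound the second factor through \<open>G\<close>, and cancel.\<close>

lemma peetre:
  fixes h :: "'p \<Rightarrow> real"
  assumes V: "finite V" and h0: "\<And>x. 0 \<le> h x"
    and w1: "\<And>x y. 1 \<le> w x y" and wt: "\<And>x y z. w x z \<le> w x y * w y z" and wr: "\<And>x. w x x = 1"
    and \<rho>: "0 < \<rho>" "\<rho> \<le> 1" and a: "a \<ge> 0" and c: "c \<ge> 0"
    and hyp: "\<And>z. h z \<le> c * (\<Sum>v\<in>V. h v * w z v powr (-a))"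
  shows "h z powr \<rho> \<le> c * (\<Sum>v\<in>V. h v powr \<rho> * w z v powr (-a * \<rho>))"
proof (cases "h z = 0")
  case True
  then show ?thesis using c \<rho> by (auto intro!: mult_nonneg_nonneg sum_nonneg)
next
  case False
  \<comment> \<open>The point \<open>z\<close> is added to \<open>V\<close> so that
    \<open>h z \<le> G\<close>, by \<open>w z z = 1\<close>.\<close>
  define G where "G = Max ((\<lambda>v. h v * w z v powr (-a)) ` insert z V)"
  define S where "S = (\<Sum>v\<in>V. h v powr \<rho> * w z v powr (-a * \<rho>))"
  have wp: "w x y > 0" for x y using w1[of x y] by linarith
  have Gge: "h v * w z v powr (-a) \<le> G" if "v \<in> insert z V" for v
    unfolding G_def by (rule Max_ge) (use V that in auto)
  have Gz: "h z \<le> G" using Gge[of z] by (simp add: wr)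
  have Gp: "G > 0" using Gz False h0[of z] by linarith
  have hv: "h v \<le> G * w z v powr a" if "v \<in> V" for v
    using Gge[of v] that wp[of z v] by (simp add: powr_minus field_simps)
  have S0: "S \<ge> 0" unfolding S_def by (auto intro: sum_nonneg)
  have "G \<in> (\<lambda>v. h v * w z v powr (-a)) ` insert z V"
    unfolding G_def by (rule Max_in) (use V in auto)
  then obtain x where x: "G = h x * w z x powr (-a)" by auto
  have "h x * w z x powr (-a) \<le> c * (\<Sum>v\<in>V. h v * w x v powr (-a)) * w z x powr (-a)"
    by (intro mult_right_mono hyp) auto
  also have "\<dots> = c * (\<Sum>v\<in>V. h v * (w x v * w z x) powr (-a))"
    using wp by (simp add: sum_distrib_right powr_mult less_imp_le mult.assoc)
  also have "\<dots> \<le> c * (\<Sum>v\<in>V. h v powr \<rho> * w z v powr (-a * \<rho>) * G powr (1 - \<rho>))"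
  proof (intro mult_left_mono sum_mono c)
    fix v assume v: "v \<in> V"
    have "h v * (w x v * w z x) powr (-a) \<le> h v * w z v powr (-a)"
      using wt[of z v x] wp a by (intro mult_left_mono powr_mono2' h0) (auto simp: mult.commute)
    also have "h v * w z v powr (-a) = (h v powr \<rho> * h v powr (1 - \<rho>)) * w z v powr (-a)"
      using h0[of v] by (simp flip: powr_add)
    also have "\<dots> \<le> (h v powr \<rho> * (G * w z v powr a) powr (1-\<rho>)) * w z v powr (-a)"
      by (intro mult_right_mono mult_left_mono powr_mono2 hv v h0) (use \<rho> in auto)
    also have "\<dots> = h v powr \<rho> * w z v powr (-a * \<rho>) * G powr (1 - \<rho>)"
    proof -
      have "(w z v powr a) powr (1-\<rho>) * w z v powr (-a) = w z v powr (-a * \<rho>)"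
        using wp[of z v] by (simp add: powr_powr algebra_simps flip: powr_add)
      then show ?thesis using Gp wp[of z v] by (simp add: powr_mult mult_ac)
    qed
    finally show "h v * (w x v * w z x) powr (-a) \<le> h v powr \<rho> * w z v powr (-a * \<rho>) * G powr (1 - \<rho>)" .
  qed
  also have "\<dots> = c * S * G powr (1 - \<rho>)" by (simp add: S_def sum_distrib_right mult.assoc)
  finally have "G \<le> c * S * G powr (1 - \<rho>)" by (simp add: x)
  moreover have "G = G powr \<rho> * G powr (1 - \<rho>)" using Gp by (simp flip: powr_add)
  ultimately have "G powr \<rho> * G powr (1 - \<rho>) \<le> c * S * G powr (1 - \<rho>)" by simp
  then have "G powr \<rho> \<le> c * S" using Gp by (simp add: mult_le_cancel_right)
  moreover have "h z powr \<rho> \<le> G powr \<rho>" using Gz h0 \<rho> by (intro powr_mono2) auto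
  ultimately show ?thesis by (simp add: S_def)
qed

section \<open>Reproducing kernels for trigonometric polynomials\<close>

text \<open>A geometric sum of roots of unity; \<open>\<bar>m\<bar> < 2 ^ J\<close> excludes the
  aliases of frequency 0.\<close>

lemma sum_cis_pt:
  fixes m :: int
  assumes "\<bar>m\<bar> < 2 ^ J"
  shows "(\<Sum>v<2^J. cis (m * pt J v)) = (if m = 0 then 2 ^ J else 0)"
proof (cases "m = 0")
  case False
  define w where "w = cis (2 * pi * m / 2 ^ J)"
  have "w \<noteq> 1"
  proof
    assume "w = 1"
    then have "cos (2 * pi * m / 2 ^ J) = 1" by (metis Re_complex_of_real cis.sel(1) of_real_1 w_def)
    then obtain n :: int where "2 * pi * m / 2 ^ J = real_of_int n * 2 * pi" using cos_one_2pi_int by blast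
    then have "real_of_int m = real_of_int (n * 2 ^ J)" by (simp add: field_simps)
    then have mn: "m = n * 2 ^ J" by (simp only: of_int_eq_iff)
    with False have "\<bar>n\<bar> \<ge> 1" by auto
    then have "\<bar>m\<bar> \<ge> 1 * 2 ^ J" unfolding mn abs_mult by (intro mult_mono) auto
    with assms show False by simp
  qed
  have "cis (m * pt J v) = cis (- (m * pi)) * w ^ v" for v
    by (simp add: w_def pt_def cis_mult Complex.DeMoivre algebra_simps)
  then have "(\<Sum>v<2^J. cis (m * pt J v)) = cis (- (m * pi)) * (\<Sum>v<2^J. w ^ v)"
    by (simp add: sum_distrib_left)
  also have "(\<Sum>v<2^J. w ^ v) = (w ^ (2 ^ J) - 1) / (w - 1)" using \<open>w \<noteq> 1\<close> by (rule geometric_sum)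
  also have "w ^ (2 ^ J) = cis (2 * pi * m)" by (simp add: w_def Complex.DeMoivre)
  also have "\<dots> = 1" by (rule cis_multiple_2pi) auto
  finally show ?thesis using False by simp
qed simp

definition dirichlet_kernel :: "int \<Rightarrow> real \<Rightarrow> complex" where
  "dirichlet_kernel N t = (\<Sum>a\<in>{-N..N}. cis (real_of_int a * t))"

definition damping_kernel :: "nat \<Rightarrow> nat \<Rightarrow> real \<Rightarrow> complex" where
  "damping_kernel n M t = ((\<Sum>b<n. cis (real b * t)) / of_nat n) ^ M"

text \<open>The spectrum of \<open>damping_kernel (2 ^ l) M\<close> lies in \<open>{0..M * (2 ^ l - 1)}\<close> and \<open>damping_kernel\<close> is 1 at 0, so the product
  still has all Fourier coefficients of order at most \<open>2 ^ l\<close> equal to 1, while \<open>damping_kernel\<close> supplies decay.\<close>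

definition reproducing_kernel :: "nat \<Rightarrow> nat \<Rightarrow> real \<Rightarrow> complex" where
  "reproducing_kernel M l t = dirichlet_kernel ((int M + 1) * 2 ^ l) t * damping_kernel (2 ^ l) M t"

lemma dirichlet_bound:
  fixes t :: real
  shows
  "norm (\<Sum>b<n. cis (real b * t)) * norm (cis t - 1) \<le> 2"
proof -
  have "(\<Sum>b<n. cis (real b * t)) = (\<Sum>b<n. cis t ^ b)" by (simp add: Complex.DeMoivre)
  then have "(\<Sum>b<n. cis (real b * t)) * (cis t - 1) = cis t ^ n - 1"
    by (simp add: power_diff_1_eq mult.commute)
  then have "norm (\<Sum>b<n. cis (real b * t)) * norm (cis t - 1) = norm (cis t ^ n - 1)"
    by (metis norm_mult)
  also have "\<dots> \<le> norm (cis t ^ n) + 1" by (metis norm_one norm_triangle_ineq4)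
  finally show ?thesis by (simp add: norm_power)
qed

lemma damping_kernel_bound:
  fixes t :: real
  assumes "n > 0"
  shows "norm (damping_kernel n M t) \<le> 3 ^ M * (1 + real n * norm (cis t - 1)) powr (- real M)"
proof -
  define y where "y = norm (\<Sum>b<n. cis (real b * t)) / n"
  define x where "x = real n * norm (cis t - 1)"
  have x0: "x \<ge> 0" "y \<ge> 0" by (simp_all add: x_def y_def)
  have "norm (\<Sum>b<n. cis (real b * t)) \<le> (\<Sum>b<n. 1)" by (rule order_trans[OF norm_sum]) simp
  then have y1: "y \<le> 1" using assms by (simp add: y_def divide_le_eq)
  have "y * x \<le> 2" using dirichlet_bound[of t n] assms by (simp add: x_def y_def)
  \<comment> \<open>Adding \<open>y \<le> 1\<close> to \<open>y * x \<le> 2\<close> gives one bound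
    that serves both near 0 and away from it.\<close>
  then have "y * (1 + x) \<le> 3" using y1 by (simp add: distrib_left)
  then have "y \<le> 3 / (1 + x)" using x0 by (simp add: pos_le_divide_eq)
  then have "y ^ M \<le> (3 / (1 + x)) ^ M" using x0 by (intro power_mono) auto
  also have "\<dots> = 3 ^ M * (1 + x) powr (- real M)"
    using x0 by (simp add: power_divide powr_minus powr_realpow divide_inverse power_inverse)
  finally show ?thesis by (simp add: damping_kernel_def y_def x_def norm_power norm_divide)
qed

lemma reproducing_kernel_bound:
  "norm (reproducing_kernel M l t) \<le> ((2 * M + 3) * 3 ^ M) * 2 ^ l * (1 + 2 ^ l * norm (cis t - 1)) powr (- real M)"
proof -
  have "norm (dirichlet_kernel ((int M + 1) * 2 ^ l) t) \<le> (\<Sum>a\<in>{-((int M + 1) * 2 ^ l)..(int M + 1) * 2 ^ l}. (1::real))"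
    unfolding dirichlet_kernel_def by (rule order_trans[OF norm_sum]) simp
  also have "\<dots> = 2 * ((M + 1) * 2 ^ l) + 1" by (simp add: nat_add_distrib nat_mult_distrib nat_power_eq)
  also have "\<dots> \<le> (2 * M + 3) * 2 ^ l"
    by (simp add: algebra_simps flip: of_nat_le_iff)
  finally have "norm (dirichlet_kernel ((int M + 1) * 2 ^ l) t) \<le> (2 * M + 3) * 2 ^ l" by simp
  moreover have "norm (damping_kernel (2^l) M t) \<le> 3 ^ M * (1 + 2 ^ l * norm (cis t - 1)) powr (- real M)"
    using damping_kernel_bound[of "2^l" M t] by simp
  ultimately have "norm (reproducing_kernel M l t) \<le> ((2 * M + 3) * 2 ^ l) * (3 ^ M * (1 + 2 ^ l * norm (cis t - 1)) powr (- real M))"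
    unfolding reproducing_kernel_def norm_mult by (intro mult_mono) auto
  then show ?thesis by (simp add: mult_ac)
qed

lemma damping_kernel_poly:
  assumes "n > 0"
  obtains p :: "complex poly" where "\<And>t. damping_kernel n M t = poly p (cis t)" "poly p 1 = 1" "degree p \<le> M * n"
proof -
  define q :: "complex poly" where "q = smult (1 / of_nat n) (\<Sum>b<n. monom 1 b)"
  have ev: "poly q (cis t) = (\<Sum>b<n. cis (real b * t)) / of_nat n" for t
    by (simp add: q_def poly_sum poly_monom Complex.DeMoivre)
  have "degree (\<Sum>b<n. monom (1::complex) b) \<le> n"
    by (rule degree_sum_le) (auto intro: order_trans[OF degree_monom_le])
  then have dq: "degree q \<le> n" unfolding q_def using degree_smult_le order_trans by blast
  show ?thesis
  proof (rule that[of "q ^ M"])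
    show "damping_kernel n M t = poly (q ^ M) (cis t)" for t by (simp add: damping_kernel_def ev)
    have "poly q 1 = 1" using assms by (simp add: q_def poly_sum poly_monom)
    then show "poly (q ^ M) 1 = 1" by simp
    show "degree (q ^ M) \<le> M * n"
      using order_trans[OF degree_power_le mult_right_mono[OF dq]] by (simp add: mult.commute)
  qed
qed

text \<open>The coefficient number \<open>b\<close> of the damping polynomial shifts the Dirichlet
  sum by \<open>b\<close>. As \<open>\<bar>k - b\<bar> \<le> (M + 1) * 2 ^ l\<close>, the frequency
  \<open>k\<close> is still met exactly once, and all frequency differences stay below
  \<open>(2 * M + 3) * 2 ^ l\<close>, so quadrature on \<open>2 ^ J\<close> points is free of
  aliasing. Thus \<open>b\<close> contributes its coefficient, and the coefficients add up to the
  value 1 of the polynomial at 1.\<close>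

lemma reproducing_kernel_reproduce:
  fixes k :: int and z :: real
  assumes k: "\<bar>k\<bar> \<le> 2 ^ l" and J: "(2 * int M + 3) * 2 ^ l \<le> 2 ^ J"
  shows "(\<Sum>v<2^J. cis (k * pt J v) * reproducing_kernel M l (z - pt J v)) = 2 ^ J * cis (k * z)"
proof -
  obtain p :: "complex poly" where p: "\<And>t. damping_kernel (2^l) M t = poly p (cis t)" "poly p 1 = 1" "degree p \<le> M * 2^l"
    using damping_kernel_poly[of "2^l" M] by auto
  define N where "N = (int M + 1) * 2 ^ l"
  define D where "D = degree p"
  have D: "int D \<le> int M * 2 ^ l" unfolding D_def using p(3) by (metis of_nat_mono of_nat_mult of_nat_numeral of_nat_power)
  have w: "reproducing_kernel M l t = (\<Sum>b\<le>D. coeff p b * (\<Sum>a\<in>{-N..N}. cis (real_of_int (a + int b) * t)))" for t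
    unfolding reproducing_kernel_def dirichlet_kernel_def p(1) poly_altdef N_def D_def
    by (simp add: sum_distrib_left sum_distrib_right Complex.DeMoivre cis_mult algebra_simps) (rule sum.swap)
  have inner: "(\<Sum>v<2^J. cis (k * pt J v) * (\<Sum>a\<in>{-N..N}. cis (real_of_int (a + int b) * (z - pt J v)))) = 2 ^ J * cis (k * z)"
    if b: "b \<le> D" for b
  proof -
    have "(\<Sum>v<2^J. cis (k * pt J v) * (\<Sum>a\<in>{-N..N}. cis (real_of_int (a + int b) * (z - pt J v))))
       = (\<Sum>a\<in>{-N..N}. cis (real_of_int (a + int b) * z) * (\<Sum>v<2^J. cis ((k - a - int b) * pt J v)))"
      by (simp add: sum_distrib_left cis_mult algebra_simps) (rule sum.swap)
    also have "\<dots> = (\<Sum>a\<in>{-N..N}. if a = k - int b then 2 ^ J * cis (k * z) else 0)"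
    proof (rule sum.cong)
      fix a assume a: "a \<in> {-N..N}"
      have "\<bar>k - a - int b\<bar> \<le> 2 ^ l + N + int M * 2 ^ l" using k a b D by auto
      also have "\<dots> < (2 * int M + 3) * 2 ^ l" unfolding N_def by (simp add: algebra_simps)
      finally have "\<bar>k - a - int b\<bar> < 2 ^ J" using J by simp
      from sum_cis_pt[OF this] show "cis (real_of_int (a + int b) * z) * (\<Sum>v<2^J. cis ((k - a - int b) * pt J v)) = (if a = k - int b then 2 ^ J * cis (k * z) else 0)"
        by auto
    qed simp
    also have "\<dots> = 2 ^ J * cis (k * z)"
    proof -
      have "k - int b \<in> {-N..N}" using k b D unfolding N_def by (auto simp: algebra_simps abs_le_iff)
      then show ?thesis by simp
    qed
    finally show ?thesis .
  qed
  have "(\<Sum>v<2^J. cis (k * pt J v) * reproducing_kernel M l (z - pt J v))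
     = (\<Sum>b\<le>D. coeff p b * (\<Sum>v<2^J. cis (k * pt J v) * (\<Sum>a\<in>{-N..N}. cis (real_of_int (a + int b) * (z - pt J v)))))"
    unfolding w sum_distrib_left by (subst sum.swap) (simp add: mult_ac)
  also have "\<dots> = (\<Sum>b\<le>D. coeff p b) * (2 ^ J * cis (k * z))"
    unfolding sum_distrib_right by (rule sum.cong[OF refl]) (simp only: inner atMost_iff)
  also have "(\<Sum>b\<le>D. coeff p b) = 1" using p(2) by (simp add: poly_altdef D_def)
  finally show ?thesis by simp
qed

definition texp :: "nat \<Rightarrow> (nat \<Rightarrow> int) \<Rightarrow> (nat \<Rightarrow> real) \<Rightarrow> complex" where
  "texp d k x = cis (\<Sum>i<d. real_of_int (k i) * x i)"

lemma texp_prod: "texp d k x = (\<Prod>i<d. cis (k i * x i))"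
  unfolding texp_def by (induction d) (auto simp flip: cis_mult)

definition trigpoly :: "nat \<Rightarrow> (nat \<Rightarrow> int) \<Rightarrow> ((nat \<Rightarrow> real) \<Rightarrow> complex) \<Rightarrow> bool" where
  "trigpoly d N g \<longleftrightarrow> (\<exists>K c. finite K \<and> (\<forall>k\<in>K. \<forall>i<d. \<bar>k i\<bar> \<le> N i) \<and> g = (\<lambda>x. \<Sum>k\<in>K. c k * texp d k x))"

lemma trigpoly_reproduce:
  assumes g: "trigpoly d (\<lambda>i. 2 ^ l i) g" and J: "\<And>i. i < d \<Longrightarrow> (2 * int M + 3) * 2 ^ l i \<le> 2 ^ J"
  shows "g z = 1 / 2 ^ (J * d) * (\<Sum>v\<in>dgrid d (\<lambda>_. J). g (gpt (\<lambda>_. J) v) * (\<Prod>i<d. reproducing_kernel M (l i) (z i - gpt (\<lambda>_. J) v i)))"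
proof -
  obtain K c where K: "finite K" "\<And>k i. k \<in> K \<Longrightarrow> i < d \<Longrightarrow> \<bar>k i\<bar> \<le> 2 ^ l i" and g: "g = (\<lambda>x. \<Sum>k\<in>K. c k * texp d k x)"
    using g unfolding trigpoly_def by blast
  have one: "(\<Sum>v\<in>dgrid d (\<lambda>_. J). texp d k (gpt (\<lambda>_. J) v) * (\<Prod>i<d. reproducing_kernel M (l i) (z i - gpt (\<lambda>_. J) v i))) = 2 ^ (J * d) * texp d k z"
    if k: "k \<in> K" for k
  proof -
    have "(\<Sum>v\<in>dgrid d (\<lambda>_. J). texp d k (gpt (\<lambda>_. J) v) * (\<Prod>i<d. reproducing_kernel M (l i) (z i - gpt (\<lambda>_. J) v i)))
       = (\<Prod>i<d. \<Sum>v<2^J. cis (k i * pt J v) * reproducing_kernel M (l i) (z i - pt J v))"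
      unfolding texp_prod gpt_def prod.distrib[symmetric] dgrid_def by (subst prod_sum_PiE) auto
    also have "\<dots> = (\<Prod>i<d. 2 ^ J * cis (k i * z i))"
      by (rule prod.cong) (use reproducing_kernel_reproduce K(2)[OF k] J in auto)
    also have "\<dots> = 2 ^ (J * d) * texp d k z"
      by (simp add: prod.distrib texp_prod power_mult)
    finally show ?thesis .
  qed
  have "(\<Sum>v\<in>dgrid d (\<lambda>_. J). g (gpt (\<lambda>_. J) v) * (\<Prod>i<d. reproducing_kernel M (l i) (z i - gpt (\<lambda>_. J) v i)))
     = (\<Sum>k\<in>K. c k * (\<Sum>v\<in>dgrid d (\<lambda>_. J). texp d k (gpt (\<lambda>_. J) v) * (\<Prod>i<d. reproducing_kernel M (l i) (z i - gpt (\<lambda>_. J) v i))))"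
    unfolding g sum_distrib_left sum_distrib_right by (subst sum.swap) (simp add: mult_ac)
  also have "\<dots> = 2 ^ (J * d) * g z" by (simp add: one g sum_distrib_left mult_ac)
  finally show ?thesis by simp
qed

lemma trigpoly_pointwise:
  fixes M d :: nat
  assumes g: "trigpoly d (\<lambda>i. 2 ^ l i) g" and J: "\<And>i. i < d \<Longrightarrow> (2 * int M + 3) * 2 ^ l i \<le> 2 ^ J"
  shows "norm (g z) \<le> ((2 * M + 3) * 3 ^ M) ^ d * (2 ^ (\<Sum>i<d. l i) / 2 ^ (J * d)) *
     (\<Sum>v\<in>dgrid d (\<lambda>_. J). norm (g (gpt (\<lambda>_. J) v)) * cdist d l z (gpt (\<lambda>_. J) v) powr (- real M))"
proof -
  let ?K = "real ((2 * M + 3) * 3 ^ M)"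
  have w: "norm (\<Prod>i<d. reproducing_kernel M (l i) (z i - gpt (\<lambda>_. J) v i)) \<le> ?K ^ d * 2 ^ (\<Sum>i<d. l i) * cdist d l z (gpt (\<lambda>_. J) v) powr (- real M)" for v
  proof -
    have "norm (\<Prod>i<d. reproducing_kernel M (l i) (z i - gpt (\<lambda>_. J) v i)) \<le>
      (\<Prod>i<d. ?K * 2 ^ l i * (1 + 2 ^ l i * chord (z i) (gpt (\<lambda>_. J) v i)) powr (- real M))"
      unfolding prod_norm[symmetric]
      by (intro prod_mono conjI norm_ge_zero) (use reproducing_kernel_bound in \<open>simp flip: chord_eq_1\<close>)
    also have "\<dots> = ?K ^ d * 2 ^ (\<Sum>i<d. l i) * cdist d l z (gpt (\<lambda>_. J) v) powr (- real M)"
      by (simp add: prod.distrib cdist_powr power_sum)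
    finally show ?thesis .
  qed
  have "norm (g z) = 1 / 2 ^ (J * d) * norm (\<Sum>v\<in>dgrid d (\<lambda>_. J). g (gpt (\<lambda>_. J) v) * (\<Prod>i<d. reproducing_kernel M (l i) (z i - gpt (\<lambda>_. J) v i)))"
    by (subst trigpoly_reproduce[OF g J]) (auto simp: norm_mult norm_divide norm_power)
  also have "\<dots> \<le> 1 / 2 ^ (J * d) * (\<Sum>v\<in>dgrid d (\<lambda>_. J). norm (g (gpt (\<lambda>_. J) v)) * (?K ^ d * 2 ^ (\<Sum>i<d. l i) * cdist d l z (gpt (\<lambda>_. J) v) powr (- real M)))"
    by (intro mult_left_mono order_trans[OF norm_sum] sum_mono) (auto simp: norm_mult intro!: mult_left_mono w[simplified])
  finally show ?thesis by (simp add: sum_distrib_left sum_divide_distrib mult_ac)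
qed

section \<open>A discrete Jawerth embedding\<close>

lemma bavg_mono: "(\<And>v. A v \<le> B v) \<Longrightarrow> bavg d J l A n \<le> bavg d J l B n"
  unfolding bavg_def by (intro divide_right_mono sum_mono) auto

lemma bavg_one:
  assumes "\<And>i. i < d \<Longrightarrow> l i \<le> J"
  shows "bavg d J l (\<lambda>_. 1) n = 1"
proof -
  have "card (PiE {..<d} (\<lambda>i. dblock J (l i) (n i))) = (\<Prod>i<d. 2 ^ (J - l i))"
    by (subst card_PiE) (auto simp: dblock_def)
  then show ?thesis by (simp add: bavg_def power_sum)
qed

text \<open>The kernel representation bounds the modulus itself by weighted averages of moduli. For
  \<open>\<rho> \<le> 1\<close> the exponent is lowered by \<open>peetre\<close>, for
  \<open>\<rho> > 1\<close> it is raised by Jensen; in both cases the remaining weight is frozen on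
  the boxes of level \<open>l\<close>. The offset \<open>b\<close> is the oversampling that exact
  quadrature demands.\<close>

lemma trigpoly_peetre:
  fixes \<rho> :: real
  assumes \<rho>: "\<rho> > 0"
  obtains C b where "C > 0" and "\<And>l J g z. (\<And>i. i < d \<Longrightarrow> l i + b \<le> J) \<Longrightarrow> trigpoly d (\<lambda>i. 2 ^ l i) g \<Longrightarrow>
     norm (g z) powr \<rho> \<le> C * (\<Sum>m\<in>dgrid d l. bavg d J l (\<lambda>v. norm (g (gpt (\<lambda>_. J) v)) powr \<rho>) m * cdist d l z (gpt l m) powr (-2))"
proof -
  define \<rho>' where "\<rho>' = min \<rho> 1"
  have \<rho>': "0 < \<rho>'" "\<rho>' \<le> 1" using \<rho> by (auto simp: \<rho>'_def)
  \<comment> \<open>Passing to the power \<open>\<rho>\<close> multiplies the decay exponent by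
    \<open>\<rho>\<close> if \<open>\<rho> \<le> 1\<close>. This \<open>M\<close> leaves at least
    the exponent 2, whose weight is summable over the grid.\<close>
  define M where "M = nat \<lceil>2 / \<rho>'\<rceil>"
  have M: "2 / \<rho>' \<le> M" unfolding M_def by linarith
  then have M2: "2 \<le> M * \<rho>'" using \<rho>' by (simp add: field_simps)
  define b where "b = nat \<lceil>log 2 (2 * M + 3)\<rceil>"
  have "2 * M + 3 \<le> (2::real) ^ b"
  proof -
    have "log 2 (2 * M + 3) \<le> b" unfolding b_def by linarith
    then have "2 * M + 3 \<le> 2 powr b" by (simp add: log_le_iff)
    then show ?thesis by (simp add: powr_realpow)
  qed
  then have b: "2 * int M + 3 \<le> 2 ^ b"
  proof -
    have "real_of_int (2 * int M + 3) \<le> real_of_int (2 ^ b)" using \<open>2 * M + 3 \<le> (2::real) ^ b\<close> by simp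
    then show ?thesis by (simp only: of_int_le_iff)
  qed
  obtain C1 where C1: "C1 > 0" "\<And>d l z. (\<Sum>n\<in>dgrid d l. cdist d l z (gpt l n) powr (-2)) \<le> C1 ^ d"
    using sum_cdist_bound[of 2] by auto
  define K where "K = real ((2 * M + 3) * 3 ^ M) ^ d"
  define P where "P = (1 + 2 * pi) powr (d * 2)"
  have K0: "K > 0" and P0: "P > 0" unfolding K_def P_def using pi_gt_zero by (auto simp: add_pos_pos simp del: pi_gt_zero)
  define C where "C = (if \<rho> \<le> 1 then K * P else K powr \<rho> * (P * C1 ^ d) powr (\<rho> - 1) * P)"
  show ?thesis
  proof (rule that)
    show "C > 0" using K0 P0 C1 by (simp add: C_def)
    fix l J g z
    assume lJ: "\<And>i. i < d \<Longrightarrow> l i + b \<le> J" and g: "trigpoly d (\<lambda>i. 2 ^ l i) g"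
    define V where "V = dgrid d (\<lambda>_. J)"
    define x where "x v = gpt (\<lambda>_. J) v" for v
    define T where "T = 2 ^ (\<Sum>i<d. l i) / (2::real) ^ (J * d)"
    have T0: "T > 0" by (simp add: T_def)
    have fV: "finite V" by (simp add: V_def)
    have J: "(2 * int M + 3) * 2 ^ l i \<le> 2 ^ J" if "i < d" for i
    proof -
      have "(2 * int M + 3) * 2 ^ l i \<le> 2 ^ b * 2 ^ l i" using b by (intro mult_right_mono) auto
      also have "\<dots> = 2 ^ (l i + b)" by (simp add: power_add)
      also have "\<dots> \<le> 2 ^ J" using lJ[OF that] by (intro power_increasing) auto
      finally show ?thesis .
    qed
    have lJ': "l i \<le> J" if "i < d" for i using lJ[OF that] by simp
    have pw: "norm (g z) \<le> K * T * (\<Sum>v\<in>V. norm (g (x v)) * cdist d l z (x v) powr (- real M))" for z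
      using trigpoly_pointwise[OF g J, of z] by (simp add: K_def T_def V_def x_def)
    have cd: "cdist d l z w powr (-s) \<le> cdist d l z w powr (-2)" if "s \<ge> 2" for z w s
      using cdist_ge_1[of d l z w] that by (intro powr_mono) auto
    have blk: "T * (\<Sum>v\<in>V. A v * cdist d l z (x v) powr (-2)) \<le> P * (\<Sum>m\<in>dgrid d l. bavg d J l A m * cdist d l z (gpt l m) powr (-2))"
      if "\<And>v. A v \<ge> 0" for A
      using block_sum_le[where d=d and l=l and A=A and J=J and s=2 and z=z, OF lJ' that] by (simp add: T_def V_def x_def P_def mult.commute)
    \<comment> \<open>\<open>peetre\<close> compares points of a single type, so the grid has to be
      a set of points instead of indices.\<close>
    have img: "(\<Sum>y\<in>x ` V. f y) = (\<Sum>v\<in>V. f (x v))" for f :: "_ \<Rightarrow> real"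
    proof (rule sum.reindex_cong[of x V])
      show "inj_on x V"
      proof (rule inj_onI)
        fix v w assume vw: "v \<in> V" "w \<in> V" and e: "x v = x w"
        have "v i = w i" for i using fun_cong[OF e, of i] by (simp add: x_def gpt_def pt_def)
        then show "v = w" by blast
      qed
    qed auto
    show "norm (g z) powr \<rho> \<le> C * (\<Sum>m\<in>dgrid d l. bavg d J l (\<lambda>v. norm (g (gpt (\<lambda>_. J) v)) powr \<rho>) m * cdist d l z (gpt l m) powr (-2))"
    proof (cases "\<rho> \<le> 1")
      case True
      then have r: "\<rho>' = \<rho>" by (simp add: \<rho>'_def)
      have "norm (g z) powr \<rho> \<le> K * T * (\<Sum>y\<in>x ` V. norm (g y) powr \<rho> * cdist d l z y powr (- real M * \<rho>))"
      proof (rule peetre)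
        show "norm (g z) \<le> K * T * (\<Sum>y\<in>x ` V. norm (g y) * cdist d l z y powr (- real M))" for z
          unfolding img by (rule pw)
      qed (use fV \<rho> True K0 T0 in \<open>auto intro: cdist_ge_1 cdist_mult\<close>)
      also have "\<dots> \<le> K * T * (\<Sum>v\<in>V. norm (g (x v)) powr \<rho> * cdist d l z (x v) powr (-2))"
        unfolding img using K0 T0 M2 r
        by (intro mult_left_mono sum_mono) (use cd[of "real M * \<rho>"] in auto)
      also have "\<dots> \<le> K * (P * (\<Sum>m\<in>dgrid d l. bavg d J l (\<lambda>v. norm (g (x v)) powr \<rho>) m * cdist d l z (gpt l m) powr (-2)))"
        unfolding mult.assoc using K0 by (intro mult_left_mono blk) auto
      finally show ?thesis using True by (simp add: C_def x_def mult.assoc)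
    next
      case False
      then have r: "\<rho>' = 1" by (simp add: \<rho>'_def)
      define w where "w v = T * cdist d l z (x v) powr (-2)" for v
      have w0: "w v \<ge> 0" for v using T0 by (simp add: w_def)
      have sw: "(\<Sum>v\<in>V. w v) \<le> P * C1 ^ d"
      proof -
        have "(\<Sum>v\<in>V. w v) = T * (\<Sum>v\<in>V. 1 * cdist d l z (x v) powr (-2))"
          by (simp add: w_def sum_distrib_left)
        also have "\<dots> \<le> P * (\<Sum>m\<in>dgrid d l. bavg d J l (\<lambda>_. 1) m * cdist d l z (gpt l m) powr (-2))"
          by (rule blk) simp
        also have "\<dots> = P * (\<Sum>m\<in>dgrid d l. cdist d l z (gpt l m) powr (-2))"
          using bavg_one[OF lJ'] by simp
        also have "\<dots> \<le> P * C1 ^ d" using P0 by (intro mult_left_mono C1) auto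
        finally show ?thesis .
      qed
      have "norm (g z) \<le> K * T * (\<Sum>v\<in>V. norm (g (x v)) * cdist d l z (x v) powr (- real M))" by (rule pw)
      also have "\<dots> \<le> K * T * (\<Sum>v\<in>V. norm (g (x v)) * cdist d l z (x v) powr (-2))"
        using K0 T0 M2 r by (intro mult_left_mono sum_mono cd) auto
      also have "\<dots> = K * (\<Sum>v\<in>V. w v * norm (g (x v)))" by (simp add: w_def sum_distrib_left mult_ac)
      finally have "norm (g z) powr \<rho> \<le> (K * (\<Sum>v\<in>V. w v * norm (g (x v)))) powr \<rho>"
        using \<rho> by (intro powr_mono2) auto
      also have "\<dots> = K powr \<rho> * (\<Sum>v\<in>V. w v * norm (g (x v))) powr \<rho>"
        by (rule powr_mult)
      also have "(\<Sum>v\<in>V. w v * norm (g (x v))) powr \<rho> \<le> (\<Sum>v\<in>V. w v) powr (\<rho> - 1) * (\<Sum>v\<in>V. w v * norm (g (x v)) powr \<rho>)"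
        using False fV w0 by (intro weighted_power_mean) auto
      also have "\<dots> \<le> (P * C1 ^ d) powr (\<rho> - 1) * (P * (\<Sum>m\<in>dgrid d l. bavg d J l (\<lambda>v. norm (g (x v)) powr \<rho>) m * cdist d l z (gpt l m) powr (-2)))"
      proof (intro mult_mono powr_mono2 sw)
        show "(\<Sum>v\<in>V. w v * norm (g (x v)) powr \<rho>) \<le> P * (\<Sum>m\<in>dgrid d l. bavg d J l (\<lambda>v. norm (g (x v)) powr \<rho>) m * cdist d l z (gpt l m) powr (-2))"
          using blk[of "\<lambda>v. norm (g (x v)) powr \<rho>"] by (simp add: w_def sum_distrib_left mult_ac)
      qed (use False w0 in \<open>auto intro!: sum_nonneg\<close>)
      finally show ?thesis using False K0 by (simp add: C_def x_def mult_ac)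
    qed
  qed
qed

text \<open>A Schur test: the symmetric matrix \<open>w n m\<close> has row and column sums at most
  \<open>D\<close>, hence acts on \<ell>_\<kappa> with norm at most \<open>D\<close>. Applied to the
  pointwise bound of \<open>trigpoly_peetre\<close> at the grid points of level \<open>l\<close>, it
  leaves only the box averages.\<close>

lemma trigpoly_sampled_bound:
  fixes \<rho> \<kappa> :: real
  assumes \<rho>: "\<rho> > 0" and \<kappa>: "\<kappa> > 1"
  obtains C b where "C > 0" and "\<And>l J g. (\<And>i. i < d \<Longrightarrow> l i + b \<le> J) \<Longrightarrow> trigpoly d (\<lambda>i. 2 ^ l i) g \<Longrightarrow>
     lnorm \<kappa> (dgrid d l) (\<lambda>n. norm (g (gpt l n)) powr \<rho>) \<le> C * lnorm \<kappa> (dgrid d l) (bavg d J l (\<lambda>v. norm (g (gpt (\<lambda>_. J) v)) powr \<rho>))"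
proof (rule trigpoly_peetre[OF \<rho>, where d=d])
  fix C b assume C: "C > 0" and pee: "\<And>l J g z. (\<And>i. i < d \<Longrightarrow> l i + b \<le> J) \<Longrightarrow> trigpoly d (\<lambda>i. 2 ^ l i) g \<Longrightarrow>
     norm (g z) powr \<rho> \<le> C * (\<Sum>m\<in>dgrid d l. bavg d J l (\<lambda>v. norm (g (gpt (\<lambda>_. J) v)) powr \<rho>) m * cdist d l z (gpt l m) powr (-2))"
  obtain C1 where C1: "C1 > 0" "\<And>d l z. (\<Sum>n\<in>dgrid d l. cdist d l z (gpt l n) powr (-2)) \<le> C1 ^ d"
    using sum_cdist_bound[of 2] by auto
  define D where "D = C1 ^ d"
  have D: "D > 0" using C1 by (simp add: D_def)
  show ?thesis
  proof (rule that)
    show "C * D > 0" using C D by simp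
    fix l J g
    assume lJ: "\<And>i. i < d \<Longrightarrow> l i + b \<le> J" and g: "trigpoly d (\<lambda>i. 2 ^ l i) g"
    define G where "G = dgrid d l"
    define a where "a = bavg d J l (\<lambda>v. norm (g (gpt (\<lambda>_. J) v)) powr \<rho>)"
    define w where "w n m = cdist d l (gpt l n) (gpt l m) powr (-2)" for n m
    have a0: "a m \<ge> 0" for m unfolding a_def by (rule bavg_nonneg) auto
    have row: "(\<Sum>m\<in>G. w n m) \<le> D" for n unfolding w_def G_def D_def by (rule C1)
    have col: "(\<Sum>n\<in>G. w n m) \<le> D" for m using row[of m] unfolding w_def by (simp add: cdist_commute)
    have w0: "w n m \<ge> 0" for n m by (simp add: w_def)
    have fG: "finite G" by (simp add: G_def)
    have "(\<Sum>n\<in>G. (\<Sum>m\<in>G. w n m * a m) powr \<kappa>) \<le> (\<Sum>n\<in>G. D powr (\<kappa> - 1) * (\<Sum>m\<in>G. w n m * a m powr \<kappa>))"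
    proof (rule sum_mono)
      fix n
      have "(\<Sum>m\<in>G. w n m * a m) powr \<kappa> \<le> (\<Sum>m\<in>G. w n m) powr (\<kappa> - 1) * (\<Sum>m\<in>G. w n m * a m powr \<kappa>)"
        using fG \<kappa> w0 a0 by (intro weighted_power_mean) auto
      also have "\<dots> \<le> D powr (\<kappa> - 1) * (\<Sum>m\<in>G. w n m * a m powr \<kappa>)"
        using \<kappa> w0 by (intro mult_right_mono powr_mono2 row sum_nonneg) auto
      finally show "(\<Sum>m\<in>G. w n m * a m) powr \<kappa> \<le> D powr (\<kappa> - 1) * (\<Sum>m\<in>G. w n m * a m powr \<kappa>)" .
    qed
    also have "\<dots> = D powr (\<kappa> - 1) * (\<Sum>m\<in>G. (\<Sum>n\<in>G. w n m) * a m powr \<kappa>)"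
      unfolding sum_distrib_left sum_distrib_right by (rule sum.swap)
    also have "\<dots> \<le> D powr (\<kappa> - 1) * (\<Sum>m\<in>G. D * a m powr \<kappa>)"
      by (intro mult_left_mono sum_mono mult_right_mono col) auto
    also have "\<dots> = D powr \<kappa> * (\<Sum>m\<in>G. a m powr \<kappa>)"
      using D by (simp add: powr_diff flip: sum_distrib_left)
    finally have "lnorm \<kappa> G (\<lambda>n. \<Sum>m\<in>G. w n m * a m) \<le> (D powr \<kappa> * (\<Sum>m\<in>G. a m powr \<kappa>)) powr (1/\<kappa>)"
      unfolding lnorm_def using \<kappa> by (intro powr_mono2) (auto intro!: sum_nonneg)
    also have "\<dots> = D * lnorm \<kappa> G a"
      using D \<kappa> by (simp add: lnorm_def powr_mult powr_powr sum_nonneg)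
    finally have main: "lnorm \<kappa> G (\<lambda>n. \<Sum>m\<in>G. w n m * a m) \<le> D * lnorm \<kappa> G a" .
    have "lnorm \<kappa> G (\<lambda>n. norm (g (gpt l n)) powr \<rho>) \<le> lnorm \<kappa> G (\<lambda>n. C * (\<Sum>m\<in>G. w n m * a m))"
      using pee[OF lJ g] \<kappa> by (intro lnorm_mono) (auto simp: a_def w_def G_def mult.commute[of "bavg d J l _ _"])
    also have "\<dots> = C * lnorm \<kappa> G (\<lambda>n. \<Sum>m\<in>G. w n m * a m)"
      using \<kappa> C w0 a0 by (intro lnorm_scale) (auto intro!: sum_nonneg)
    also have "\<dots> \<le> C * (D * lnorm \<kappa> G a)" using C main by (intro mult_left_mono) auto
    finally show "lnorm \<kappa> (dgrid d l) (\<lambda>n. norm (g (gpt l n)) powr \<rho>) \<le> C * D * lnorm \<kappa> (dgrid d l) (bavg d J l (\<lambda>v. norm (g (gpt (\<lambda>_. J) v)) powr \<rho>))"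
      by (simp add: G_def a_def mult.assoc)
  qed
qed

text \<open>One majorant \<open>A\<close> serves all \<open>l\<close> at once: the averages of every
  \<open>g l\<close> are dominated by averages of the same \<open>A\<close>, and the dyadic
  embedding sums these over all levels. This is the point at which a maximum over blocks taken
  before integration pays off.\<close>

lemma discrete_jawerth:
  fixes \<rho> \<kappa> :: real
  assumes \<rho>: "\<rho> > 0" and \<kappa>: "\<kappa> > 2"
  obtains C b where "C > 0" and "\<And>F J g A. F \<subseteq> PiE {..<d} (\<lambda>_. {..J}) \<Longrightarrow> (\<And>l i. l \<in> F \<Longrightarrow> i < d \<Longrightarrow> l i + b \<le> J) \<Longrightarrow>
     (\<And>l. l \<in> F \<Longrightarrow> trigpoly d (\<lambda>i. 2 ^ l i) (g l)) \<Longrightarrow>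
     (\<And>v. 0 \<le> A v) \<Longrightarrow> (\<And>l v. l \<in> F \<Longrightarrow> norm (g l (gpt (\<lambda>_. J) v)) powr \<rho> \<le> A v) \<Longrightarrow>
     (\<Sum>l\<in>F. (lnorm \<kappa> (dgrid d l) (\<lambda>n. norm (g l (gpt l n)) powr \<rho>))\<^sup>2 / 2 ^ (\<Sum>i<d. l i))
       \<le> C * ((\<Sum>v\<in>dgrid d (\<lambda>_. J). (A v)\<^sup>2) / 2 ^ (J * d))"
proof (rule trigpoly_sampled_bound[OF \<rho>, where d=d and \<kappa>=\<kappa>])
  show "1 < \<kappa>" using \<kappa> by simp
next
  fix C b assume C: "C > 0" and sb: "\<And>l J g. (\<And>i. i < d \<Longrightarrow> l i + b \<le> J) \<Longrightarrow> trigpoly d (\<lambda>i. 2 ^ l i) g \<Longrightarrow>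
     lnorm \<kappa> (dgrid d l) (\<lambda>n. norm (g (gpt l n)) powr \<rho>) \<le> C * lnorm \<kappa> (dgrid d l) (bavg d J l (\<lambda>v. norm (g (gpt (\<lambda>_. J) v)) powr \<rho>))"
  define E where "E = (1 / (1 - 2 powr (1/\<kappa> - 1/2))\<^sup>2) ^ d"
  have "1/\<kappa> < 1/2" using \<kappa> by (simp add: field_simps)
  then have "2 powr (1/\<kappa> - 1/2) < 1" by (auto simp: powr_less_one)
  then have E: "E > 0" unfolding E_def by (intro zero_less_power divide_pos_pos) auto
  show ?thesis
  proof (rule that)
    show "C\<^sup>2 * E > 0" using C E by simp
    fix F J g A
    assume F: "F \<subseteq> PiE {..<d} (\<lambda>_. {..J})" and lJ: "\<And>l i. l \<in> F \<Longrightarrow> i < d \<Longrightarrow> l i + b \<le> J"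
     and g: "\<And>l. l \<in> F \<Longrightarrow> trigpoly d (\<lambda>i. 2 ^ l i) (g l)"
     and A: "\<And>v. 0 \<le> A v" and gA: "\<And>l v. l \<in> F \<Longrightarrow> norm (g l (gpt (\<lambda>_. J) v)) powr \<rho> \<le> A v"
    have "(\<Sum>l\<in>F. (lnorm \<kappa> (dgrid d l) (\<lambda>n. norm (g l (gpt l n)) powr \<rho>))\<^sup>2 / 2 ^ (\<Sum>i<d. l i))
       \<le> (\<Sum>l\<in>F. (C * lnorm \<kappa> (dgrid d l) (bavg d J l A))\<^sup>2 / 2 ^ (\<Sum>i<d. l i))"
    proof (intro sum_mono divide_right_mono power_mono)
      fix l assume l: "l \<in> F"
      have "lnorm \<kappa> (dgrid d l) (\<lambda>n. norm (g l (gpt l n)) powr \<rho>) \<le> C * lnorm \<kappa> (dgrid d l) (bavg d J l (\<lambda>v. norm (g l (gpt (\<lambda>_. J) v)) powr \<rho>))"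
        using l by (intro sb lJ g)
      also have "\<dots> \<le> C * lnorm \<kappa> (dgrid d l) (bavg d J l A)"
        using C \<kappa> gA[OF l] by (intro mult_left_mono lnorm_mono bavg_mono bavg_nonneg) auto
      finally show "lnorm \<kappa> (dgrid d l) (\<lambda>n. norm (g l (gpt l n)) powr \<rho>) \<le> C * lnorm \<kappa> (dgrid d l) (bavg d J l A)" .
    qed auto
    also have "\<dots> = C\<^sup>2 * (\<Sum>l\<in>F. (lnorm \<kappa> (dgrid d l) (bavg d J l A))\<^sup>2 / 2 ^ (\<Sum>i<d. l i))"
      by (simp add: power_mult_distrib sum_distrib_left)
    also have "\<dots> \<le> C\<^sup>2 * (\<Sum>l\<in>PiE {..<d} (\<lambda>_. {..J}). (lnorm \<kappa> (dgrid d l) (bavg d J l A))\<^sup>2 / 2 ^ (\<Sum>i<d. l i))"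
      using F by (intro mult_left_mono sum_mono2) (auto intro!: finite_PiE)
    also have "\<dots> \<le> C\<^sup>2 * (E * ((\<Sum>v\<in>dgrid d (\<lambda>_. J). (A v)\<^sup>2) / 2 ^ (J * d)))"
      unfolding E_def by (intro mult_left_mono dyadic_embedding \<kappa> A) auto
    finally show "(\<Sum>l\<in>F. (lnorm \<kappa> (dgrid d l) (\<lambda>n. norm (g l (gpt l n)) powr \<rho>))\<^sup>2 / 2 ^ (\<Sum>i<d. l i))
       \<le> C\<^sup>2 * E * ((\<Sum>v\<in>dgrid d (\<lambda>_. J). (A v)\<^sup>2) / 2 ^ (J * d))" by (simp add: mult.assoc)
  qed
qed

section \<open>Integration on the torus\<close>

abbreviation circle_measure :: "real measure" where
  "circle_measure \<equiv> restrict_space lborel {-pi..pi}"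

lemma space_circle [simp]: "space circle_measure = {-pi..pi}"
  by (simp add: space_restrict_space)

lemma finite_measure_circle: "finite_measure circle_measure"
  by (rule finite_measureI) (simp add: emeasure_restrict_space)

lemma product_sigma_finite_circle: "product_sigma_finite (\<lambda>_::nat. circle_measure)"
  by (simp add: product_sigma_finite_def finite_measure.sigma_finite_measure finite_measure_circle
      finite_measure.axioms(1))

lemma space_torus: "space (torus_measure d) = PiE {..<d} (\<lambda>_. {-pi..pi})"
  by (simp add: torus_measure_def space_PiM)

lemma torus_integral_prod:
  fixes f :: "nat \<Rightarrow> real \<Rightarrow> 'b::{real_normed_field,banach,second_countable_topology}"
  assumes "\<And>i. i < d \<Longrightarrow> integrable circle_measure (f i)"
  shows "(\<integral>x. (\<Prod>i<d. f i (x i)) \<partial>torus_measure d) = (\<Prod>i<d. integral\<^sup>L circle_measure (f i))"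
  unfolding torus_measure_def
  by (rule product_sigma_finite.product_integral_prod[OF product_sigma_finite_circle]) (use assms in auto)

lemma torus_integrable_prod:
  fixes f :: "nat \<Rightarrow> real \<Rightarrow> 'b::{real_normed_field,banach,second_countable_topology}"
  assumes "\<And>i. i < d \<Longrightarrow> integrable circle_measure (f i)"
  shows "integrable (torus_measure d) (\<lambda>x. \<Prod>i<d. f i (x i))"
  unfolding torus_measure_def
  by (rule product_sigma_finite.product_integrable_prod[OF product_sigma_finite_circle]) (use assms in auto)

lemma finite_measure_torus: "finite_measure (torus_measure d)"
proof (rule finite_measureI)
  interpret product_sigma_finite "\<lambda>_::nat. circle_measure" by (rule product_sigma_finite_circle)
  have "emeasure (torus_measure d) (PiE {..<d} (\<lambda>_. {-pi..pi})) = (\<Prod>i<d. emeasure circle_measure {-pi..pi})"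
    unfolding torus_measure_def by (subst emeasure_PiM) (auto simp: sets_restrict_space)
  also have "\<dots> = ennreal (2 * pi) ^ d" by (simp add: emeasure_restrict_space)
  finally show "emeasure (torus_measure d) (space (torus_measure d)) \<noteq> \<infinity>"
    by (simp add: space_torus ennreal_power)
qed

lemma torus_bounded_integrable:
  fixes f :: "(nat \<Rightarrow> real) \<Rightarrow> 'b::{banach,second_countable_topology}"
  assumes "f \<in> borel_measurable (torus_measure d)" "\<And>x. x \<in> space (torus_measure d) \<Longrightarrow> norm (f x) \<le> B"
  shows "integrable (torus_measure d) f"
  by (rule finite_measure.integrable_const_bound[OF finite_measure_torus, of f B]) (use assms in auto)

lemma circle_bounded_integrable:
  fixes f :: "real \<Rightarrow> 'b::{banach,second_countable_topology}"
  assumes "f \<in> borel_measurable borel" "\<And>x. norm (f x) \<le> B"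
  shows "integrable circle_measure f"
  by (rule finite_measure.integrable_const_bound[OF finite_measure_circle, of f B])
     (use assms in \<open>auto intro: measurable_restrict_space1\<close>)

text \<open>Points of the product measure are \<open>undefined\<close> outside
  \<open>{..<d}\<close>. Padding with 0 gives a measurable map into the full product, through which
  functions of the first \<open>d\<close> coordinates are pulled back.\<close>

definition extz :: "nat \<Rightarrow> (nat \<Rightarrow> real) \<Rightarrow> nat \<Rightarrow> real" where
  "extz d x = (\<lambda>i. if i < d then x i else 0)"

lemma torus_component_measurable:
  assumes "i < d" shows "(\<lambda>x. x i) \<in> borel_measurable (torus_measure d)"
proof -
  have "(\<lambda>x. x i) \<in> measurable (torus_measure d) circle_measure"
    unfolding torus_measure_def by (rule measurable_component_singleton) (use assms in auto)
  moreover have "(\<lambda>t. t) \<in> borel_measurable circle_measure" by (rule measurable_restrict_space1) auto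
  ultimately show ?thesis by (rule measurable_compose)
qed

lemma extz_measurable: "extz d \<in> measurable (torus_measure d) borel"
proof (rule measurable_coordinatewise_then_product)
  fix i show "(\<lambda>x. extz d x i) \<in> borel_measurable (torus_measure d)"
    using torus_component_measurable[of i d] by (cases "i < d") (auto simp: extz_def)
qed

lemma torus_measurable:
  fixes F :: "(nat \<Rightarrow> real) \<Rightarrow> 'b::topological_space"
  assumes "continuous_on UNIV F" "\<And>x y. (\<And>i. i < d \<Longrightarrow> x i = y i) \<Longrightarrow> F x = F y"
  shows "F \<in> borel_measurable (torus_measure d)"
proof -
  have "F \<in> borel_measurable borel" using assms(1) by (rule borel_measurable_continuous_onI)
  then have "(\<lambda>x. F (extz d x)) \<in> borel_measurable (torus_measure d)"
    by (rule measurable_compose[OF extz_measurable])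
  moreover have "F (extz d x) = F x" for x by (rule assms(2)) (simp add: extz_def)
  ultimately show ?thesis by simp
qed

text \<open>Continuity refers to the product topology on all coordinates, while the conclusion
  restrains only the first \<open>d\<close>. In a violating sequence the other coordinates are reset
  to those of \<open>x0\<close>, which changes no value of \<open>F\<close> and forces
  convergence.\<close>

lemma continuous_delta:
  fixes F :: "(nat \<Rightarrow> real) \<Rightarrow> 'b::metric_space"
  assumes cont: "continuous_on UNIV F" and dep: "\<And>x y. (\<And>i. i < d \<Longrightarrow> x i = y i) \<Longrightarrow> F x = F y" and e: "e > 0"
  obtains \<delta> where "\<delta> > 0" "\<And>x. (\<And>i. i < d \<Longrightarrow> \<bar>x i - x0 i\<bar> < \<delta>) \<Longrightarrow> dist (F x) (F x0) < e"
proof (rule ccontr)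
  assume no: "\<not> thesis"
  have "\<exists>x. (\<forall>i<d. \<bar>x i - x0 i\<bar> < 1 / Suc n) \<and> e \<le> dist (F x) (F x0)" for n
  proof (rule ccontr)
    assume "\<not> ?thesis"
    then have "thesis" by (intro that[of "1 / Suc n"]) (auto simp: not_le)
    with no show False by simp
  qed
  then obtain X where X: "\<And>n i. i < d \<Longrightarrow> \<bar>X n i - x0 i\<bar> < 1 / Suc n" "\<And>n. e \<le> dist (F (X n)) (F x0)"
    by metis
  define Y where "Y n i = (if i < d then X n i else x0 i)" for n i
  have "(\<lambda>n. Y n i) \<longlonglongrightarrow> x0 i" for i
  proof (cases "i < d")
    case True
    have "(\<lambda>n. X n i - x0 i) \<longlonglongrightarrow> 0"
      by (rule Lim_null_comparison[OF _ LIMSEQ_inverse_real_of_nat]) (use X(1)[OF True] in \<open>auto simp: inverse_eq_divide intro!: always_eventually less_imp_le\<close>)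
    then show ?thesis using True by (simp add: Y_def LIM_zero_iff)
  next
    case False then show ?thesis by (simp add: Y_def)
  qed
  then have "limitin (product_topology (\<lambda>_. euclidean) UNIV) Y x0 sequentially"
    by (simp add: limitin_componentwise)
  then have "Y \<longlonglongrightarrow> x0" by (simp add: euclidean_product_topology)
  moreover have "isCont F x0" using cont by (simp add: continuous_on_eq_continuous_at)
  ultimately have "(\<lambda>n. F (Y n)) \<longlonglongrightarrow> F x0" by (rule isCont_tendsto_compose[rotated])
  then have "\<forall>\<^sub>F n in sequentially. dist (F (Y n)) (F x0) < e" using e by (rule tendstoD)
  then obtain n where "dist (F (Y n)) (F x0) < e" by (meson eventually_sequentially order_refl)
  moreover have "F (Y n) = F (X n)" by (rule dep) (simp add: Y_def)
  ultimately show False using X(2)[of n] by simp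
qed

text \<open>The number of the dyadic cell containing \<open>x\<close>. The \<open>min\<close>
  assigns the right endpoint \<open>pi\<close> to the last cell, which is therefore closed.\<close>

definition pidx :: "nat \<Rightarrow> real \<Rightarrow> nat" where
  "pidx J x = min (nat \<lfloor>(x + pi) * 2 ^ J / (2 * pi)\<rfloor>) (2 ^ J - 1)"

lemma pidx_less: "pidx J x < 2 ^ J"
proof -
  have "pidx J x \<le> 2 ^ J - 1" "(0::nat) < 2 ^ J" by (simp_all add: pidx_def)
  then show ?thesis by linarith
qed

lemma pidx_cell:
  assumes x: "x \<in> {-pi..pi}" and n: "n < 2 ^ J"
  shows "pidx J x = n \<longleftrightarrow> pt J n \<le> x \<and> (x < pt J (Suc n) \<or> Suc n = 2 ^ J)"
proof -
  define y where "y = (x + pi) * 2 ^ J / (2 * pi)"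
  have y0: "0 \<le> y" "y \<le> 2 ^ J"   proof -
    have "0 \<le> (x + pi) * 2 ^ J" "(x + pi) * 2 ^ J \<le> (2 * pi) * 2 ^ J" using x by (auto intro!: mult_right_mono)
    then show "0 \<le> y" "y \<le> 2 ^ J" by (auto simp: y_def field_simps)
  qed
  have ge: "pt J k \<le> x \<longleftrightarrow> k \<le> y" for k by (simp add: pt_def y_def field_simps)
  have gt: "x < pt J k \<longleftrightarrow> y < k" for k by (simp add: pt_def y_def field_simps)
  define m where "m = nat \<lfloor>y\<rfloor>"
  have m: "real m \<le> y" "y < real m + 1" using y0 unfolding m_def by linarith+
  have nk: "real n \<le> 2 ^ J - 1"
  proof -
    have "Suc n \<le> 2 ^ J" using n by simp
    then have "real (Suc n) \<le> 2 ^ J" by (metis of_nat_mono of_nat_numeral of_nat_power)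
    then show ?thesis by simp
  qed
  show ?thesis
  proof (cases "Suc n = 2 ^ J")
    case True
    have "pidx J x = n \<longleftrightarrow> n \<le> m"
      unfolding pidx_def y_def[symmetric] m_def[symmetric] using True by (auto simp: min_def)
    also have "\<dots> \<longleftrightarrow> real n \<le> y" using m by linarith
    finally show ?thesis using True ge by simp
  next
    case False
    have "pidx J x = n \<longleftrightarrow> n = m"
      unfolding pidx_def y_def[symmetric] m_def[symmetric] using False n by (auto simp: min_def)
    also have "\<dots> \<longleftrightarrow> real n \<le> y \<and> y < real n + 1" using m by linarith
    finally show ?thesis using False ge gt[of "Suc n"] by (simp add: add.commute)
  qed
qed

lemma pt_pidx_close:
  assumes x: "x \<in> {-pi..pi}"
  shows "\<bar>pt J (pidx J x) - x\<bar> \<le> 2 * pi / 2 ^ J"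
proof -
  let ?n = "pidx J x"
  have c: "pt J ?n \<le> x" "x < pt J (Suc ?n) \<or> Suc ?n = 2 ^ J" using pidx_cell[OF x pidx_less[of J x]] by auto
  have s: "pt J (Suc n) = pt J n + 2 * pi / 2 ^ J" for n by (simp add: pt_def field_simps)
  have "x \<le> pt J (Suc ?n)"
  proof (cases "Suc ?n = 2 ^ J")
    case True
    then have "pt J (Suc ?n) = pi" unfolding True by (simp add: pt_def)
    then show ?thesis using x by simp
  qed (use c in auto)
  then show ?thesis using c(1) s by simp
qed

lemma cell_integral:
  assumes n: "n < 2 ^ J"
  shows "integrable circle_measure (\<lambda>x. indicator {x. pidx J x = n} x :: real)"
    and "(\<integral>x. indicator {x. pidx J x = n} x \<partial>circle_measure) = 2 * pi / 2 ^ J"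
proof -
  let ?I = "if Suc n = 2 ^ J then {pt J n..pt J (Suc n)} else {pt J n..<pt J (Suc n)}"
  have s: "pt J (Suc n) = pt J n + 2 * pi / 2 ^ J" by (simp add: pt_def field_simps)
  have lo: "-pi \<le> pt J n" by (simp add: pt_def)
  have hi: "pt J (Suc n) \<le> pi"
  proof -
    have "Suc n \<le> 2 ^ J" using n by simp
    then have "real (Suc n) \<le> 2 ^ J" by (metis of_nat_mono of_nat_numeral of_nat_power)
    then have "real (Suc n) / 2 ^ J \<le> 1" by simp
    then have "2 * pi * (real (Suc n) / 2 ^ J) \<le> 2 * pi * 1" by (intro mult_left_mono) auto
    then show ?thesis by (simp add: pt_def)
  qed
  have top: "Suc n = 2 ^ J \<Longrightarrow> pt J (Suc n) = pi" unfolding pt_def by (simp del: of_nat_Suc)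
  have eq: "indicator {-pi..pi} x *\<^sub>R (indicator {x. pidx J x = n} x :: real) = indicator ?I x" for x
  proof (cases "x \<in> {-pi..pi}")
    case True
    then show ?thesis using pidx_cell[OF True n] top by (auto simp: indicator_def)
  next
    case False
    then show ?thesis using lo hi by (auto simp: indicator_def)
  qed
  have fin: "integrable lborel (indicator ?I :: real \<Rightarrow> real)"
    using s by (intro integrable_real_indicator) (auto simp: emeasure_lborel_Icc_eq)
  have "integrable lborel (\<lambda>x. indicator {-pi..pi} x *\<^sub>R (indicator {x. pidx J x = n} x :: real))"
    unfolding eq by (rule fin)
  then show "integrable circle_measure (\<lambda>x. indicator {x. pidx J x = n} x :: real)"
    by (rule iffD2[OF integrable_restrict_space, rotated]) simp
  have "(\<integral>x. indicator {x. pidx J x = n} x \<partial>circle_measure)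
      = (\<integral>x. indicator {-pi..pi} x *\<^sub>R (indicator {x. pidx J x = n} x :: real) \<partial>lborel)"
    by (rule integral_restrict_space) simp
  also have "\<dots> = (\<integral>x. indicator ?I x \<partial>lborel)" unfolding eq ..
  also have "\<dots> = 2 * pi / 2 ^ J" using s by auto
  finally show "(\<integral>x. indicator {x. pidx J x = n} x \<partial>circle_measure) = 2 * pi / 2 ^ J" .
qed

text \<open>The sum at level \<open>J\<close> is the integral of the step function
  \<open>S J\<close>, which evaluates \<open>F\<close> at the left corner of the cell of
  \<open>x\<close>. Continuity gives pointwise convergence, and boundedness gives dominated
  convergence.\<close>

lemma riemann_sum_tendsto:
  fixes F :: "(nat \<Rightarrow> real) \<Rightarrow> real"
  assumes cont: "continuous_on UNIV F" and dep: "\<And>x y. (\<And>i. i < d \<Longrightarrow> x i = y i) \<Longrightarrow> F x = F y"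
    and bd: "\<And>x. \<bar>F x\<bar> \<le> B"
  shows "(\<lambda>J. (2 * pi) ^ d * ((\<Sum>v\<in>dgrid d (\<lambda>_. J). F (gpt (\<lambda>_. J) v)) / 2 ^ (J * d))) \<longlonglongrightarrow> (\<integral>x. F x \<partial>torus_measure d)"
proof -
  define S where "S J x = (\<Sum>v\<in>dgrid d (\<lambda>_. J). F (gpt (\<lambda>_. J) v) * (\<Prod>i<d. indicator {t. pidx J t = v i} (x i)))" for J x
  have int: "integrable (torus_measure d) (S J)"
    "(\<integral>x. S J x \<partial>torus_measure d) = (2 * pi) ^ d * ((\<Sum>v\<in>dgrid d (\<lambda>_. J). F (gpt (\<lambda>_. J) v)) / 2 ^ (J * d))" for J
  proof -
    have v: "integrable (torus_measure d) (\<lambda>x. \<Prod>i<d. indicator {t. pidx J t = v i} (x i) :: real)"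
      "(\<integral>x. (\<Prod>i<d. indicator {t. pidx J t = v i} (x i) :: real) \<partial>torus_measure d) = (2 * pi / 2 ^ J) ^ d"
      if "v \<in> dgrid d (\<lambda>_. J)" for v
    proof -
      have vi: "v i < 2 ^ J" if "i < d" for i using \<open>v \<in> _\<close> that by (auto simp: dgrid_def)
      show "integrable (torus_measure d) (\<lambda>x. \<Prod>i<d. indicator {t. pidx J t = v i} (x i) :: real)"
        by (rule torus_integrable_prod) (rule cell_integral(1)[OF vi])
      show "(\<integral>x. (\<Prod>i<d. indicator {t. pidx J t = v i} (x i) :: real) \<partial>torus_measure d) = (2 * pi / 2 ^ J) ^ d"
        by (subst torus_integral_prod) (use cell_integral[OF vi] in auto)
    qed
    show "integrable (torus_measure d) (S J)"
      unfolding S_def by (intro Bochner_Integration.integrable_sum integrable_mult_right v)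
    have "(\<integral>x. S J x \<partial>torus_measure d) = (\<Sum>v\<in>dgrid d (\<lambda>_. J). F (gpt (\<lambda>_. J) v) * (2 * pi / 2 ^ J) ^ d)"
      unfolding S_def by (subst Bochner_Integration.integral_sum) (auto intro!: v simp: v)
    also have "\<dots> = (2 * pi) ^ d * ((\<Sum>v\<in>dgrid d (\<lambda>_. J). F (gpt (\<lambda>_. J) v)) / 2 ^ (J * d))"
      by (simp add: power_divide power_mult sum_distrib_left sum_divide_distrib mult_ac)
    finally show "(\<integral>x. S J x \<partial>torus_measure d) = (2 * pi) ^ d * ((\<Sum>v\<in>dgrid d (\<lambda>_. J). F (gpt (\<lambda>_. J) v)) / 2 ^ (J * d))" .
  qed
  have S_eq: "S J x = F (\<lambda>i. pt J (pidx J (x i)))" for J x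
  proof -
    define w where "w = restrict (\<lambda>i. pidx J (x i)) {..<d}"
    have w: "w \<in> dgrid d (\<lambda>_. J)" unfolding w_def dgrid_def using pidx_less by auto
    have "(\<Prod>i<d. indicator {t. pidx J t = v i} (x i) :: real) = (if v = w then 1 else 0)" if v: "v \<in> dgrid d (\<lambda>_. J)" for v
    proof (cases "v = w")
      case True then show ?thesis by (simp add: w_def)
    next
      case False
      then obtain i where "i < d" "v i \<noteq> pidx J (x i)"
        using v w PiE_ext[of v "{..<d}" _ w] unfolding dgrid_def by (force simp: w_def)
      then show ?thesis using False by (auto intro!: prod_zero bexI[of _ i])
    qed
    then have "S J x = (\<Sum>v\<in>dgrid d (\<lambda>_. J). if v = w then F (gpt (\<lambda>_. J) v) else 0)"
      unfolding S_def by (intro sum.cong) auto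
    also have "\<dots> = F (gpt (\<lambda>_. J) w)" using w by simp
    also have "\<dots> = F (\<lambda>i. pt J (pidx J (x i)))" by (rule dep) (simp add: gpt_def w_def)
    finally show ?thesis .
  qed
  have "(\<lambda>J. \<integral>x. S J x \<partial>torus_measure d) \<longlonglongrightarrow> (\<integral>x. F x \<partial>torus_measure d)"
  proof (rule integral_dominated_convergence)
    show "F \<in> borel_measurable (torus_measure d)" by (rule torus_measurable[OF cont dep])
    show "S J \<in> borel_measurable (torus_measure d)" for J using int(1) by auto
    show "integrable (torus_measure d) (\<lambda>_. B)" by (intro finite_measure.integrable_const finite_measure_torus)
    show "AE x in torus_measure d. norm (S J x) \<le> B" for J by (simp add: S_eq bd)
    show "AE x in torus_measure d. (\<lambda>J. S J x) \<longlonglongrightarrow> F x"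
    proof (rule AE_I2)
      fix x assume x: "x \<in> space (torus_measure d)"
      show "(\<lambda>J. S J x) \<longlonglongrightarrow> F x"
      proof (rule tendstoI)
        fix e :: real assume "e > 0"
        obtain \<delta> where \<delta>: "\<delta> > 0" "\<And>y. (\<And>i. i < d \<Longrightarrow> \<bar>y i - x i\<bar> < \<delta>) \<Longrightarrow> dist (F y) (F x) < e"
          using continuous_delta[where F=F, OF cont dep \<open>e > 0\<close>, where ?x0.0=x] by blast
        have "(\<lambda>J. 2 * pi * (1/2) ^ J) \<longlonglongrightarrow> 2 * pi * 0" by (intro tendsto_mult tendsto_const LIMSEQ_power_zero) auto
        then have ev: "\<forall>\<^sub>F J in sequentially. 2 * pi * (1/2) ^ J < \<delta>"
          using \<delta>(1) order_tendstoD(2)[of _ "2 * pi * 0" sequentially \<delta>] by simp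
        have key: "dist (S J x) (F x) < e" if J: "2 * pi * (1/2) ^ J < \<delta>" for J
        proof -
          have "\<bar>pt J (pidx J (x i)) - x i\<bar> < \<delta>" if "i < d" for i
          proof -
            have "x i \<in> {-pi..pi}" using PiE_mem[of x "{..<d}" "\<lambda>_. {-pi..pi}" i] x that by (simp only: space_torus lessThan_iff)
            then have "\<bar>pt J (pidx J (x i)) - x i\<bar> \<le> 2 * pi / 2 ^ J" by (rule pt_pidx_close)
            also have "\<dots> = 2 * pi * (1/2) ^ J" by (simp add: power_divide)
            finally show ?thesis using J by linarith
          qed
          then show ?thesis unfolding S_eq by (intro \<delta>(2))
        qed
        show "\<forall>\<^sub>F J in sequentially. dist (S J x) (F x) < e"
          using ev by (rule eventually_mono) (rule key)
      qed
    qed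
  qed
  then show ?thesis unfolding int(2) .
qed

section \<open>Uniqueness of Fourier coefficients\<close>

lemma fourier_coeff_texp:
  "fourier_coeff d f k = (\<integral>x. f x * texp d (\<lambda>i. - k i) x \<partial>torus_measure d) / of_real ((2 * pi) ^ d)"
proof -
  have "exp (- \<i> * of_real (\<Sum>i<d. real_of_int (k i) * x i)) = texp d (\<lambda>i. - k i) x" for x
    by (simp add: texp_def cis_conv_exp sum_negf)
  then show ?thesis unfolding fourier_coeff_def by simp
qed

text \<open>A nonnegative trigonometric polynomial with maximal value 1 at 0, the power sharpening
  the peak. A function all of whose Fourier coefficients vanish is orthogonal to its
  translates.\<close>

definition bump :: "nat \<Rightarrow> real \<Rightarrow> real" where
  "bump n t = ((1 + cos t) / 2) ^ n"

lemma bump_bounds: "0 \<le> bump n t" "bump n t \<le> 1"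
proof -
  have "-1 \<le> cos t" "cos t \<le> 1" by auto
  then have "0 \<le> 1 + cos t" "1 + cos t \<le> 2" by linarith+
  then have "0 \<le> (1 + cos t) / 2" "(1 + cos t) / 2 \<le> 1" by simp_all
  then show "0 \<le> bump n t" "bump n t \<le> 1" unfolding bump_def by (auto intro: power_le_one)
qed

lemma bump_cis:
  "complex_of_real (bump n t) = (\<Sum>j\<le>2*n. (of_nat (2*n choose j) / 4 ^ n) * cis (real_of_int (int j - int n) * t))"
proof -
  \<comment> \<open>Up to the phase \<open>cis t\<close> the base is the square of
    \<open>(1 + cis t) / 2\<close>, so the coefficients are binomial.\<close>
  have "complex_of_real ((1 + cos t) / 2) * (4 * cis t) = (1 + cis t) ^ 2"
  proof (rule complex_eqI)
    have "2 * (cos t * (1 + cos t)) = (1 + cos t) * (1 + cos t) - sin t * sin t"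
      using sin_cos_squared_add3[of t] by (simp add: algebra_simps)
    then show "Re (complex_of_real ((1 + cos t) / 2) * (4 * cis t)) = Re ((1 + cis t) ^ 2)"
      by (simp add: power2_eq_square)
    show "Im (complex_of_real ((1 + cos t) / 2) * (4 * cis t)) = Im ((1 + cis t) ^ 2)"
      by (simp add: power2_eq_square algebra_simps)
  qed
  note sq = this
  have "complex_of_real (bump n t) * (4 * cis t) ^ n = (complex_of_real ((1 + cos t) / 2) * (4 * cis t)) ^ n"
    unfolding bump_def of_real_power power_mult_distrib ..
  also have "\<dots> = (1 + cis t) ^ (2 * n)" unfolding sq power_mult ..
  also have "\<dots> = (\<Sum>j\<le>2*n. of_nat (2*n choose j) * cis (real j * t))"
    using binomial_ring[of "cis t" 1 "2*n"] by (simp add: Complex.DeMoivre add.commute)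
  finally have "complex_of_real (bump n t) * (4 ^ n * cis (real n * t)) = (\<Sum>j\<le>2*n. of_nat (2*n choose j) * cis (real j * t))"
    by (simp add: power_mult_distrib Complex.DeMoivre)
  then have "complex_of_real (bump n t) * (4 ^ n * cis (real n * t)) * (cis (- (real n * t)) / 4 ^ n)
     = (\<Sum>j\<le>2*n. of_nat (2*n choose j) * cis (real j * t)) * (cis (- (real n * t)) / 4 ^ n)" by simp
  also have "\<dots> = (\<Sum>j\<le>2*n. (of_nat (2*n choose j) / 4 ^ n) * cis (real_of_int (int j - int n) * t))"
    unfolding sum_distrib_right
  proof (rule sum.cong)
    fix j
    have "cis (real_of_int (int j - int n) * t) = cis (real j * t) * cis (- (real n * t))"
      by (simp add: cis_mult algebra_simps)
    then show "of_nat (2*n choose j) * cis (real j * t) * (cis (- (real n * t)) / 4 ^ n)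
      = (of_nat (2*n choose j) / 4 ^ n) * cis (real_of_int (int j - int n) * t)" by simp
  qed simp
  also have "complex_of_real (bump n t) * (4 ^ n * cis (real n * t)) * (cis (- (real n * t)) / 4 ^ n)
      = complex_of_real (bump n t) * (cis (real n * t) * cis (- (real n * t))) * (4 ^ n / 4 ^ n)"
    by (simp only: times_divide_eq_right times_divide_eq_left mult_ac)
  also have "\<dots> = complex_of_real (bump n t)" by (simp add: cis_mult)
  finally show ?thesis .
qed

lemma bump_measurable [measurable]: "bump n \<in> borel_measurable borel"
  unfolding bump_def by (intro borel_measurable_continuous_onI continuous_intros) auto

text \<open>The functions \<open>bump n\<close> form an approximate identity at interior points; no periodicity of
  \<open>f\<close> is needed there.\<close>

lemma bump_concentration:
  fixes x0 \<delta> :: real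
  assumes \<delta>: "0 < \<delta>" "\<bar>x0\<bar> \<le> pi - \<delta>"
  obtains q where "0 \<le> q" "q < 1"
    and "\<And>n. 0 < (\<integral>t. bump n (t - x0) \<partial>circle_measure)"
    and "\<And>n. (\<integral>t. indicator {t. \<delta> \<le> \<bar>t - x0\<bar>} t * bump n (t - x0) \<partial>circle_measure)
        \<le> 2 * pi / \<delta> * q ^ n * (\<integral>t. bump n (t - x0) \<partial>circle_measure)"
proof -
  \<comment> \<open>The base of \<open>bump n (t - x0)\<close> is at most \<open>a\<close> at
    distance \<open>\<delta>\<close> or more and at least \<open>b\<close> within distance
    \<open>\<delta>/2\<close>, so far mass relative to total mass decays like
    \<open>(a / b) ^ n\<close>.\<close>
  define a b where "a = (1 + cos \<delta>) / 2" and "b = (1 + cos (\<delta>/2)) / 2"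
  have dpi: "\<delta> \<le> pi" using \<delta> abs_ge_zero[of x0] by linarith
  have ab: "0 \<le> a" "a < b"
  proof -
    have "0 \<le> 1 + cos \<delta>" using cos_ge_minus_one[of \<delta>] by linarith
    then show "0 \<le> a" unfolding a_def by simp
    have "cos \<delta> < cos (\<delta>/2)" using \<delta>(1) dpi by (intro cos_monotone_0_pi) auto
    then show "a < b" by (simp add: a_def b_def)
  qed
  have bint: "integrable circle_measure (\<lambda>t. bump n (t - x0))" for n
    by (rule circle_bounded_integrable[where B=1]) (use bump_bounds in auto)
  have fint: "integrable circle_measure (\<lambda>t. indicator {t. \<delta> \<le> \<bar>t - x0\<bar>} t * bump n (t - x0))" for n
    by (rule circle_bounded_integrable[where B=1]) (use bump_bounds in \<open>auto simp: indicator_def\<close>)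
  have mass: "\<delta> * b ^ n \<le> (\<integral>t. bump n (t - x0) \<partial>circle_measure)" for n
  proof -
    let ?N = "{x0 - \<delta>/2..x0 + \<delta>/2}"
    have sub: "?N \<subseteq> {-pi..pi}" using \<delta> by (auto simp: abs_le_iff)
    have "(\<integral>t. b ^ n * indicator ?N t \<partial>circle_measure) \<le> (\<integral>t. bump n (t - x0) \<partial>circle_measure)"
    proof (rule integral_mono)
      show "integrable circle_measure (\<lambda>t. b ^ n * indicator ?N t)"
        by (rule circle_bounded_integrable[where B="b^n"]) (use ab in \<open>auto simp: indicator_def\<close>)
      fix t assume "t \<in> space circle_measure"
      show "b ^ n * indicator ?N t \<le> bump n (t - x0)"
      proof (cases "t \<in> ?N")
        case True
        then have "t - x0 \<le> \<delta>/2" "-(t - x0) \<le> \<delta>/2" by simp_all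
          then have "\<bar>t - x0\<bar> \<le> \<delta>/2" by (rule abs_leI)
        then have "cos (\<delta>/2) \<le> cos \<bar>t - x0\<bar>" using \<delta> dpi by (intro cos_monotone_0_pi_le) auto
        then have "b \<le> (1 + cos (t - x0)) / 2" by (simp add: b_def)
        then show ?thesis using True ab by (auto simp: bump_def intro!: power_mono)
      qed (use bump_bounds in auto)
    qed (rule bint)
    moreover have "(\<integral>t. b ^ n * indicator ?N t \<partial>circle_measure) = \<delta> * b ^ n"
    proof -
      have "(\<integral>t. b ^ n * indicator ?N t \<partial>circle_measure) = (\<integral>t. b ^ n * indicator ?N t \<partial>lborel)"
      proof -
        have eq: "indicator {-pi..pi} t *\<^sub>R (b ^ n * indicator ?N t) = b ^ n * indicator ?N t" for t
          using sub by (cases "t \<in> ?N") auto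
        show ?thesis by (subst integral_restrict_space) (simp, simp only: eq)
      qed
      then show ?thesis using \<delta> by simp
    qed
    ultimately show ?thesis by (simp only:)
  qed
  show ?thesis
  proof (rule that[of "a / b"])
    show "0 \<le> a / b" "a / b < 1" using ab by auto
    fix n
    show pos: "0 < (\<integral>t. bump n (t - x0) \<partial>circle_measure)"
      using mass[of n] \<delta> ab by (smt (verit) mult_pos_pos zero_less_power)
    have "(\<integral>t. indicator {t. \<delta> \<le> \<bar>t - x0\<bar>} t * bump n (t - x0) \<partial>circle_measure) \<le> (\<integral>t. a ^ n \<partial>circle_measure)"
    proof (rule integral_mono)
      show "integrable circle_measure (\<lambda>t. a ^ n)" by (intro finite_measure.integrable_const finite_measure_circle)
      fix t assume t: "t \<in> space circle_measure"
      show "indicator {t. \<delta> \<le> \<bar>t - x0\<bar>} t * bump n (t - x0) \<le> a ^ n"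
      proof (cases "\<delta> \<le> \<bar>t - x0\<bar>")
        case True
        \<comment> \<open>As \<open>x0\<close> keeps the distance \<open>\<delta>\<close> from both
          ends, no point of the interval comes within \<open>\<delta>\<close> of a full turn from
          \<open>x0\<close>, where the cosine would return to 1.\<close>
        have up: "\<bar>t - x0\<bar> \<le> 2 * pi - \<delta>" using t \<delta> by auto
        have "cos \<bar>t - x0\<bar> \<le> cos \<delta>"
        proof (cases "\<bar>t - x0\<bar> \<le> pi")
          case True then show ?thesis using \<open>\<delta> \<le> \<bar>t - x0\<bar>\<close> \<delta> by (intro cos_monotone_0_pi_le) auto
        next
          case False
          have "cos (2 * pi - \<bar>t - x0\<bar>) \<le> cos \<delta>" using False up \<delta> by (intro cos_monotone_0_pi_le) auto
          then show ?thesis by (simp add: cos_diff)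
        qed
        then have "(1 + cos (t - x0)) / 2 \<le> a" by (simp add: a_def)
        moreover have "0 \<le> (1 + cos (t - x0)) / 2" using bump_bounds(1)[of 1 "t - x0"] by (simp add: bump_def)
        ultimately show ?thesis using True by (auto simp: bump_def intro!: power_mono)
      qed (use ab in auto)
    qed (rule fint)
    also have "\<dots> = 2 * pi * a ^ n"
      by (simp add: measure_restrict_space)
    also have "\<dots> = 2 * pi / \<delta> * (a / b) ^ n * (\<delta> * b ^ n)"
      using \<delta> ab by (simp add: power_divide)
    also have "\<dots> \<le> 2 * pi / \<delta> * (a / b) ^ n * (\<integral>t. bump n (t - x0) \<partial>circle_measure)"
      using \<delta> ab by (intro mult_left_mono mass) auto
    finally show "(\<integral>t. indicator {t. \<delta> \<le> \<bar>t - x0\<bar>} t * bump n (t - x0) \<partial>circle_measure)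
        \<le> 2 * pi / \<delta> * (a / b) ^ n * (\<integral>t. bump n (t - x0) \<partial>circle_measure)" .
  qed
qed

lemma texp_measurable: "texp d k \<in> borel_measurable (torus_measure d)"
proof (rule torus_measurable)
  show "continuous_on UNIV (texp d k)" unfolding texp_def
    by (intro continuous_intros continuous_on_product_coordinates)
  show "texp d k x = texp d k y" if "\<And>i. i < d \<Longrightarrow> x i = y i" for x y
    using that by (simp add: texp_def)
qed

lemma norm_texp [simp]: "norm (texp d k x) = 1"
  by (simp add: texp_def)

lemma integral_bump_zero:
  fixes f :: "(nat \<Rightarrow> real) \<Rightarrow> complex"
  assumes f: "f \<in> borel_measurable (torus_measure d)" and B: "\<And>x. x \<in> space (torus_measure d) \<Longrightarrow> norm (f x) \<le> B"
    and coeff: "\<And>k. fourier_coeff d f k = 0"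
  shows "(\<integral>x. f x * of_real (\<Prod>i<d. bump n (x i - x0 i)) \<partial>torus_measure d) = 0"
proof -
  define c where "c j = (of_nat (2*n choose j) / 4 ^ n :: complex)" for j
  let ?P = "PiE {..<d} (\<lambda>_. {..2*n})"
  have expand: "complex_of_real (\<Prod>i<d. bump n (x i - x0 i))
     = (\<Sum>j\<in>?P. ((\<Prod>i<d. c (j i)) * texp d (\<lambda>i. int (j i) - int n) (\<lambda>i. - x0 i)) * texp d (\<lambda>i. int (j i) - int n) x)" for x
  proof -
    have "complex_of_real (\<Prod>i<d. bump n (x i - x0 i)) = (\<Prod>i<d. \<Sum>j\<le>2*n. c j * cis (real_of_int (int j - int n) * (x i - x0 i)))"
      by (simp only: of_real_prod bump_cis c_def)
    also have "\<dots> = (\<Sum>j\<in>?P. \<Prod>i<d. c (j i) * cis (real_of_int (int (j i) - int n) * (x i - x0 i)))"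
      by (subst prod_sum_PiE) auto
    also have "\<dots> = (\<Sum>j\<in>?P. ((\<Prod>i<d. c (j i)) * texp d (\<lambda>i. int (j i) - int n) (\<lambda>i. - x0 i)) * texp d (\<lambda>i. int (j i) - int n) x)"
      unfolding texp_prod prod.distrib[symmetric] by (intro sum.cong prod.cong) (auto simp: cis_mult algebra_simps)
    finally show ?thesis .
  qed
  have int: "integrable (torus_measure d) (\<lambda>x. f x * texp d k x)" for k
    by (rule torus_bounded_integrable[where B=B]) (use f texp_measurable B in \<open>auto simp: norm_mult\<close>)
  have z: "(\<integral>x. f x * texp d k x \<partial>torus_measure d) = 0" for k
    using coeff[of "\<lambda>i. - k i"] by (simp add: fourier_coeff_texp)
  have "(\<integral>x. f x * of_real (\<Prod>i<d. bump n (x i - x0 i)) \<partial>torus_measure d)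
     = (\<integral>x. (\<Sum>j\<in>?P. ((\<Prod>i<d. c (j i)) * texp d (\<lambda>i. int (j i) - int n) (\<lambda>i. - x0 i)) * (f x * texp d (\<lambda>i. int (j i) - int n) x)) \<partial>torus_measure d)"
    unfolding expand sum_distrib_left by (simp add: mult_ac)
  also have "\<dots> = 0"
    by (subst Bochner_Integration.integral_sum) (auto simp: z int)
  finally show ?thesis .
qed

text \<open>Integrating \<open>f - f x0\<close> against a product of bumps gives minus
  \<open>f x0\<close> times the total mass \<open>P n\<close>. Near \<open>x0\<close> the integrand
  is at most \<open>e\<close> times the kernel. Every other point is far from \<open>x0\<close> in
  some coordinate, and for each coordinate the corresponding mass is a fraction of order
  \<open>q i ^ n\<close> of \<open>P n\<close>.\<close>

lemma fourier_unique_interior: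
  fixes f :: "(nat \<Rightarrow> real) \<Rightarrow> complex"
  assumes f: "f \<in> borel_measurable (torus_measure d)" and B: "\<And>x. x \<in> space (torus_measure d) \<Longrightarrow> norm (f x) \<le> B"
    and coeff: "\<And>k. fourier_coeff d f k = 0"
    and x0: "\<And>i. i < d \<Longrightarrow> \<bar>x0 i\<bar> < pi"
    and cont: "\<And>e. e > 0 \<Longrightarrow> \<exists>\<delta>>0. \<forall>x\<in>space (torus_measure d). (\<forall>i<d. \<bar>x i - x0 i\<bar> < \<delta>) \<longrightarrow> norm (f x - f x0) < e"
  shows "f x0 = 0"
proof -
  define B' where "B' = \<bar>B\<bar> + norm (f x0)"
  have B': "norm (f x - f x0) \<le> B'" if "x \<in> space (torus_measure d)" for x
    using B[OF that] norm_triangle_ineq4[of "f x" "f x0"] unfolding B'_def by linarith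
  have B0: "B' \<ge> 0" by (simp add: B'_def)
  have main: "norm (f x0) \<le> e" if e: "e > 0" for e
  proof -
    obtain \<delta>1 where \<delta>1: "\<delta>1 > 0" "\<And>x. x \<in> space (torus_measure d) \<Longrightarrow> (\<And>i. i < d \<Longrightarrow> \<bar>x i - x0 i\<bar> < \<delta>1) \<Longrightarrow> norm (f x - f x0) < e"
      using cont[OF e] by blast
    \<comment> \<open>Besides the continuity radius, \<open>\<delta>\<close> respects the distance
      of \<open>x0\<close> to the boundary in each coordinate, as \<open>bump_concentration\<close>
      requires.\<close>
    define \<delta> where "\<delta> = Min (insert \<delta>1 ((\<lambda>i. pi - \<bar>x0 i\<bar>) ` {..<d}))"
    have \<delta>: "\<delta> > 0" unfolding \<delta>_def using \<delta>1 x0 by (subst Min_gr_iff) auto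
    have \<delta>le: "\<delta> \<le> \<delta>1" unfolding \<delta>_def by (rule Min_le) auto
    have \<delta>i: "\<bar>x0 i\<bar> \<le> pi - \<delta>" if "i < d" for i
    proof -
      have "\<delta> \<le> pi - \<bar>x0 i\<bar>" unfolding \<delta>_def by (rule Min_le) (use that in auto)
      then show ?thesis by simp
    qed
    define A where "A n i = (\<integral>t. bump n (t - x0 i) \<partial>circle_measure)" for n i
    define I where "I n i = (\<integral>t. indicator {t. \<delta> \<le> \<bar>t - x0 i\<bar>} t * bump n (t - x0 i) \<partial>circle_measure)" for n i
    have "\<forall>i\<in>{..<d}. \<exists>q. 0 \<le> q \<and> q < 1 \<and> (\<forall>n. 0 < A n i) \<and> (\<forall>n. I n i \<le> 2 * pi / \<delta> * q ^ n * A n i)"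
    proof
      fix i assume "i \<in> {..<d}"
      then have "\<bar>x0 i\<bar> \<le> pi - \<delta>" using \<delta>i by simp
      from bump_concentration[OF \<delta> this] obtain q where "0 \<le> q" "q < 1" "\<And>n. 0 < A n i" "\<And>n. I n i \<le> 2 * pi / \<delta> * q ^ n * A n i"
        unfolding A_def I_def by blast
      then show "\<exists>q. 0 \<le> q \<and> q < 1 \<and> (\<forall>n. 0 < A n i) \<and> (\<forall>n. I n i \<le> 2 * pi / \<delta> * q ^ n * A n i)" by blast
    qed
    then obtain q where q: "\<And>i. i < d \<Longrightarrow> 0 \<le> q i \<and> q i < 1 \<and> (\<forall>n. 0 < A n i) \<and> (\<forall>n. I n i \<le> 2 * pi / \<delta> * q i ^ n * A n i)"
      unfolding bchoice_iff by auto
    define Q where "Q n x = (\<Prod>i<d. bump n (x i - x0 i))" for n and x :: "nat \<Rightarrow> real"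
    define P where "P n = (\<Prod>i<d. A n i)" for n
    have Pp: "P n > 0" for n unfolding P_def using q by (auto intro: prod_pos)
    have bint: "integrable circle_measure (\<lambda>t. bump n (t - x0 i))" for n i
      by (rule circle_bounded_integrable[where B=1]) (use bump_bounds in auto)
    have fint: "integrable circle_measure (\<lambda>t. indicator {t. \<delta> \<le> \<bar>t - x0 i\<bar>} t * bump n (t - x0 i))" for n i
      by (rule circle_bounded_integrable[where B=1]) (use bump_bounds in \<open>auto simp: indicator_def\<close>)
    have Qint: "integrable (torus_measure d) (Q n)" "(\<integral>x. Q n x \<partial>torus_measure d) = P n" for n
      unfolding Q_def P_def A_def using bint by (auto intro!: torus_integrable_prod torus_integral_prod)
    have Q0: "Q n x \<ge> 0" "Q n x \<le> 1" for n x unfolding Q_def by (auto intro!: prod_nonneg prod_le_1 simp: bump_bounds)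
    have far: "integrable (torus_measure d) (\<lambda>x. indicator {t. \<delta> \<le> \<bar>t - x0 i\<bar>} (x i) * Q n x)"
       "(\<integral>x. indicator {t. \<delta> \<le> \<bar>t - x0 i\<bar>} (x i) * Q n x \<partial>torus_measure d) \<le> 2 * pi / \<delta> * q i ^ n * P n"
      if i: "i < d" for n i
    proof -
      \<comment> \<open>Only the factor of coordinate \<open>i\<close> is truncated, so the integral
        still factorises.\<close>
      define h where "h j t = (if j = i then indicator {t. \<delta> \<le> \<bar>t - x0 i\<bar>} t * bump n (t - x0 i) else bump n (t - x0 j))" for j t
      have hint: "integrable circle_measure (h j)" for j
        unfolding h_def using bint fint by (cases "j = i") auto
      have eq: "indicator {t. \<delta> \<le> \<bar>t - x0 i\<bar>} (x i) * Q n x = (\<Prod>j<d. h j (x j))" for x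
      proof -
        have "(\<Prod>j<d. h j (x j)) = h i (x i) * (\<Prod>j\<in>{..<d}-{i}. h j (x j))" using i by (simp add: prod.remove)
        also have "(\<Prod>j\<in>{..<d}-{i}. h j (x j)) = (\<Prod>j\<in>{..<d}-{i}. bump n (x j - x0 j))" by (rule prod.cong) (auto simp: h_def)
        also have "h i (x i) * \<dots> = indicator {t. \<delta> \<le> \<bar>t - x0 i\<bar>} (x i) * (bump n (x i - x0 i) * (\<Prod>j\<in>{..<d}-{i}. bump n (x j - x0 j)))"
          by (simp add: h_def)
        also have "bump n (x i - x0 i) * (\<Prod>j\<in>{..<d}-{i}. bump n (x j - x0 j)) = Q n x"
          unfolding Q_def using i by (simp add: prod.remove[of "{..<d}" i])
        finally show ?thesis by simp
      qed
      show "integrable (torus_measure d) (\<lambda>x. indicator {t. \<delta> \<le> \<bar>t - x0 i\<bar>} (x i) * Q n x)"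
        unfolding eq by (rule torus_integrable_prod) (rule hint)
      have "(\<integral>x. indicator {t. \<delta> \<le> \<bar>t - x0 i\<bar>} (x i) * Q n x \<partial>torus_measure d) = (\<Prod>j<d. integral\<^sup>L circle_measure (h j))"
        unfolding eq by (rule torus_integral_prod) (rule hint)
      also have "\<dots> = I n i * (\<Prod>j\<in>{..<d}-{i}. A n j)"
      proof -
        have "(\<Prod>j<d. integral\<^sup>L circle_measure (h j)) = integral\<^sup>L circle_measure (h i) * (\<Prod>j\<in>{..<d}-{i}. integral\<^sup>L circle_measure (h j))"
          using i by (simp add: prod.remove)
        also have "integral\<^sup>L circle_measure (h i) = I n i" by (simp add: h_def[abs_def] I_def)
        also have "(\<Prod>j\<in>{..<d}-{i}. integral\<^sup>L circle_measure (h j)) = (\<Prod>j\<in>{..<d}-{i}. A n j)"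
          by (rule prod.cong) (auto simp: h_def[abs_def] A_def)
        finally show ?thesis .
      qed
      also have "\<dots> \<le> (2 * pi / \<delta> * q i ^ n * A n i) * (\<Prod>j\<in>{..<d}-{i}. A n j)"
        using q i by (intro mult_right_mono prod_nonneg) (auto intro: less_imp_le)
      also have "\<dots> = 2 * pi / \<delta> * q i ^ n * P n"
        unfolding P_def using i by (simp add: prod.remove[of "{..<d}" i])
      finally show "(\<integral>x. indicator {t. \<delta> \<le> \<bar>t - x0 i\<bar>} (x i) * Q n x \<partial>torus_measure d) \<le> 2 * pi / \<delta> * q i ^ n * P n" .
    qed
    have bound: "norm (f x0) \<le> e + B' * (\<Sum>i<d. 2 * pi / \<delta> * q i ^ n)" for n
    proof -
      have cQ: "(\<lambda>x. complex_of_real (Q n x)) \<in> borel_measurable (torus_measure d)"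
        by (rule measurable_compose[OF borel_measurable_integrable[OF Qint(1)]])
           (intro borel_measurable_continuous_onI continuous_intros)
      have i1: "integrable (torus_measure d) (\<lambda>x. f x * of_real (Q n x))"
      proof (rule torus_bounded_integrable[where B=B])
        fix x assume x: "x \<in> space (torus_measure d)"
        have "norm (f x) * Q n x \<le> B * 1"
          using B[OF x] Q0[of n x] norm_ge_zero[of "f x"] by (intro mult_mono) linarith+
        then show "norm (f x * of_real (Q n x)) \<le> B" using Q0 by (simp add: norm_mult)
      qed (use f cQ in auto)
      have iQ: "integrable (torus_measure d) (\<lambda>x. complex_of_real (Q n x))"
        by (rule torus_bounded_integrable[where B=1, OF cQ]) (use Q0 in auto)
      then have i2: "integrable (torus_measure d) (\<lambda>x. f x0 * of_real (Q n x))"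
        by (rule integrable_mult_right)
      have "(\<integral>x. (f x - f x0) * of_real (Q n x) \<partial>torus_measure d) = - (f x0 * of_real (P n))"
      proof -
        have "(\<integral>x. (f x - f x0) * of_real (Q n x) \<partial>torus_measure d)
          = (\<integral>x. f x * of_real (Q n x) \<partial>torus_measure d) - (\<integral>x. f x0 * of_real (Q n x) \<partial>torus_measure d)"
          unfolding left_diff_distrib by (rule Bochner_Integration.integral_diff[OF i1 i2])
        also have "(\<integral>x. f x * of_real (Q n x) \<partial>torus_measure d) = 0"
          unfolding Q_def by (rule integral_bump_zero[OF f B coeff])
        also have "(\<integral>x. f x0 * of_real (Q n x) \<partial>torus_measure d) = f x0 * of_real (P n)"
          by (simp add: Qint(2))
        finally show ?thesis by simp
      qed
      then have "norm (f x0) * P n = norm (\<integral>x. (f x - f x0) * of_real (Q n x) \<partial>torus_measure d)"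
        using Pp[of n] by (simp add: norm_mult)
      also have "\<dots> \<le> (\<integral>x. e * Q n x + (\<Sum>i<d. B' * (indicator {t. \<delta> \<le> \<bar>t - x0 i\<bar>} (x i) * Q n x)) \<partial>torus_measure d)"
      proof (rule order_trans[OF integral_norm_bound], rule integral_mono)
        have "integrable (torus_measure d) (\<lambda>x. (f x - f x0) * of_real (Q n x))"
          unfolding left_diff_distrib using i1 i2 by (rule Bochner_Integration.integrable_diff)
        then show "integrable (torus_measure d) (\<lambda>x. norm ((f x - f x0) * of_real (Q n x)))" by (rule integrable_norm)
        show "integrable (torus_measure d) (\<lambda>x. e * Q n x + (\<Sum>i<d. B' * (indicator {t. \<delta> \<le> \<bar>t - x0 i\<bar>} (x i) * Q n x)))"
          by (intro Bochner_Integration.integrable_add Bochner_Integration.integrable_sum integrable_mult_right Qint far(1)) auto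
        fix x assume x: "x \<in> space (torus_measure d)"
        show "norm ((f x - f x0) * of_real (Q n x)) \<le> e * Q n x + (\<Sum>i<d. B' * (indicator {t. \<delta> \<le> \<bar>t - x0 i\<bar>} (x i) * Q n x))"
        proof (cases "\<forall>i<d. \<bar>x i - x0 i\<bar> < \<delta>")
          case True
          then have "norm (f x - f x0) \<le> e" using \<delta>1(2)[OF x] \<delta>le by (meson less_imp_le less_le_trans)
          then have "norm (f x - f x0) * Q n x \<le> e * Q n x" using Q0 by (intro mult_right_mono)
          moreover have "(\<Sum>i<d. B' * (indicator {t. \<delta> \<le> \<bar>t - x0 i\<bar>} (x i) * Q n x)) \<ge> 0"
            using B0 Q0 by (intro sum_nonneg mult_nonneg_nonneg) auto
          ultimately show ?thesis using Q0 by (simp add: norm_mult)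
        next
          case False
          then obtain i where i: "i < d" "\<delta> \<le> \<bar>x i - x0 i\<bar>" by (auto simp: not_less)
          have "norm (f x - f x0) * Q n x \<le> B' * Q n x" using Q0 B'[OF x] by (intro mult_right_mono)
          also have "\<dots> = B' * (indicator {t. \<delta> \<le> \<bar>t - x0 i\<bar>} (x i) * Q n x)" using i by simp
          also have "\<dots> \<le> (\<Sum>i<d. B' * (indicator {t. \<delta> \<le> \<bar>t - x0 i\<bar>} (x i) * Q n x))"
            by (rule member_le_sum) (use i B0 Q0 in auto)
          finally have "norm (f x - f x0) * Q n x \<le> (\<Sum>i<d. B' * (indicator {t. \<delta> \<le> \<bar>t - x0 i\<bar>} (x i) * Q n x))" .
          moreover have "e * Q n x \<ge> 0" using e Q0 by simp
          ultimately show ?thesis using Q0 by (simp add: norm_mult)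
        qed
      qed
      also have "\<dots> = e * P n + (\<Sum>i<d. B' * (\<integral>x. indicator {t. \<delta> \<le> \<bar>t - x0 i\<bar>} (x i) * Q n x \<partial>torus_measure d))"
        by (subst Bochner_Integration.integral_add) (auto simp: Qint far(1) intro!: Bochner_Integration.integrable_sum integrable_mult_right)
      also have "\<dots> \<le> e * P n + (\<Sum>i<d. B' * (2 * pi / \<delta> * q i ^ n * P n))"
        using B0 by (intro add_left_mono sum_mono mult_left_mono far(2)) auto
      also have "\<dots> = (e + B' * (\<Sum>i<d. 2 * pi / \<delta> * q i ^ n)) * P n"
        by (simp only: distrib_right sum_distrib_left sum_distrib_right mult.assoc)
      finally show ?thesis using Pp[of n] by simp
    qed
    have "(\<lambda>n. e + B' * (\<Sum>i<d. 2 * pi / \<delta> * q i ^ n)) \<longlonglongrightarrow> e + B' * (\<Sum>i<d. 2 * pi / \<delta> * 0)"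
      using q by (intro tendsto_intros LIMSEQ_power_zero) auto
    then show "norm (f x0) \<le> e" using bound by (intro LIMSEQ_le_const[of _ e]) auto
  qed
  show ?thesis using field_le_epsilon[of "norm (f x0)" 0] main by simp
qed

section \<open>Orthogonality and Fourier coefficients of series\<close>

lemma measure_torus: "measure (torus_measure d) (space (torus_measure d)) = (2 * pi) ^ d"
proof -
  have "integrable circle_measure (\<lambda>_. 1::real)"
    by (intro finite_measure.integrable_const finite_measure_circle)
  from torus_integral_prod[of d "\<lambda>_ _. 1::real", OF this] show ?thesis
    by (simp add: measure_restrict_space)
qed

lemma cis_has_vector_derivative:
  "((\<lambda>t. cis (a * t)) has_vector_derivative (\<i> * of_real a * cis (a * t))) (at t within S)"
proof -
  have "((\<lambda>z. exp (\<i> * of_real a * z)) has_field_derivative (\<i> * of_real a * exp (\<i> * of_real a * of_real t))) (at (of_real t))"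
    by (auto intro!: derivative_eq_intros)
  from has_vector_derivative_real_field[OF this, of S] show ?thesis by (simp add: cis_conv_exp mult_ac)
qed

lemma circle_integral_cis:
  fixes m :: int
  shows "(\<integral>t. cis (real_of_int m * t) \<partial>circle_measure) = (if m = 0 then 2 * pi else 0)"
proof -
  have "(\<integral>t. cis (real_of_int m * t) \<partial>circle_measure) = (\<integral>t. indicator {-pi..pi} t *\<^sub>R cis (real_of_int m * t) \<partial>lborel)"
    by (rule integral_restrict_space) simp
  also have "\<dots> = (if m = 0 then 2 * pi else 0)"
  proof (cases "m = 0")
    case True
    have "(\<integral>t. indicator {-pi..pi} t *\<^sub>R (1::complex) \<partial>lborel) = (2 * pi) *\<^sub>R 1"
      by (subst integral_scaleR_left) auto
    then show ?thesis using True by (simp add: scaleR_conv_of_real)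
  next
    case False
    define F where "F t = cis (real_of_int m * t) / (\<i> * m)" for t
    have "(\<integral>t. indicator {-pi..pi} t *\<^sub>R cis (real_of_int m * t) \<partial>lborel) = F pi - F (-pi)"
    proof (rule integral_FTC_Icc)
      fix x :: real
      have "(F has_vector_derivative (\<i> * of_real (real_of_int m) * cis (real_of_int m * x)) / (\<i> * m)) (at x within {-pi..pi})"
        unfolding F_def by (intro has_vector_derivative_divide cis_has_vector_derivative)
      moreover have "(\<i> * of_real (real_of_int m) * cis (real_of_int m * x)) / (\<i> * m) = cis (real_of_int m * x)"
        using False by simp
      ultimately show "(F has_vector_derivative cis (real_of_int m * x)) (at x within {-pi..pi})" by simp
    qed (auto intro!: continuous_intros)
    also have "\<dots> = 0"
    proof -
      have "cis (real_of_int m * pi) = cis (- (real_of_int m * pi)) * cis (2 * pi * real_of_int m)" unfolding cis_mult by (simp add: algebra_simps)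
      also have "cis (2 * pi * real_of_int m) = 1" by (rule cis_multiple_2pi) auto
      finally show ?thesis by (simp add: F_def)
    qed
    finally show ?thesis using False by simp
  qed
  finally show ?thesis .
qed

lemma fourier_coeff_of_texp:
  "fourier_coeff d (texp d k) l = (if \<forall>i<d. k i = l i then 1 else 0)"
proof -
  have "(\<integral>x. texp d k x * texp d (\<lambda>i. - l i) x \<partial>torus_measure d) = (\<integral>x. (\<Prod>i<d. cis (real_of_int (k i - l i) * x i)) \<partial>torus_measure d)"
    by (simp add: texp_prod cis_mult algebra_simps flip: prod.distrib)
  also have "\<dots> = (\<Prod>i<d. \<integral>t. cis (real_of_int (k i - l i) * t) \<partial>circle_measure)"
    by (rule torus_integral_prod)
       (rule circle_bounded_integrable[where B=1], auto intro!: borel_measurable_continuous_onI continuous_intros)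
  also have "\<dots> = (\<Prod>i<d. if k i = l i then 2 * complex_of_real pi else 0)"
    unfolding circle_integral_cis by (rule prod.cong) auto
  also have "\<dots> = (if \<forall>i<d. k i = l i then (2 * pi) ^ d else 0)"
    by (auto simp: prod_zero_iff)
  finally show ?thesis by (simp add: fourier_coeff_texp)
qed

lemma fourier_integrable:
  assumes "f \<in> borel_measurable (torus_measure d)" "\<And>x. x \<in> space (torus_measure d) \<Longrightarrow> norm (f x) \<le> B"
  shows "integrable (torus_measure d) (\<lambda>x. f x * texp d k x)"
  by (rule torus_bounded_integrable[where B=B]) (use assms texp_measurable in \<open>auto simp: norm_mult\<close>)

lemma fourier_coeff_cmult: "fourier_coeff d (\<lambda>x. c * f x) k = c * fourier_coeff d f k"
  by (simp add: fourier_coeff_texp mult.assoc)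

lemma fourier_coeff_diff:
  assumes "f \<in> borel_measurable (torus_measure d)" "\<And>x. x \<in> space (torus_measure d) \<Longrightarrow> norm (f x) \<le> B"
    and "g \<in> borel_measurable (torus_measure d)" "\<And>x. x \<in> space (torus_measure d) \<Longrightarrow> norm (g x) \<le> B'"
  shows "fourier_coeff d (\<lambda>x. f x - g x) k = fourier_coeff d f k - fourier_coeff d g k"
  unfolding fourier_coeff_texp left_diff_distrib
  using Bochner_Integration.integral_diff[OF fourier_integrable[OF assms(1,2)] fourier_integrable[OF assms(3,4)], of "\<lambda>i. - k i" "\<lambda>i. - k i"]
  by (simp add: diff_divide_distrib)

lemma fourier_coeff_sum:
  assumes "finite A" "\<And>j. j \<in> A \<Longrightarrow> g j \<in> borel_measurable (torus_measure d)"
    and "\<And>j x. j \<in> A \<Longrightarrow> x \<in> space (torus_measure d) \<Longrightarrow> norm (g j x) \<le> B j"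
  shows "fourier_coeff d (\<lambda>x. \<Sum>j\<in>A. g j x) k = (\<Sum>j\<in>A. fourier_coeff d (g j) k)"
proof -
  have "(\<integral>x. (\<Sum>j\<in>A. g j x * texp d (\<lambda>i. - k i) x) \<partial>torus_measure d) = (\<Sum>j\<in>A. \<integral>x. g j x * texp d (\<lambda>i. - k i) x \<partial>torus_measure d)"
    by (rule Bochner_Integration.integral_sum) (rule fourier_integrable, use assms in auto)
  then show ?thesis by (simp add: fourier_coeff_texp sum_distrib_right sum_divide_distrib)
qed

lemma fourier_coeff_bound:
  assumes "f \<in> borel_measurable (torus_measure d)" "\<And>x. x \<in> space (torus_measure d) \<Longrightarrow> norm (f x) \<le> B"
  shows "norm (fourier_coeff d f k) \<le> B"
proof -
  have "norm (\<integral>x. f x * texp d (\<lambda>i. - k i) x \<partial>torus_measure d) \<le> (\<integral>x. norm (f x * texp d (\<lambda>i. - k i) x) \<partial>torus_measure d)"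
    by (rule integral_norm_bound)
  also have "\<dots> \<le> (\<integral>x. B \<partial>torus_measure d)"
  proof (rule integral_mono)
    show "integrable (torus_measure d) (\<lambda>x. norm (f x * texp d (\<lambda>i. - k i) x))"
      using assms by (intro integrable_norm fourier_integrable)
    show "integrable (torus_measure d) (\<lambda>x. B)" by (intro finite_measure.integrable_const finite_measure_torus)
  qed (use assms in \<open>auto simp: norm_mult\<close>)
  also have "\<dots> = (2 * pi) ^ d * B" by (simp add: measure_torus)
  finally show ?thesis by (simp add: fourier_coeff_texp norm_divide norm_power pos_divide_le_eq mult.commute norm_mult)
qed

text \<open>The Weierstrass test gives uniform convergence, which transports continuity and Fourier
  coefficients to the limit. It serves both the sampling series over the integers and the series of
  blocks over multi-indices.\<close>

lemma fourier_series_infsum: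
  fixes g :: "'j \<Rightarrow> (nat \<Rightarrow> real) \<Rightarrow> complex"
  assumes cont: "\<And>j. j \<in> I \<Longrightarrow> continuous_on UNIV (g j)"
    and dep: "\<And>j x y. j \<in> I \<Longrightarrow> \<forall>i<d. x i = y i \<Longrightarrow> g j x = g j y"
    and bd: "\<And>j x. j \<in> I \<Longrightarrow> norm (g j x) \<le> b j" and b: "b summable_on I"
  defines "G \<equiv> \<lambda>x. \<Sum>\<^sub>\<infinity>j\<in>I. g j x"
  shows "continuous_on UNIV G" "\<And>x y. (\<And>i. i < d \<Longrightarrow> x i = y i) \<Longrightarrow> G x = G y"
    "((\<lambda>j. fourier_coeff d (g j) k) has_sum fourier_coeff d G k) I"
    "\<And>x. norm (G x) \<le> (\<Sum>\<^sub>\<infinity>j\<in>I. b j)" "\<And>x. ((\<lambda>j. g j x) has_sum G x) I"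
proof -
  have ul: "uniform_limit UNIV (\<lambda>X x. \<Sum>j\<in>X. g j x) G (finite_subsets_at_top I)"
    unfolding G_def by (rule Weierstrass_m_test_general[OF _ b]) (use bd in auto)
  have fin: "\<forall>\<^sub>F X in finite_subsets_at_top I. finite X \<and> X \<subseteq> I"
    by (auto simp: eventually_finite_subsets_at_top)
  show contG: "continuous_on UNIV G"
  proof (rule uniform_limit_theorem[OF _ ul])
    show "\<forall>\<^sub>F X in finite_subsets_at_top I. continuous_on UNIV (\<lambda>x. \<Sum>j\<in>X. g j x)"
      using fin by eventually_elim (auto intro!: continuous_on_sum cont)
  qed simp
  show depG: "G x = G y" if "\<And>i. i < d \<Longrightarrow> x i = y i" for x y
    unfolding G_def by (rule infsum_cong) (rule dep, use that in auto)
  have abs: "(\<lambda>j. norm (g j x)) summable_on I" for x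
    by (rule Infinite_Sum.abs_summable_on_comparison_test'[OF b]) (rule bd)
  show hs: "((\<lambda>j. g j x) has_sum G x) I" for x
    unfolding G_def by (rule has_sum_infsum, rule abs_summable_summable, rule abs)
  show bG: "norm (G x) \<le> (\<Sum>\<^sub>\<infinity>j\<in>I. b j)" for x
  proof -
    have "norm (G x) \<le> (\<Sum>\<^sub>\<infinity>j\<in>I. norm (g j x))" using has_sum_infsum[OF abs[of x]] hs[of x] by (rule norm_has_sum_bound)
    also have "\<dots> \<le> (\<Sum>\<^sub>\<infinity>j\<in>I. b j)" by (intro infsum_mono abs b bd)
    finally show ?thesis .
  qed
  have mG: "G \<in> borel_measurable (torus_measure d)" by (rule torus_measurable[OF contG depG])
  have mg: "g j \<in> borel_measurable (torus_measure d)" if "j \<in> I" for j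
    by (rule torus_measurable[OF cont[OF that]]) (rule dep[OF that], blast)
  show "((\<lambda>j. fourier_coeff d (g j) k) has_sum fourier_coeff d G k) I"
    unfolding has_sum_def
  proof (rule tendstoI)
    fix e :: real assume "e > 0"
    then have "\<forall>\<^sub>F X in finite_subsets_at_top I. \<forall>x\<in>UNIV. dist (\<Sum>j\<in>X. g j x) (G x) < e/2"
      using ul by (intro uniform_limitD) auto
    with fin show "\<forall>\<^sub>F X in finite_subsets_at_top I. dist (\<Sum>j\<in>X. fourier_coeff d (g j) k) (fourier_coeff d G k) < e"
    proof eventually_elim
      case (elim X)
      have sb: "norm (\<Sum>j\<in>X. g j x) \<le> (\<Sum>j\<in>X. b j)" for x
        using elim bd by (intro sum_norm_le) auto
      have sm: "(\<lambda>x. \<Sum>j\<in>X. g j x) \<in> borel_measurable (torus_measure d)"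
        using elim mg by (intro borel_measurable_sum) auto
      have "(\<Sum>j\<in>X. fourier_coeff d (g j) k) - fourier_coeff d G k = fourier_coeff d (\<lambda>x. (\<Sum>j\<in>X. g j x) - G x) k"
        using elim bd mg by (subst fourier_coeff_diff[OF sm sb mG bG], subst fourier_coeff_sum[where B=b]) auto
      moreover have "norm \<dots> \<le> e/2"
        using elim by (intro fourier_coeff_bound borel_measurable_diff sm mG) (auto simp: dist_norm less_imp_le)
      ultimately show ?case using \<open>e > 0\<close> by (simp add: dist_norm)
    qed
  qed
qed

section \<open>Sampling with products of sinc functions\<close>

lemma tsinc_abs_le_1: "\<bar>tsinc x\<bar> \<le> 1"
  using abs_sin_x_le_abs_x[of x] by (auto simp: tsinc_def abs_divide divide_le_eq)

lemma tsinc_abs_le: "x \<noteq> 0 \<Longrightarrow> \<bar>tsinc x\<bar> \<le> 1 / \<bar>x\<bar>"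
  by (simp add: tsinc_def abs_divide divide_right_mono)

lemma tsinc_of_real_mult: "of_real (tsinc x) * (2 * \<i> * of_real x) = cis x - cis (- x)"
  by (auto simp: tsinc_def complex_eq_iff)

lemma KL_Suc: "KL (Suc L) x = KL L x * tsinc (x / 2 ^ Suc L)"
  by (simp add: KL_def prod.nat_ivl_Suc' mult.commute)

lemma KL_abs_le_1: "\<bar>KL L x\<bar> \<le> 1"
  unfolding KL_def abs_prod by (intro prod_le_1) (auto simp: tsinc_abs_le_1)

lemma KL_2: "KL 2 x = tsinc (x/2) * tsinc (x/4)"
  by (simp add: KL_def numeral_2_eq_2 prod.nat_ivl_Suc')

lemma KL_abs_antimono: "2 \<le> L \<Longrightarrow> \<bar>KL L x\<bar> \<le> \<bar>KL 2 x\<bar>"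
proof (induction L rule: dec_induct)
  case (step n)
  have "\<bar>KL (Suc n) x\<bar> \<le> \<bar>KL n x\<bar> * 1"
    unfolding KL_Suc abs_mult by (intro mult_left_mono tsinc_abs_le_1) auto
  then show ?case using step by linarith
qed simp

lemma KL_decay: "2 \<le> L \<Longrightarrow> x \<noteq> 0 \<Longrightarrow> \<bar>KL L x\<bar> \<le> 8 / x\<^sup>2"
proof -
  assume L: "2 \<le> L" and x: "x \<noteq> 0"
  have "\<bar>KL L x\<bar> \<le> \<bar>tsinc (x/2)\<bar> * \<bar>tsinc (x/4)\<bar>"
    using KL_abs_antimono[OF L, of x] by (simp add: KL_2 abs_mult)
  also have "\<dots> \<le> (1 / \<bar>x/2\<bar>) * (1 / \<bar>x/4\<bar>)"
    using x by (intro mult_mono tsinc_abs_le) auto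
  also have "\<dots> = 8 / x\<^sup>2" using x by (simp add: abs_divide power2_eq_square field_simps)
  finally show ?thesis .
qed

text \<open>Two sinc factors give quadratic decay. With \<open>m\<close> the integer nearest to
  \<open>y / (2 * pi)\<close>, the term \<open>n = m\<close> is at most 1 and the term
  \<open>n\<close> is of order \<open>1 / (n - m)\<^sup>2\<close>, uniformly in
  \<open>y\<close>.\<close>

lemma KL_shift_bound:
  obtains C where "C > 0" "\<And>L y F. 2 \<le> L \<Longrightarrow> finite F \<Longrightarrow> (\<Sum>n\<in>F. \<bar>KL L (y - 2 * pi * real_of_int n)\<bar>) \<le> C"
proof -
  obtain C where C: "C > 0" "\<And>F :: int set. finite F \<Longrightarrow> (\<Sum>i\<in>F. (max 1 \<bar>real_of_int i\<bar>) powr (-2)) \<le> C"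
    using int_powr_sum_bound[of 2] by auto
  show ?thesis
  proof (rule that[of "8 * C"])
    fix L :: nat and y :: real and F :: "int set" assume L: "2 \<le> L" and F: "finite F"
    define m where "m = round (y / (2 * pi))"
    have "\<bar>real_of_int m - y / (2 * pi)\<bar> \<le> 1/2" unfolding m_def by (rule of_int_round_abs_le)
    then have "2 * pi * \<bar>real_of_int m - y / (2 * pi)\<bar> \<le> 2 * pi * (1/2)" by (intro mult_left_mono) auto
    moreover have "2 * pi * \<bar>real_of_int m - y / (2 * pi)\<bar> = \<bar>2 * pi * m - y\<bar>"
    proof -
      have "\<bar>2 * pi * m - y\<bar> = \<bar>2 * pi * (real_of_int m - y / (2 * pi))\<bar>" by (simp add: right_diff_distrib)
      then show ?thesis by (simp add: abs_mult)
    qed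
    ultimately have my: "\<bar>2 * pi * m - y\<bar> \<le> pi" by simp
    have summand: "\<bar>KL L (y - 2 * pi * real_of_int n)\<bar> \<le> 8 * (max 1 \<bar>real_of_int (n - m)\<bar>) powr (-2)" for n
    proof (cases "n = m")
      case True then show ?thesis using KL_abs_le_1[of L "y - 2 * pi * real_of_int n"] by simp
    next
      case False
      define k where "k = \<bar>real_of_int (n - m)\<bar>"
      have k: "k \<ge> 1" unfolding k_def using False by linarith
      have "2 * pi * k = \<bar>2 * pi * n - 2 * pi * m\<bar>"
        unfolding k_def of_int_diff by (simp add: abs_mult flip: right_diff_distrib)
      \<comment> \<open>The offset of \<open>y\<close> from \<open>2 * pi * m\<close> is at most
        \<open>pi\<close>, hence at most half of \<open>2 * pi * k\<close>.\<close>
      then have "2 * pi * k \<le> \<bar>y - 2 * pi * n\<bar> + pi" using my by linarith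
      moreover have "pi \<le> pi * k" using k by simp
      ultimately have "pi * k \<le> \<bar>y - 2 * pi * n\<bar>" by linarith
      moreover have "k \<le> pi * k" using k pi_gt3 mult_right_mono[of 1 pi k] by simp
      ultimately have ky: "k \<le> \<bar>y - 2 * pi * n\<bar>" by linarith
      have "\<bar>KL L (y - 2 * pi * n)\<bar> \<le> 8 / (y - 2 * pi * n)\<^sup>2"
        using ky k by (intro KL_decay L) auto
      also have "\<dots> \<le> 8 / k\<^sup>2"
        using ky k power_mono[of k "\<bar>y - 2 * pi * n\<bar>" 2] by (intro divide_left_mono) auto
      also have "\<dots> = 8 * (max 1 k) powr (-2)"
        using k by (simp add: max_absorb2 powr_minus divide_inverse)
      finally show ?thesis by (simp add: k_def)
    qed
    have "(\<Sum>n\<in>F. \<bar>KL L (y - 2 * pi * real_of_int n)\<bar>) \<le> (\<Sum>n\<in>F. 8 * (max 1 \<bar>real_of_int (n - m)\<bar>) powr (-2))"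
      by (intro sum_mono summand)
    also have "\<dots> = 8 * (\<Sum>i\<in>(\<lambda>n. n - m) ` F. (max 1 \<bar>real_of_int i\<bar>) powr (-2))"
      by (subst sum.reindex) (auto simp: inj_on_def sum_distrib_left)
    also have "\<dots> \<le> 8 * C" using F C by (intro mult_left_mono C) auto
    finally show "(\<Sum>n\<in>F. \<bar>KL L (y - 2 * pi * real_of_int n)\<bar>) \<le> 8 * C" .
  qed (use C in auto)
qed

lemma KL_shift_summable:
  assumes "2 \<le> L" shows "(\<lambda>n::int. \<bar>KL L (y - 2 * pi * real_of_int n)\<bar>) summable_on UNIV"
proof -
  obtain C where "C > 0" "\<And>L y F. 2 \<le> L \<Longrightarrow> finite F \<Longrightarrow> (\<Sum>n\<in>F. \<bar>KL L (y - 2 * pi * real_of_int n)\<bar>) \<le> C"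
    using KL_shift_bound by blast
  then show ?thesis using assms by (intro nonneg_bdd_above_summable_on) (auto simp: bdd_above_def)
qed

text \<open>The \<open>2\<pi>\<close>-periodic function whose Fourier coefficients are the samples \<open>KL 2 (y - 2\<pi>n)\<close>: the
  trapezoid \<open>1 - max 0 (\<bar>s\<bar>/\<pi> - 1/2)\<close> is the Fourier transform of \<open>KL 2\<close>, and the other two terms
  are its neighbouring periodic translates.\<close>

definition trapz :: "real \<Rightarrow> real \<Rightarrow> complex" where
  "trapz y s = cis (y / (2*pi) * s) * (1 - of_real (max 0 (s/pi - 1/2)) - of_real (max 0 (-s/pi - 1/2))
     + of_real (max 0 (s/pi - 1/2)) * cis (-y) + of_real (max 0 (-s/pi - 1/2)) * cis y)"

lemma trapz_continuous: "continuous_on S (trapz y)"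
  unfolding trapz_def by (intro continuous_intros) auto

lemma trapz_bounded: "\<bar>s\<bar> \<le> pi \<Longrightarrow> norm (trapz y s) \<le> 5"
proof -
  assume s: "\<bar>s\<bar> \<le> pi"
  have "s / pi \<le> 1" "- s / pi \<le> 1" using s by (simp_all add: divide_le_eq le_divide_eq abs_le_iff)
  then have m: "\<bar>max 0 (s/pi - 1/2)\<bar> \<le> 1" "\<bar>max 0 (-s/pi - 1/2)\<bar> \<le> 1"
  proof -
    from \<open>s / pi \<le> 1\<close> \<open>- s / pi \<le> 1\<close> have "s/pi - 1/2 \<le> 1" "-s/pi - 1/2 \<le> 1" by linarith+
    then show "\<bar>max 0 (s/pi - 1/2)\<bar> \<le> 1" "\<bar>max 0 (-s/pi - 1/2)\<bar> \<le> 1" by (simp_all only: abs_of_nonneg max.cobounded1 max.boundedI zero_le_one)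
  qed
  have "norm (trapz y s) = norm (1 - of_real (max 0 (s/pi - 1/2)) - of_real (max 0 (-s/pi - 1/2))
     + of_real (max 0 (s/pi - 1/2)) * cis (-y) + complex_of_real (max 0 (-s/pi - 1/2)) * cis y)"
    by (simp add: trapz_def norm_mult)
  also have "\<dots> \<le> norm (1::complex) + norm (complex_of_real (max 0 (s/pi - 1/2))) + norm (complex_of_real (max 0 (-s/pi - 1/2)))
     + norm (of_real (max 0 (s/pi - 1/2)) * cis (-y)) + norm (complex_of_real (max 0 (-s/pi - 1/2)) * cis y)"
    by (intro order_trans[OF norm_triangle_ineq] add_mono order_trans[OF norm_triangle_ineq4] order_refl)
  also have "\<dots> \<le> 1 + 1 + 1 + 1 + 1"
    unfolding norm_mult norm_of_real norm_cis using m by (intro add_mono) auto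
  finally show ?thesis by simp
qed

text \<open>The factors \<open>cis y\<close> and \<open>cis (-y)\<close> do not change when
  \<open>y\<close> moves by multiples of \<open>2 * pi\<close>. All Fourier coefficients of
  \<open>trapz y\<close> are therefore instances of the single integral of
  \<open>trapz z\<close>.\<close>

lemma trapz_mult_cis:
  "trapz y s * cis (- (real_of_int k * s)) = trapz (y - 2 * pi * real_of_int k) s"
proof -
  have e: "cis (y / (2*pi) * s) * cis (- (real_of_int k * s)) = cis ((y - 2 * pi * real_of_int k) / (2*pi) * s)"
    unfolding cis_mult by (simp add: field_simps)
  have k: "cis (2 * pi * real_of_int k) = 1" "cis (- (2 * pi * real_of_int k)) = 1"
    using cis_multiple_2pi[of "real_of_int k"] cis_multiple_2pi[of "- real_of_int k"] by auto
  have c: "cis (- (y - 2 * pi * real_of_int k)) = cis (- y)" "cis (y - 2 * pi * real_of_int k) = cis y"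
    using cis_mult[of "-y" "2 * pi * real_of_int k"] cis_mult[of y "- (2 * pi * real_of_int k)"] k by (simp_all add: algebra_simps)
  show ?thesis unfolding trapz_def c e[symmetric] by (simp only: mult_ac)
qed

lemma cis_linear_integral:
  fixes a b c :: real and \<alpha> \<beta> :: complex
  assumes a: "a \<noteq> 0" and bc: "b \<le> c"
  defines "F \<equiv> \<lambda>s. cis (a * s) * ((\<alpha> + \<beta> * of_real s) / (\<i> * of_real a) + \<beta> / (of_real a)\<^sup>2)"
  shows "((\<lambda>s. cis (a * s) * (\<alpha> + \<beta> * of_real s)) has_integral (F c - F b)) {b..c}"
proof (rule fundamental_theorem_of_calculus[OF bc])
  fix s assume "s \<in> {b..c}"
  have lin: "((\<lambda>s. (\<alpha> + \<beta> * of_real s) / (\<i> * of_real a) + \<beta> / (of_real a)\<^sup>2) has_vector_derivative (\<beta> / (\<i> * of_real a))) (at s within {b..c})"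
  proof -
    have "((\<lambda>z. (\<alpha> + \<beta> * z) / (\<i> * of_real a) + \<beta> / (of_real a)\<^sup>2) has_field_derivative (\<beta> / (\<i> * of_real a))) (at (of_real s))"
      using a by (auto intro!: derivative_eq_intros)
    from has_vector_derivative_real_field[OF this, of "{b..c}"] show ?thesis .
  qed
  have "(F has_vector_derivative (cis (a * s) * (\<beta> / (\<i> * of_real a)) + (\<i> * of_real a * cis (a * s)) * ((\<alpha> + \<beta> * of_real s) / (\<i> * of_real a) + \<beta> / (of_real a)\<^sup>2))) (at s within {b..c})"
    unfolding F_def by (rule has_vector_derivative_mult[OF cis_has_vector_derivative lin])
  moreover have "cis (a * s) * (\<beta> / (\<i> * of_real a)) + (\<i> * of_real a * cis (a * s)) * ((\<alpha> + \<beta> * of_real s) / (\<i> * of_real a) + \<beta> / (of_real a)\<^sup>2)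
     = cis (a * s) * (\<alpha> + \<beta> * of_real s)"
    using a by (simp add: field_simps power2_eq_square)
  ultimately show "(F has_vector_derivative cis (a * s) * (\<alpha> + \<beta> * of_real s)) (at s within {b..c})" by simp
qed

text \<open>On each of the three intervals cut by \<open>-(pi/2)\<close> and \<open>pi/2\<close> the
  integrand is an exponential times an affine function with an explicit primitive. The sum of the
  boundary terms is matched with the product of the two sinc factors.\<close>

lemma trapz_integral: "(trapz z has_integral (2 * complex_of_real pi * of_real (KL 2 z))) {-pi..pi}"
proof (cases "z = 0")
  case True
  have "trapz z = (\<lambda>s. 1)" by (rule ext) (simp add: trapz_def True)
  moreover have "((\<lambda>s::real. 1::complex) has_integral (2 * pi)) {-pi..pi}"
    using has_integral_const_real[of "1::complex" "-pi" pi] by (simp add: scaleR_conv_of_real)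
  ultimately show ?thesis by (simp add: KL_2 True tsinc_def)
next
  case False
  define a where "a = z / (2 * pi)"
  have a0: "a \<noteq> 0" using False by (simp add: a_def)
  have z: "z = 2 * pi * a" by (simp add: a_def)
  \<comment> \<open>With \<open>pi * a / 2\<close> as unit angle all exponentials involved are
    powers of \<open>E\<close> or of its inverse \<open>W\<close>, and the comparison becomes a
    polynomial identity modulo \<open>E * W = 1\<close>.\<close>
  define E where "E = cis (pi * a / 2)"
  define W where "W = cis (- (pi * a / 2))"
  have EW: "E * W = 1" by (simp add: E_def W_def cis_mult)
  have pw: "cis z = E ^ 4" "cis (- z) = W ^ 4" "cis (a * pi) = E\<^sup>2" "cis (a * (- pi)) = W\<^sup>2"
    "cis (a * (pi/2)) = E" "cis (a * (-(pi/2))) = W"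
    unfolding E_def W_def z Complex.DeMoivre by (simp_all add: algebra_simps)
  have A: "(trapz z has_integral ((E - W) / (\<i> * a))) {-(pi/2)..pi/2}"
  proof (rule has_integral_eq)
    show "((\<lambda>s. cis (a * s) * (1 + 0 * of_real s)) has_integral ((E - W) / (\<i> * a))) {-(pi/2)..pi/2}"
      using cis_linear_integral[OF a0, of "-(pi/2)" "pi/2" 1 0] unfolding pw by (simp add: diff_divide_distrib)
    fix s assume "s \<in> {-(pi/2)..pi/2}"
    then have "s / pi - 1/2 \<le> 0" "- s / pi - 1/2 \<le> 0" by (simp_all add: divide_le_eq le_divide_eq)
    then have "max 0 (s/pi - 1/2) = 0" "max 0 (-s/pi - 1/2) = 0" by simp_all
    then show "cis (a * s) * (1 + 0 * of_real s) = trapz z s" unfolding trapz_def a_def by simp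
  qed
  \<comment> \<open>\<open>\<beta>\<close> and \<open>\<beta>'\<close> are the slopes of the affine
    factor on the right and left outer intervals.\<close>
  define \<beta> where "\<beta> = (W ^ 4 - 1) / complex_of_real pi"
  define \<beta>' where "\<beta>' = - (E ^ 4 - 1) / complex_of_real pi"
  have B: "(trapz z has_integral (E\<^sup>2 * ((1 + (W^4 - 1)/2) / (\<i> * a) + \<beta> / (of_real a)\<^sup>2) - E * (1 / (\<i> * a) + \<beta> / (of_real a)\<^sup>2))) {pi/2..pi}"
  proof (rule has_integral_eq)
    have v: "(1 - (W^4 - 1)/2) + \<beta> * of_real pi = 1 + (W^4 - 1)/2" "(1 - (W^4 - 1)/2) + \<beta> * of_real (pi/2) = 1"
      by (simp_all add: \<beta>_def field_simps)
    show "((\<lambda>s. cis (a * s) * ((1 - (W^4 - 1)/2) + \<beta> * of_real s)) has_integral (E\<^sup>2 * ((1 + (W^4 - 1)/2) / (\<i> * a) + \<beta> / (of_real a)\<^sup>2) - E * (1 / (\<i> * a) + \<beta> / (of_real a)\<^sup>2))) {pi/2..pi}"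
      using cis_linear_integral[OF a0, of "pi/2" "pi" "1 - (W^4 - 1)/2" \<beta>] unfolding pw v by simp
    fix s assume s: "s \<in> {pi/2..pi}"
    then have "s / pi - 1/2 \<ge> 0" by (simp add: le_divide_eq)
    moreover have "- s / pi - 1/2 \<le> 0"
    proof -
      have "0 \<le> s" using s pi_gt_zero by simp
      then have "0 \<le> s / pi" by simp
      then show ?thesis unfolding minus_divide_left[symmetric] by linarith
    qed
    ultimately have m: "max 0 (s/pi - 1/2) = s/pi - 1/2" "max 0 (-s/pi - 1/2) = 0" by simp_all
    show "cis (a * s) * ((1 - (W^4 - 1)/2) + \<beta> * of_real s) = trapz z s"
      unfolding trapz_def m pw a_def[symmetric] by (simp add: \<beta>_def field_simps)
  qed
  have C: "(trapz z has_integral (W * (1 / (\<i> * a) + \<beta>' / (of_real a)\<^sup>2) - W\<^sup>2 * ((1 + (E^4 - 1)/2) / (\<i> * a) + \<beta>' / (of_real a)\<^sup>2))) {-pi..-(pi/2)}"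
  proof (rule has_integral_eq)
    have v: "(1 - (E^4 - 1)/2) + \<beta>' * of_real (-pi) = 1 + (E^4 - 1)/2" "(1 - (E^4 - 1)/2) + \<beta>' * of_real (-(pi/2)) = 1"
      by (simp_all add: \<beta>'_def field_simps)
    show "((\<lambda>s. cis (a * s) * ((1 - (E^4 - 1)/2) + \<beta>' * of_real s)) has_integral (W * (1 / (\<i> * a) + \<beta>' / (of_real a)\<^sup>2) - W\<^sup>2 * ((1 + (E^4 - 1)/2) / (\<i> * a) + \<beta>' / (of_real a)\<^sup>2))) {-pi..-(pi/2)}"
      using cis_linear_integral[OF a0, of "-pi" "-(pi/2)" "1 - (E^4 - 1)/2" \<beta>'] unfolding pw v by simp
    fix s assume s: "s \<in> {-pi..-(pi/2)}"
    then have "- s / pi - 1/2 \<ge> 0" by (simp add: le_divide_eq divide_le_eq)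
    moreover have "s / pi - 1/2 \<le> 0"
    proof -
      have "s \<le> 0" using s pi_gt_zero by simp
      then have "s / pi \<le> 0" by (simp add: divide_le_0_iff)
      then show ?thesis by linarith
    qed
    ultimately have m: "max 0 (-s/pi - 1/2) = -s/pi - 1/2" "max 0 (s/pi - 1/2) = 0" by simp_all
    show "cis (a * s) * ((1 - (E^4 - 1)/2) + \<beta>' * of_real s) = trapz z s"
      unfolding trapz_def m pw a_def[symmetric] by (simp add: \<beta>'_def field_simps)
  qed
  let ?C = "W * (1 / (\<i> * a) + \<beta>' / (of_real a)\<^sup>2) - W\<^sup>2 * ((1 + (E^4 - 1)/2) / (\<i> * a) + \<beta>' / (of_real a)\<^sup>2)"
  let ?A = "(E - W) / (\<i> * a)"
  let ?B = "E\<^sup>2 * ((1 + (W^4 - 1)/2) / (\<i> * a) + \<beta> / (of_real a)\<^sup>2) - E * (1 / (\<i> * a) + \<beta> / (of_real a)\<^sup>2)"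
  have int: "(trapz z has_integral (?C + ?A + ?B)) {-pi..pi}"
    using has_integral_combine[OF _ _ has_integral_combine[OF _ _ C A] B] pi_gt_zero by simp
  have EW': "E\<^sup>2 * W ^ 4 = W\<^sup>2" "W\<^sup>2 * E ^ 4 = E\<^sup>2" "E * W ^ 4 = W ^ 3" "W * E ^ 4 = E ^ 3" "E\<^sup>2 * W = E" "W\<^sup>2 * E = W"
    using EW by algebra+
  have sum: "?C + ?A + ?B = (E + W - E ^ 3 - W ^ 3) / (of_real pi * (of_real a)\<^sup>2)"
  proof -
    define x y where "x = 1 / (\<i> * complex_of_real a)" and "y = 1 / (complex_of_real pi * (of_real a)\<^sup>2)"
    have b: "\<beta> / (of_real a)\<^sup>2 = (W^4 - 1) * y" "\<beta>' / (of_real a)\<^sup>2 = - (E^4 - 1) * y"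
      by (simp_all add: \<beta>_def \<beta>'_def y_def)
    have d: "u / (\<i> * complex_of_real a) = u * x" for u by (simp add: x_def)
    have "?C + ?A + ?B = (W * (1 * x + - (E^4 - 1) * y) - W\<^sup>2 * ((1 + (E^4 - 1)/2) * x + - (E^4 - 1) * y)) + (E - W) * x
        + (E\<^sup>2 * ((1 + (W^4 - 1)/2) * x + (W^4 - 1) * y) - E * (1 * x + (W^4 - 1) * y))"
      unfolding b d ..
    also have "\<dots> = (E + W - E ^ 3 - W ^ 3) * y"
    proof -
      \<comment> \<open>The factor 2 clears the halves, leaving an identity between
        polynomials.\<close>
      have "2 * ((W * (1 * x + - (E^4 - 1) * y) - W\<^sup>2 * ((1 + (E^4 - 1)/2) * x + - (E^4 - 1) * y)) + (E - W) * x
        + (E\<^sup>2 * ((1 + (W^4 - 1)/2) * x + (W^4 - 1) * y) - E * (1 * x + (W^4 - 1) * y))) = 2 * ((E + W - E ^ 3 - W ^ 3) * y)"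
        using EW' by (simp add: algebra_simps) algebra
      then show ?thesis by (rule iffD1[OF mult_left_cancel, rotated]) simp
    qed
    finally show ?thesis by (simp add: y_def)
  qed
  have KL: "2 * complex_of_real pi * of_real (KL 2 z) = (E + W - E ^ 3 - W ^ 3) / (of_real pi * (of_real a)\<^sup>2)"
  proof -
    have t: "of_real (tsinc (z/2)) * (2 * \<i> * of_real (pi * a)) = E\<^sup>2 - W\<^sup>2"
      "of_real (tsinc (z/4)) * (2 * \<i> * of_real (pi * a / 2)) = E - W"
      using tsinc_of_real_mult[of "z/2"] tsinc_of_real_mult[of "z/4"]
      by (simp_all add: z E_def W_def Complex.DeMoivre algebra_simps)
    have "(E\<^sup>2 - W\<^sup>2) * (E - W) = E ^ 3 + W ^ 3 - E - W"
      using EW by algebra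
    then have "(of_real (tsinc (z/2)) * (2 * \<i> * of_real (pi * a))) * (of_real (tsinc (z/4)) * (2 * \<i> * of_real (pi * a / 2))) = E ^ 3 + W ^ 3 - E - W"
      unfolding t .
    then have "- (complex_of_real (KL 2 z) * (2 * pi * (of_real pi * (of_real a)\<^sup>2))) = E ^ 3 + W ^ 3 - E - W"
      by (simp add: KL_2 power2_eq_square mult_ac)
    then have "complex_of_real (KL 2 z) * (2 * pi) * (of_real pi * (of_real a)\<^sup>2) = E + W - E ^ 3 - W ^ 3"
      by (simp add: algebra_simps)
    then show ?thesis using a0 by (simp add: eq_divide_eq mult_ac)
  qed
  show ?thesis using int unfolding sum KL .
qed

text \<open>The series on the left is a Fourier series in \<open>s\<close> whose coefficients are
  those of \<open>trapz y\<close>, so both functions agree in the interior of the interval. For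
  \<open>\<bar>s\<bar> \<le> pi / 2\<close> the truncated parts of \<open>trapz\<close> vanish and
  only the exponential is left.\<close>

lemma KL_sampling_2:
  assumes s: "\<bar>s\<bar> \<le> pi / 2"
  shows "((\<lambda>n::int. of_real (KL 2 (y - 2 * pi * real_of_int n)) * cis (real_of_int n * s)) has_sum cis (y / (2*pi) * s)) UNIV"
proof -
  define c where "c n = KL 2 (y - 2 * pi * real_of_int n)" for n :: int
  define g where "g n x = of_real (c n) * texp 1 (\<lambda>_. n) x" for n :: int and x
  define b where "b n = \<bar>c n\<bar>" for n
  define G where "G = (\<lambda>x. \<Sum>\<^sub>\<infinity>n\<in>UNIV. g n x)"
  define h where "h x = trapz y (x 0)" for x :: "nat \<Rightarrow> real"
  have gc: "continuous_on UNIV (g n)" for n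
    unfolding g_def texp_def by (intro continuous_intros continuous_on_product_coordinates)
  have gd: "g n x = g n z" if "\<forall>i<1. x i = z i" for n x and z :: "nat \<Rightarrow> real"
    using that by (simp add: g_def texp_def)
  have gb: "norm (g n x) \<le> b n" for n x by (simp add: g_def b_def norm_mult)
  have bs: "b summable_on UNIV" unfolding b_def c_def by (rule KL_shift_summable) simp
  note fs = fourier_series_infsum[where g=g and d=1 and I=UNIV and b=b, OF gc gd gb bs]
  have Gc: "continuous_on UNIV G" unfolding G_def by (rule fs(1)) auto
  have Gd: "G x = G z" if "\<And>i. i < 1 \<Longrightarrow> x i = z i" for x z unfolding G_def by (rule fs(2)) (use that in auto)
  have Gb: "norm (G x) \<le> (\<Sum>\<^sub>\<infinity>n. b n)" for x unfolding G_def by (rule fs(4)) auto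
  have Gs: "((\<lambda>n. g n x) has_sum G x) UNIV" for x unfolding G_def by (rule fs(5)) auto
  have fcG: "fourier_coeff 1 G k = of_real (c (k 0))" for k
  proof -
    have "((\<lambda>n. fourier_coeff 1 (g n) k) has_sum fourier_coeff 1 G k) UNIV"
      unfolding G_def by (rule fs(3)) auto
    moreover have "fourier_coeff 1 (g n) k = (if n = k 0 then of_real (c (k 0)) else 0)" for n
      unfolding g_def fourier_coeff_cmult fourier_coeff_of_texp by auto
    moreover have "((\<lambda>n. if n = k 0 then complex_of_real (c (k 0)) else 0) has_sum of_real (c (k 0))) UNIV"
      using has_sum_finite_neutralI[of "{k 0}" UNIV "\<lambda>n. if n = k 0 then complex_of_real (c (k 0)) else 0" "of_real (c (k 0))"] by auto
    ultimately show ?thesis using has_sum_unique by auto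
  qed
  have hc: "continuous_on UNIV h"
    unfolding h_def by (rule continuous_on_compose2[OF trapz_continuous[of UNIV] continuous_on_product_coordinates]) auto
  have hd: "h x = h z" if "\<And>i. i < 1 \<Longrightarrow> x i = z i" for x z using that[of 0] by (simp add: h_def)
  have hb: "norm (h x) \<le> 5" if "x \<in> space (torus_measure 1)" for x
    unfolding h_def using PiE_mem[of x "{..<1}" "\<lambda>_. {-pi..pi}" 0] that by (intro trapz_bounded) (auto simp: space_torus abs_le_iff)
  have fch: "fourier_coeff 1 h k = of_real (c (k 0))" for k
  proof -
    have "(\<integral>x. h x * texp 1 (\<lambda>i. - k i) x \<partial>torus_measure 1) = (\<integral>x. (\<Prod>i<1. trapz (y - 2 * pi * real_of_int (k 0)) (x i)) \<partial>torus_measure 1)"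
      by (simp add: h_def texp_def trapz_mult_cis)
    also have "\<dots> = (\<integral>t. trapz (y - 2 * pi * real_of_int (k 0)) t \<partial>circle_measure)"
    proof (subst torus_integral_prod)
      show "integrable circle_measure (trapz (y - 2 * pi * real_of_int (k 0)))" for i :: nat
      proof (rule finite_measure.integrable_const_bound[OF finite_measure_circle, where B=5])
        show "AE x in circle_measure. norm (trapz (y - 2 * pi * real_of_int (k 0)) x) \<le> 5"
          by (rule AE_I2) (auto intro!: trapz_bounded simp: abs_le_iff)
        show "trapz (y - 2 * pi * real_of_int (k 0)) \<in> borel_measurable circle_measure"
          by (rule measurable_restrict_space1) (simp add: borel_measurable_continuous_onI trapz_continuous)
      qed
    qed simp
    also have "\<dots> = (\<integral>t. indicator {-pi..pi} t *\<^sub>R trapz (y - 2 * pi * real_of_int (k 0)) t \<partial>lborel)"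
      by (rule integral_restrict_space) simp
    also have "\<dots> = integral {-pi..pi} (trapz (y - 2 * pi * real_of_int (k 0)))"
    proof -
      have "set_integrable lborel {-pi..pi} (trapz (y - 2 * pi * real_of_int (k 0)))"
        unfolding set_integrable_def by (rule borel_integrable_compact[OF _ trapz_continuous]) auto
      from set_borel_integral_eq_integral(2)[OF this] show ?thesis by (simp add: set_lebesgue_integral_def)
    qed
    also have "\<dots> = 2 * complex_of_real pi * of_real (c (k 0))" unfolding c_def by (rule integral_unique[OF trapz_integral])
    finally show ?thesis by (simp add: fourier_coeff_texp)
  qed
  define x0 where "x0 = (\<lambda>i::nat. s)"
  have mh: "h \<in> borel_measurable (torus_measure 1)" by (rule torus_measurable[OF hc hd])
  have mG: "G \<in> borel_measurable (torus_measure 1)" by (rule torus_measurable[OF Gc Gd])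
  have "h x0 - G x0 = 0"
  proof (rule fourier_unique_interior[where f="\<lambda>x. h x - G x" and d=1 and B="5 + (\<Sum>\<^sub>\<infinity>n. b n)"])
    show "(\<lambda>x. h x - G x) \<in> borel_measurable (torus_measure 1)" using mh mG by (rule borel_measurable_diff)
    show "norm (h x - G x) \<le> 5 + (\<Sum>\<^sub>\<infinity>n. b n)" if "x \<in> space (torus_measure 1)" for x
      using hb[OF that] Gb[of x] norm_triangle_ineq4[of "h x" "G x"] by linarith
    show "fourier_coeff 1 (\<lambda>x. h x - G x) k = 0" for k
      by (subst fourier_coeff_diff[OF mh hb mG Gb]) (simp_all only: fch fcG diff_self)
    have "pi / 2 < pi" by simp
    then show "\<bar>x0 i\<bar> < pi" if "i < 1" for i using s unfolding x0_def by linarith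
    show "\<exists>\<delta>>0. \<forall>x\<in>space (torus_measure 1). (\<forall>i<1. \<bar>x i - x0 i\<bar> < \<delta>) \<longrightarrow> norm (h x - G x - (h x0 - G x0)) < e" if "e > 0" for e
    proof -
      have hG: "continuous_on UNIV (\<lambda>x. h x - G x)" using hc Gc by (rule continuous_on_diff)
      have hGd: "h x - G x = h z - G z" if "\<And>i. i < 1 \<Longrightarrow> x i = z i" for x z
        using hd[OF that] Gd[OF that] by simp
      show ?thesis
        by (rule continuous_delta[where F="\<lambda>x. h x - G x" and ?x0.0=x0, OF hG hGd that]) (auto simp: dist_norm)
    qed
  qed
  then have "G x0 = trapz y s" by (simp add: h_def x0_def)
  also have "\<dots> = cis (y / (2*pi) * s)"
  proof -
    have "s / pi - 1/2 \<le> 0" "- s / pi - 1/2 \<le> 0" using s by (simp_all add: divide_le_eq le_divide_eq abs_le_iff)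
    then have "max 0 (s/pi - 1/2) = 0" "max 0 (-s/pi - 1/2) = 0" by simp_all
    then show ?thesis unfolding trapz_def by simp
  qed
  finally show ?thesis using Gs[of x0] by (simp add: g_def c_def texp_def x0_def)
qed

lemma tsinc_average:
  assumes h: "h > 0"
  shows "((\<lambda>t. cis (x * t)) has_integral (2 * h * of_real (tsinc (x * h)))) {-h..h}"
proof (cases "x = 0")
  case True
  then show ?thesis using has_integral_const_real[of "1::complex" "-h" h] h by (simp add: tsinc_def scaleR_conv_of_real)
next
  case False
  have "((\<lambda>t. cis (x * t)) has_integral ((cis (x * h) / (\<i> * x)) - (cis (x * (-h)) / (\<i> * x)))) {-h..h}"
  proof (rule fundamental_theorem_of_calculus)
    show "((\<lambda>t. cis (x * t) / (\<i> * x)) has_vector_derivative cis (x * t)) (at t within {-h..h})" for t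
      using has_vector_derivative_divide[OF cis_has_vector_derivative[of x t "{-h..h}"], of "\<i> * x"] False by simp
  qed (use h in simp)
  moreover have "(cis (x * h) / (\<i> * x)) - (cis (x * (-h)) / (\<i> * x)) = 2 * h * of_real (tsinc (x * h))"
    using tsinc_of_real_mult[of "x * h"] False by (simp add: field_simps)
  ultimately show ?thesis by simp
qed

text \<open>The additional factor at level \<open>Suc L\<close> is, by \<open>tsinc_average\<close>,
  the mean of \<open>cis (x * t)\<close> over \<open>\<bar>t\<bar> \<le> 1 / 2 ^ Suc L\<close>.
  Averaging the identity of level \<open>L\<close> over the frequencies \<open>w - t\<close> thus
  yields the next level; keeping \<open>w - t\<close> within the old band halves the admissible band
  for \<open>w\<close>. Uniform convergence in \<open>t\<close> permits the exchange of limit and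
  mean.\<close>

lemma KL_sampling:
  assumes "2 \<le> L" "\<bar>w\<bar> \<le> 1 / 2 ^ L"
  shows "((\<lambda>n::int. of_real (KL L (y - 2 * pi * real_of_int n)) * cis (2 * pi * real_of_int n * w)) has_sum cis (w * y)) UNIV"
  using assms
proof (induction L arbitrary: w rule: dec_induct)
  case base
  have "2 * pi * \<bar>w\<bar> \<le> 2 * pi * (1/4)" using base by (intro mult_left_mono) auto
  then have "\<bar>2 * pi * w\<bar> \<le> pi / 2" by (simp add: abs_mult)
  from KL_sampling_2[OF this, of y] show ?case by (simp add: mult_ac)
next
  case (step L)
  define h :: real where "h = 1 / 2 ^ Suc L"
  have h: "h > 0" by (simp add: h_def)
  define K where "K L n = KL L (y - 2 * pi * real_of_int n)" for L n
  define E where "E F t = (\<Sum>n\<in>F. of_real (K L n) * cis (2 * pi * real_of_int n * (w - t))) - cis ((w - t) * y)" for F t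
  have sm: "(\<lambda>n. \<bar>K L n\<bar>) summable_on UNIV" unfolding K_def by (rule KL_shift_summable) (use step in simp)
  have ul: "uniform_limit {-h..h} (\<lambda>F t. \<Sum>n\<in>F. of_real (K L n) * cis (2 * pi * real_of_int n * (w - t))) (\<lambda>t. cis ((w - t) * y)) (finite_subsets_at_top UNIV)"
  proof (rule Weierstrass_m_test_general'[OF _ _ sm])
    fix t assume t: "t \<in> {-h..h}"
    have "\<bar>w - t\<bar> \<le> h + h" using t step.prems by (auto simp: h_def abs_le_iff)
    also have "\<dots> = 1 / 2 ^ L" by (simp add: h_def)
    finally show "((\<lambda>n. of_real (K L n) * cis (2 * pi * real_of_int n * (w - t))) has_sum cis ((w - t) * y)) UNIV"
      unfolding K_def by (rule step.IH)
  qed (simp add: norm_mult)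
  \<comment> \<open>The factor \<open>cis (y * t)\<close> makes the limit
    \<open>cis ((w - t) * y)\<close> constant in \<open>t\<close>, so its mean is
    \<open>cis (w * y)\<close> itself.\<close>
  have avg: "((\<lambda>t. cis (y * t) * E F t) has_integral
      (2 * h * ((\<Sum>n\<in>F. of_real (K (Suc L) n) * cis (2 * pi * real_of_int n * w)) - cis (w * y)))) {-h..h}" if "finite F" for F
  proof -
    have e: "cis (y * t) * E F t = (\<Sum>n\<in>F. (of_real (K L n) * cis (2 * pi * real_of_int n * w)) * cis ((y - 2 * pi * real_of_int n) * t)) - cis (w * y)" for t
    proof -
      have "cis (y * t) * cis (2 * pi * real_of_int n * (w - t)) = cis (2 * pi * real_of_int n * w) * cis ((y - 2 * pi * real_of_int n) * t)" for n
        unfolding cis_mult by (simp add: algebra_simps)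
      then have "cis (y * t) * (\<Sum>n\<in>F. of_real (K L n) * cis (2 * pi * real_of_int n * (w - t)))
         = (\<Sum>n\<in>F. (of_real (K L n) * cis (2 * pi * real_of_int n * w)) * cis ((y - 2 * pi * real_of_int n) * t))"
        unfolding sum_distrib_left mult.left_commute[of "cis (y * t)"] by (simp only: mult.assoc)
      moreover have "cis (y * t) * cis ((w - t) * y) = cis (w * y)" unfolding cis_mult by (simp add: algebra_simps)
      ultimately show ?thesis by (simp add: E_def right_diff_distrib)
    qed
    have "((\<lambda>t. (\<Sum>n\<in>F. (of_real (K L n) * cis (2 * pi * real_of_int n * w)) * cis ((y - 2 * pi * real_of_int n) * t)) - cis (w * y)) has_integral
      ((\<Sum>n\<in>F. (of_real (K L n) * cis (2 * pi * real_of_int n * w)) * (2 * h * of_real (tsinc ((y - 2 * pi * real_of_int n) * h)))) - (h - (-h)) *\<^sub>R cis (w * y))) {-h..h}"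
      using h that by (intro has_integral_diff has_integral_sum has_integral_mult_right tsinc_average has_integral_const_real[THEN has_integral_eq_rhs]) auto
    moreover have "(\<Sum>n\<in>F. (of_real (K L n) * cis (2 * pi * real_of_int n * w)) * (2 * h * of_real (tsinc ((y - 2 * pi * real_of_int n) * h)))) - (h - (-h)) *\<^sub>R cis (w * y)
       = 2 * h * ((\<Sum>n\<in>F. of_real (K (Suc L) n) * cis (2 * pi * real_of_int n * w)) - cis (w * y))"
      by (simp add: K_def KL_Suc h_def scaleR_conv_of_real right_diff_distrib sum_distrib_left mult_ac)
    ultimately show ?thesis unfolding e by simp
  qed
  show ?case unfolding has_sum_def
  proof (rule tendstoI)
    fix e :: real assume e: "e > 0"
    have "\<forall>\<^sub>F F in finite_subsets_at_top UNIV. finite (F :: int set)"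
      by (auto simp: eventually_finite_subsets_at_top)
    moreover have "\<forall>\<^sub>F F in finite_subsets_at_top UNIV. \<forall>t\<in>{-h..h}. dist (\<Sum>n\<in>F. of_real (K L n) * cis (2 * pi * real_of_int n * (w - t))) (cis ((w - t) * y)) < e/2"
      using ul e by (intro uniform_limitD) auto
    ultimately show "\<forall>\<^sub>F F in finite_subsets_at_top UNIV. dist (\<Sum>n\<in>F. of_real (KL (Suc L) (y - 2 * pi * real_of_int n)) * cis (2 * pi * real_of_int n * w)) (cis (w * y)) < e"
    proof eventually_elim
      case (elim F)
      have "norm (2 * h * ((\<Sum>n\<in>F. of_real (K (Suc L) n) * cis (2 * pi * real_of_int n * w)) - cis (w * y))) \<le> (e/2) * measure lborel {-h..h}"
      proof (rule has_integral_bound_real[OF _ _ avg, where S="{}"])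
        show "norm (cis (y * t) * E F t) \<le> e/2" if "t \<in> {-h..h} - {}" for t
          using elim(2) that by (auto simp: norm_mult E_def dist_norm less_imp_le)
      qed (use e elim in auto)
      then have "norm ((\<Sum>n\<in>F. of_real (K (Suc L) n) * cis (2 * pi * real_of_int n * w)) - cis (w * y)) \<le> e/2"
        using h by (simp add: norm_mult content_real)
      then show ?case using e by (simp add: dist_norm K_def)
    qed
  qed
qed

section \<open>Interpolation operators\<close>

definition node :: "nat \<Rightarrow> int \<Rightarrow> real" where
  "node j u = 2 * pi * real_of_int u / 2 ^ j"

text \<open>The grid \<open>pt\<close> starts at \<open>-pi\<close>, the nodes are centred at 0;
  hence the index offset. At level 0 the two differ: the only node is 0, the only grid point is
  \<open>-pi\<close>.\<close>

lemma node_eq_pt: "j \<ge> 1 \<Longrightarrow> node j (int v - 2 ^ (j - 1)) = pt j v"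
proof -
  assume "j \<ge> 1"
  then have p: "(2::real) ^ j = 2 * 2 ^ (j - 1)" by (cases j) auto
  show ?thesis by (simp add: node_def pt_def p field_simps)
qed

lemma finite_Ugrid [simp]: "finite (Ugrid j)"
  by (simp add: Ugrid_def)

lemma sum_Ugrid:
  fixes f :: "real \<Rightarrow> 'b::comm_monoid_add"
  assumes "j \<ge> 1"
  shows "(\<Sum>u\<in>Ugrid j. f (node j u)) = (\<Sum>v<2^j. f (pt j v))"
proof -
  have p: "(2::int) ^ j = 2 * 2 ^ (j - 1)" using assms by (cases j) auto
  show ?thesis
  proof (rule sum.reindex_bij_witness[of _ "\<lambda>v. int v - 2 ^ (j - 1)" "\<lambda>u. nat (u + 2 ^ (j - 1))"])
    fix u assume "u \<in> Ugrid j"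
    then have u: "- (2 ^ (j - 1)) \<le> u" "u \<le> 2 ^ (j - 1) - 1" using assms by (auto simp: Ugrid_def)
    then show "int (nat (u + 2 ^ (j - 1))) - 2 ^ (j - 1) = u" by simp
    have "u + 2 ^ (j - 1) < 2 ^ j" unfolding p using u by simp
    then show "nat (u + 2 ^ (j - 1)) \<in> {..<2 ^ j}" using u by (simp add: nat_less_iff)
    show "f (pt j (nat (u + 2 ^ (j - 1)))) = f (node j u)"
      using node_eq_pt[OF assms, of "nat (u + 2 ^ (j - 1))"] u by simp
  next
    fix v :: nat assume "v \<in> {..<2^j}"
    then have "int v < 2 ^ j" by (metis lessThan_iff of_nat_less_iff of_nat_numeral of_nat_power)
    then show "int v - 2 ^ (j - 1) \<in> Ugrid j" using assms unfolding Ugrid_def p by auto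
  qed simp
qed

text \<open>Up to a unimodular factor the kernel is a normalised geometric sum, that is,
  \<open>damping_kernel\<close> with exponent 1. The decay is only of first order.\<close>

lemma Kpi_1_norm:
  assumes "j \<ge> 1"
  shows "norm (Kpi 1 j x) \<le> 3 * (1 + 2 ^ j * norm (cis x - 1)) powr (- 1)"
proof -
  have p: "(2::int) ^ j = 2 * 2 ^ (j - 1)" using assms by (cases j) auto
  have "(\<Sum>k\<in>{-(2 ^ (j - 1))..2 ^ (j - 1) - 1 :: int}. exp (\<i> * of_real (real_of_int k * x)))
     = (\<Sum>b<2^j. cis (real_of_int (int b - 2 ^ (j - 1)) * x))"
  proof (rule sum.reindex_bij_witness[of _ "\<lambda>v. int v - 2 ^ (j - 1)" "\<lambda>u. nat (u + 2 ^ (j - 1))"])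
    fix u :: int assume u: "u \<in> {-(2 ^ (j - 1))..2 ^ (j - 1) - 1}"
    then show "int (nat (u + 2 ^ (j - 1))) - 2 ^ (j - 1) = u" by simp
    have "u + 2 ^ (j - 1) < 2 ^ j" unfolding p using u by simp
    then show "nat (u + 2 ^ (j - 1)) \<in> {..<2 ^ j}" using u by (simp add: nat_less_iff)
    show "cis (real_of_int (int (nat (u + 2 ^ (j - 1))) - 2 ^ (j - 1)) * x) = exp (\<i> * of_real (real_of_int u * x))"
      using u by (simp add: cis_conv_exp)
  next
    fix v :: nat assume "v \<in> {..<2^j}"
    then have "int v < 2 ^ j" by (metis lessThan_iff of_nat_less_iff of_nat_numeral of_nat_power)
    then show "int v - 2 ^ (j - 1) \<in> {-(2 ^ (j - 1))..2 ^ (j - 1) - 1}" unfolding p by auto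
  qed simp
  also have "\<dots> = cis (- (2 ^ (j - 1) * x)) * (\<Sum>b<2^j. cis (real b * x))"
    unfolding sum_distrib_left by (rule sum.cong) (auto simp: cis_mult algebra_simps)
  finally have "norm (Kpi 1 j x) = norm (damping_kernel (2^j) 1 x)"
    using assms by (simp add: Kpi_def damping_kernel_def norm_mult norm_divide norm_power)
  then show ?thesis using damping_kernel_bound[of "2^j" 1 x] by simp
qed

text \<open>Every integer is \<open>u - 2 ^ j * m\<close> for exactly one \<open>u\<close> in
  \<open>Ugrid j\<close> and one \<open>m\<close>. Summing a periodised kernel over the nodes is
  thereby the same as summing the unperiodised one over all integers.\<close>

lemma has_sum_residues:
  fixes \<phi> :: "int \<Rightarrow> 'b::banach"
  assumes s: "(\<lambda>n. norm (\<phi> n)) summable_on UNIV" and tot: "(\<phi> has_sum S) UNIV"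
  shows "(\<Sum>u\<in>Ugrid j. \<Sum>\<^sub>\<infinity>m. \<phi> (u - 2 ^ j * m)) = S"
    and "\<And>u. (\<lambda>m. norm (\<phi> (u - 2 ^ j * m))) summable_on UNIV"
proof -
  have sm: "(\<lambda>m. norm (\<phi> (u - 2 ^ j * m))) summable_on UNIV" for u
  proof -
    have inj: "inj (\<lambda>m::int. u - 2 ^ j * m)" by (auto simp: inj_def)
    have "(\<lambda>n. norm (\<phi> n)) summable_on range (\<lambda>m::int. u - 2 ^ j * m)"
      using s by (rule summable_on_subset_banach) auto
    then show ?thesis using summable_on_reindex[OF inj, of "\<lambda>n. norm (\<phi> n)"] by (simp add: o_def)
  qed
  then show "(\<lambda>m. norm (\<phi> (u - 2 ^ j * m))) summable_on UNIV" for u by auto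
  have bij: "bij_betw (\<lambda>(u, m). u - 2 ^ j * m) (Ugrid j \<times> UNIV) UNIV"
  proof -
    define N where "N = (2::int) ^ j"
    have N: "N > 0" by (simp add: N_def)
    \<comment> \<open>The shift that turns \<open>Ugrid j\<close> into the standard residues
      \<open>{0..<N}\<close>. Level 0 has its own value because its grid is
      \<open>{0}\<close>.\<close>
    define a where "a = (if j = 0 then 0 else (2::int) ^ (j - 1))"
    have U: "u \<in> Ugrid j \<longleftrightarrow> 0 \<le> u + a \<and> u + a < N" for u
      unfolding Ugrid_def a_def N_def by (cases j) auto
    show ?thesis
    proof (rule bij_betw_byWitness[where f'="\<lambda>n. ((n + a) mod N - a, - ((n + a) div N))"])
      show "\<forall>p\<in>Ugrid j \<times> UNIV. (((case p of (u, m) \<Rightarrow> u - 2 ^ j * m) + a) mod N - a, - (((case p of (u, m) \<Rightarrow> u - 2 ^ j * m) + a) div N)) = p"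
      proof
        fix p assume "p \<in> Ugrid j \<times> (UNIV :: int set)"
        then obtain u m where p: "p = (u, m)" and "u \<in> Ugrid j" by auto
        then have u: "0 \<le> u + a" "u + a < N" using U by auto
        have e: "u - 2 ^ j * m + a = (u + a) + N * (- m)" by (simp add: N_def)
        show "(((case p of (u, m) \<Rightarrow> u - 2 ^ j * m) + a) mod N - a, - (((case p of (u, m) \<Rightarrow> u - 2 ^ j * m) + a) div N)) = p"
          unfolding p prod.case e using u N by (simp add: div_pos_pos_trivial mod_pos_pos_trivial del: mult_minus_right)
      qed
      show "\<forall>n\<in>UNIV. (case ((n + a) mod N - a, - ((n + a) div N)) of (u, m) \<Rightarrow> u - 2 ^ j * m) = n"
      proof
        fix n :: int
        have *: "N * ((n + a) div N) + (n + a) mod N = n + a" by (rule mult_div_mod_eq)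
        show "(case ((n + a) mod N - a, - ((n + a) div N)) of (u, m) \<Rightarrow> u - 2 ^ j * m) = n"
          unfolding prod.case N_def[symmetric] mult_minus_right using * by linarith
      qed
      show "(\<lambda>(u, m). u - 2 ^ j * m) ` (Ugrid j \<times> UNIV) \<subseteq> UNIV" by simp
      show "(\<lambda>n. ((n + a) mod N - a, - ((n + a) div N))) ` UNIV \<subseteq> Ugrid j \<times> UNIV" using N by (auto simp: U)
    qed
  qed
  have "((\<lambda>p. \<phi> (case p of (u, m) \<Rightarrow> u - 2 ^ j * m)) has_sum S) (Ugrid j \<times> UNIV)"
    using has_sum_reindex_bij_betw[OF bij, of \<phi> S] tot by simp
  then have "((\<lambda>u. \<Sum>\<^sub>\<infinity>m. \<phi> (u - 2 ^ j * m)) has_sum S) (Ugrid j)"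
    by (rule has_sum_SigmaD) (auto intro!: has_sum_infsum abs_summable_summable[OF sm])
  then show "(\<Sum>u\<in>Ugrid j. \<Sum>\<^sub>\<infinity>m. \<phi> (u - 2 ^ j * m)) = S"
    by (simp add: has_sum_finite_iff)
qed

lemma Kpi_ge_2:
  "2 \<le> L \<Longrightarrow> Kpi L j (t - node j u) = of_real (\<Sum>\<^sub>\<infinity>m. KL L (2 ^ j * t - 2 * pi * real_of_int (u - 2 ^ j * m)))"
proof -
  assume L: "2 \<le> L"
  have "2 ^ j * (t - node j u + 2 * pi * real_of_int m) = 2 ^ j * t - 2 * pi * real_of_int (u - 2 ^ j * m)" for m
    by (simp add: node_def algebra_simps)
  then show ?thesis using L by (simp add: Kpi_def)
qed

text \<open>For \<open>L = 1\<close> this is discrete orthogonality, \<open>k\<close> lying strictly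
  inside the frequency range of the kernel. For \<open>L \<ge> 2\<close> unfolding the periodisation
  turns the sum over the nodes into the series of \<open>KL_sampling\<close> at
  \<open>y = 2 ^ j * t\<close> and \<open>w = k / 2 ^ j\<close>. The hypothesis on \<open>k\<close>
  leaves a spare factor 2 compared with the band \<open>1 / 2 ^ L\<close>.\<close>

lemma interpolation_reproduce:
  fixes k :: int and t :: real
  assumes L: "1 \<le> L" and k: "\<bar>k\<bar> * 2 ^ (L + 1) \<le> 2 ^ j"
  shows "(\<Sum>u\<in>Ugrid j. cis (k * node j u) * Kpi L j (t - node j u)) = cis (k * t)"
proof (cases "L = 1")
  case True
  show ?thesis
  proof (cases "j = 0")
    case True
    with k \<open>L = 1\<close> have "k = 0" by auto
    then show ?thesis using True \<open>L = 1\<close> by (simp add: Ugrid_def Kpi_def)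
  next
    case False
    then have j: "j \<ge> 1" by simp
    have p: "(2::int) ^ j = 2 * 2 ^ (j - 1)" using j by (cases j) auto
    have k4: "\<bar>k\<bar> * 2 \<le> 2 ^ (j - 1)" using k \<open>L = 1\<close> unfolding p by simp
    have kr: "k \<in> {-(2 ^ (j - 1))..2 ^ (j - 1) - 1}"
    proof -
      have "(2::int) ^ (j - 1) \<ge> 1" by simp
      moreover have "k \<le> \<bar>k\<bar>" "-k \<le> \<bar>k\<bar>" by auto
      ultimately have "- (2 ^ (j - 1)) \<le> k" "k \<le> 2 ^ (j - 1) - 1" using k4 by linarith+
      then show ?thesis by simp
    qed
    have "(\<Sum>u\<in>Ugrid j. cis (k * node j u) * Kpi L j (t - node j u)) = (\<Sum>v<2^j. cis (k * pt j v) * Kpi L j (t - pt j v))"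
      by (rule sum_Ugrid[OF j])
    also have "\<dots> = (\<Sum>v<2^j. cis (k * pt j v) * (1 / 2 ^ j * (\<Sum>m\<in>{-(2 ^ (j - 1))..2 ^ (j - 1) - 1 :: int}. cis (real_of_int m * (t - pt j v)))))"
      using j \<open>L = 1\<close> by (simp add: Kpi_def cis_conv_exp)
    also have "\<dots> = 1 / 2 ^ j * (\<Sum>m\<in>{-(2 ^ (j - 1))..2 ^ (j - 1) - 1 :: int}. cis (real_of_int m * t) * (\<Sum>v<2^j. cis (real_of_int (k - m) * pt j v)))"
      unfolding sum_distrib_left
      by (subst sum.swap) (intro sum.cong refl, simp add: cis_mult algebra_simps flip: mult.assoc)
    also have "\<dots> = 1 / 2 ^ j * (\<Sum>m\<in>{-(2 ^ (j - 1))..2 ^ (j - 1) - 1 :: int}. if m = k then 2 ^ j * cis (k * t) else 0)"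
    proof (intro arg_cong2[where f=times] sum.cong refl)
      fix m :: int assume m: "m \<in> {-(2 ^ (j - 1))..2 ^ (j - 1) - 1}"
      have "\<bar>k - m\<bar> < 2 ^ j" unfolding p using kr m by auto
      from sum_cis_pt[OF this] show "cis (real_of_int m * t) * (\<Sum>v<2^j. cis (real_of_int (k - m) * pt j v)) = (if m = k then 2 ^ j * cis (k * t) else 0)"
        by auto
    qed
    also have "\<dots> = cis (k * t)" using kr by simp
    finally show ?thesis .
  qed
next
  case False
  then have L2: "2 \<le> L" using L by simp
  define w where "w = real_of_int k / 2 ^ j"
  have w: "\<bar>w\<bar> \<le> 1 / 2 ^ L"
  proof -
    have "real_of_int (\<bar>k\<bar> * 2 ^ (L + 1)) \<le> real_of_int (2 ^ j)" using k by (simp only: of_int_le_iff)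
    then have "\<bar>real_of_int k\<bar> * 2 ^ L * 2 \<le> 2 ^ j" by simp
    moreover have "0 \<le> \<bar>real_of_int k\<bar> * 2 ^ L" by simp
    ultimately have "\<bar>real_of_int k\<bar> * 2 ^ L \<le> 2 ^ j" by linarith
    then show ?thesis by (simp add: w_def field_simps abs_divide)
  qed
  define \<phi> where "\<phi> n = complex_of_real (KL L (2 ^ j * t - 2 * pi * real_of_int n)) * cis (2 * pi * real_of_int n * w)" for n
  have tot: "(\<phi> has_sum cis (w * (2 ^ j * t))) UNIV" unfolding \<phi>_def by (rule KL_sampling[OF L2 w])
  have sm: "(\<lambda>n. norm (\<phi> n)) summable_on UNIV"
    using KL_shift_summable[OF L2, of "2 ^ j * t"] by (simp add: \<phi>_def norm_mult)
  have u: "cis (k * node j u) * Kpi L j (t - node j u) = (\<Sum>\<^sub>\<infinity>m. \<phi> (u - 2 ^ j * m))" for u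
  proof -
    \<comment> \<open>The exponential depends only on the residue \<open>u\<close>, so it leaves the
      sum over \<open>m\<close>.\<close>
    have "cis (2 * pi * real_of_int (u - 2 ^ j * m) * w) = cis (k * node j u)" for m
    proof -
      have "2 * pi * real_of_int (u - 2 ^ j * m) * w = k * node j u - 2 * pi * real_of_int (m * k)"
        by (simp add: w_def node_def field_simps)
      then have "cis (2 * pi * real_of_int (u - 2 ^ j * m) * w) = cis (k * node j u) / cis (2 * pi * real_of_int (m * k))"
        by (simp only: cis_divide)
      also have "cis (2 * pi * real_of_int (m * k)) = 1" by (rule cis_multiple_2pi) auto
      finally show ?thesis by simp
    qed
    then have "(\<Sum>\<^sub>\<infinity>m. \<phi> (u - 2 ^ j * m)) = (\<Sum>\<^sub>\<infinity>m. complex_of_real (KL L (2 ^ j * t - 2 * pi * real_of_int (u - 2 ^ j * m))) * cis (k * node j u))"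
      unfolding \<phi>_def by presburger
    also have "\<dots> = (\<Sum>\<^sub>\<infinity>m. complex_of_real (KL L (2 ^ j * t - 2 * pi * real_of_int (u - 2 ^ j * m)))) * cis (k * node j u)"
      by (rule infsum_cmult_left')
    also have "\<dots> = Kpi L j (t - node j u) * cis (k * node j u)"
    proof -
      have "(\<lambda>m. \<bar>KL L (2 ^ j * t - 2 * pi * real_of_int (u - 2 ^ j * m))\<bar>) summable_on UNIV"
        using has_sum_residues(2)[OF sm tot, of u j] by (simp add: \<phi>_def norm_mult)
      then have "(\<lambda>m. KL L (2 ^ j * t - 2 * pi * real_of_int (u - 2 ^ j * m))) summable_on UNIV"
        by (subst summable_on_iff_abs_summable_on_real) simp
      from infsumI[OF has_sum_of_real[OF has_sum_infsum[OF this]]] show ?thesis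
        unfolding Kpi_ge_2[OF L2] by simp
    qed
    finally show ?thesis by (simp add: mult.commute)
  qed
  have "(\<Sum>u\<in>Ugrid j. cis (k * node j u) * Kpi L j (t - node j u)) = cis (w * (2 ^ j * t))"
    unfolding u by (rule has_sum_residues(1)[OF sm tot])
  then show ?thesis by (simp add: w_def)
qed

text \<open>For \<open>L = 1\<close> first-order decay is summable only after raising it to a power
  \<open>s > 1\<close>. For \<open>L \<ge> 2\<close> already the absolute sums are bounded, and they
  dominate the \<ell>_s norm.\<close>

lemma interpolation_kernel_bound:
  fixes s :: real
  assumes L: "1 \<le> L" and s: "s > 1"
  obtains C where "C > 0" "\<And>j t. lnorm s (Ugrid j) (\<lambda>u. norm (Kpi L j (t - node j u))) \<le> C"
proof (cases "L = 1")
  case True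
  obtain C where C: "C > 0" "\<And>l z. (\<Sum>n<2^l. (1 + 2 ^ l * chord z (pt l n)) powr (-s)) \<le> C"
    using chord_sum_bound[OF s] by blast
  show ?thesis
  \<comment> \<open>The 1 covers \<open>j = 0\<close>, where the kernel is constantly 1 and there is
    a single node.\<close>
  proof (rule that[of "max 1 (3 * C powr (1/s))"])
    fix j t
    show "lnorm s (Ugrid j) (\<lambda>u. norm (Kpi L j (t - node j u))) \<le> max 1 (3 * C powr (1/s))"
    proof (cases "j = 0")
      case True
      then show ?thesis using \<open>L = 1\<close> by (simp add: lnorm_def Ugrid_def Kpi_def)
    next
      case False
      then have j: "j \<ge> 1" by simp
      have "lnorm s (Ugrid j) (\<lambda>u. norm (Kpi L j (t - node j u))) \<le> lnorm s (Ugrid j) (\<lambda>u. 3 * (1 + 2 ^ j * chord t (node j u)) powr (- 1))"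
        using Kpi_1_norm[OF j] \<open>L = 1\<close> s by (intro lnorm_mono) (auto simp flip: chord_eq_1)
      also have "\<dots> = 3 * lnorm s (Ugrid j) (\<lambda>u. (1 + 2 ^ j * chord t (node j u)) powr (- 1))"
        using s by (intro lnorm_scale) auto
      also have "lnorm s (Ugrid j) (\<lambda>u. (1 + 2 ^ j * chord t (node j u)) powr (- 1)) = (\<Sum>u\<in>Ugrid j. (1 + 2 ^ j * chord t (node j u)) powr (- s)) powr (1/s)"
        unfolding lnorm_def powr_powr by simp
      also have "(\<Sum>u\<in>Ugrid j. (1 + 2 ^ j * chord t (node j u)) powr (- s)) = (\<Sum>n<2^j. (1 + 2 ^ j * chord t (pt j n)) powr (-s))"
        by (rule sum_Ugrid[OF j])
      also have "3 * \<dots> powr (1/s) \<le> 3 * C powr (1/s)"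
        using s C by (intro mult_left_mono powr_mono2) (auto intro!: sum_nonneg)
      finally show ?thesis by simp
    qed
  qed simp
next
  case False
  then have L2: "2 \<le> L" using L by simp
  obtain C where C: "C > 0" "\<And>L y F. 2 \<le> L \<Longrightarrow> finite F \<Longrightarrow> (\<Sum>n\<in>F. \<bar>KL L (y - 2 * pi * real_of_int n)\<bar>) \<le> C"
    using KL_shift_bound by blast
  show ?thesis
  proof (rule that[OF C(1)])
    fix j t
    define \<phi> where "\<phi> n = \<bar>KL L (2 ^ j * t - 2 * pi * real_of_int n)\<bar>" for n :: int
    have sm: "\<phi> summable_on UNIV" unfolding \<phi>_def by (rule KL_shift_summable[OF L2])
    have sm': "(\<lambda>n. norm (\<phi> n)) summable_on UNIV" using sm by (simp add: \<phi>_def[abs_def])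
    have r1: "(\<Sum>u\<in>Ugrid j. \<Sum>\<^sub>\<infinity>m. \<phi> (u - 2 ^ j * m)) = (\<Sum>\<^sub>\<infinity>n. \<phi> n)"
      by (rule has_sum_residues(1)[OF sm']) (use sm in simp)
    have r2: "(\<lambda>m. norm (\<phi> (u - 2 ^ j * m))) summable_on UNIV" for u
      by (rule has_sum_residues(2)[OF sm']) (rule has_sum_infsum[OF sm])
    have "(\<Sum>\<^sub>\<infinity>n. \<phi> n) \<le> C"
      by (rule infsum_le_finite_sums[OF sm]) (use C(2)[OF L2] in \<open>simp add: \<phi>_def\<close>)
    moreover have "norm (Kpi L j (t - node j u)) \<le> (\<Sum>\<^sub>\<infinity>m. \<phi> (u - 2 ^ j * m))" for u
    proof -
      have "norm (Kpi L j (t - node j u)) = \<bar>\<Sum>\<^sub>\<infinity>m. KL L (2 ^ j * t - 2 * pi * real_of_int (u - 2 ^ j * m))\<bar>"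
        unfolding Kpi_ge_2[OF L2] by simp
      also have "\<dots> \<le> (\<Sum>\<^sub>\<infinity>m. \<phi> (u - 2 ^ j * m))"
        using norm_infsum_bound[of "\<lambda>m. KL L (2 ^ j * t - 2 * pi * real_of_int (u - 2 ^ j * m))" UNIV] r2[of u] by (simp add: \<phi>_def)
      finally show ?thesis .
    qed
    ultimately have "(\<Sum>u\<in>Ugrid j. norm (Kpi L j (t - node j u))) \<le> C"
      using r1 by (metis (no_types, lifting) order_trans sum_mono)
    moreover have "lnorm s (Ugrid j) (\<lambda>u. norm (Kpi L j (t - node j u))) \<le> lnorm 1 (Ugrid j) (\<lambda>u. norm (Kpi L j (t - node j u)))"
      using s by (intro lnorm_antimono) auto
    ultimately show "lnorm s (Ugrid j) (\<lambda>u. norm (Kpi L j (t - node j u))) \<le> C"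
      by (simp add: lnorm_def sum_nonneg)
  qed
qed

lemma sum_even_Ugrid:
  fixes F :: "real \<Rightarrow> 'b::comm_monoid_add"
  assumes "j \<ge> 1"
  shows "(\<Sum>u\<in>Ugrid j. if even u then F (node j u) else 0) = (\<Sum>w\<in>Ugrid (j - 1). F (node (j - 1) w))"
proof -
  have "(\<Sum>u\<in>Ugrid j. if even u then F (node j u) else 0) = (\<Sum>u\<in>{u\<in>Ugrid j. even u}. F (node j u))"
    by (rule sum.inter_filter[symmetric]) simp
  also have "\<dots> = (\<Sum>w\<in>Ugrid (j - 1). F (node (j - 1) w))"
  proof (rule sum.reindex_bij_witness[of _ "\<lambda>w. 2 * w" "\<lambda>u. u div 2"])
    fix u assume u: "u \<in> {u \<in> Ugrid j. even u}"
    then show "2 * (u div 2) = u" by auto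
    show "u div 2 \<in> Ugrid (j - 1)"
      using u assms by (cases "j - 1") (auto simp: Ugrid_def)
    have p: "(2::real) ^ j = 2 * 2 ^ (j - 1)" using assms by (cases j) auto
    from u obtain w where "u = 2 * w" by auto
    then show "F (node (j - 1) (u div 2)) = F (node j u)" by (simp add: node_def p mult.assoc)
  next
    fix w assume w: "w \<in> Ugrid (j - 1)"
    show "2 * w div 2 = w" by simp
    show "2 * w \<in> {u \<in> Ugrid j. even u}"
      using w assms by (cases "j - 1") (auto simp: Ugrid_def split: if_splits)
  qed
  finally show ?thesis .
qed

text \<open>The nodes of level \<open>j - 1\<close> are those nodes of level \<open>j\<close> that have an even index, so \<open>etaop\<close> is a
  single sum over the nodes of level \<open>j\<close>.\<close>

definition eta_kernel :: "nat \<Rightarrow> nat \<Rightarrow> int \<Rightarrow> real \<Rightarrow> complex" where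
  "eta_kernel L j u t = Kpi L j (t - node j u) - (if j \<ge> 1 \<and> even u then Kpi L (j - 1) (t - node j u) else 0)"

lemma sum_eta_kernel:
  assumes "j \<ge> 1"
  shows "(\<Sum>u\<in>Ugrid j. F (node j u) * eta_kernel L j u t)
     = (\<Sum>u\<in>Ugrid j. F (node j u) * Kpi L j (t - node j u)) - (\<Sum>u\<in>Ugrid (j - 1). F (node (j - 1) u) * Kpi L (j - 1) (t - node (j - 1) u))"
proof -
  have "(\<Sum>u\<in>Ugrid j. F (node j u) * eta_kernel L j u t)
     = (\<Sum>u\<in>Ugrid j. F (node j u) * Kpi L j (t - node j u)) - (\<Sum>u\<in>Ugrid j. if even u then F (node j u) * Kpi L (j - 1) (t - node j u) else 0)"
    unfolding sum_subtractf[symmetric] by (rule sum.cong) (use assms in \<open>auto simp: eta_kernel_def right_diff_distrib\<close>)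
  then show ?thesis using sum_even_Ugrid[OF assms, of "\<lambda>y. F y * Kpi L (j - 1) (t - y)"] by simp
qed

lemma etaop_formula:
  "etaop L j i g x = (\<Sum>u\<in>Ugrid j. g (x(i := node j u)) * eta_kernel L j u (x i))"
proof (cases "j = 0")
  case True
  then show ?thesis by (simp add: etaop_def Iop_def node_def eta_kernel_def)
next
  case False
  then have "j \<ge> 1" by simp
  then show ?thesis using False sum_eta_kernel[of j "\<lambda>y. g (x(i := y))" L "x i"] by (simp add: etaop_def Iop_def node_def)
qed

lemma eta_kernel_bound:
  fixes s :: real
  assumes L: "1 \<le> L" and s: "s > 1"
  obtains C where "C > 0" "\<And>j t. lnorm s (Ugrid j) (\<lambda>u. norm (eta_kernel L j u t)) \<le> C"
proof -
  obtain C where C: "C > 0" "\<And>j t. lnorm s (Ugrid j) (\<lambda>u. norm (Kpi L j (t - node j u))) \<le> C"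
    using interpolation_kernel_bound[OF L s] by blast
  show ?thesis
  proof (rule that[of "C + C"])
    fix j t
    define b where "b u = (if j \<ge> 1 \<and> even u then norm (Kpi L (j - 1) (t - node j u)) else 0)" for u
    have "lnorm s (Ugrid j) (\<lambda>u. norm (eta_kernel L j u t)) \<le> lnorm s (Ugrid j) (\<lambda>u. norm (Kpi L j (t - node j u)) + b u)"
      using s norm_triangle_ineq4 by (intro lnorm_mono) (auto simp: eta_kernel_def b_def)
    also have "\<dots> \<le> lnorm s (Ugrid j) (\<lambda>u. norm (Kpi L j (t - node j u))) + lnorm s (Ugrid j) b"
      using s by (intro lnorm_add) (auto simp: b_def)
    also have "\<dots> \<le> C + C"
    proof (intro add_mono C)
      show "lnorm s (Ugrid j) b \<le> C"
      proof (cases "j \<ge> 1")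
        case True
        have "(\<Sum>u\<in>Ugrid j. b u powr s) = (\<Sum>u\<in>Ugrid j. if even u then norm (Kpi L (j - 1) (t - node j u)) powr s else 0)"
          by (rule sum.cong) (use True in \<open>auto simp: b_def\<close>)
        also have "\<dots> = (\<Sum>u\<in>Ugrid (j - 1). norm (Kpi L (j - 1) (t - node (j - 1) u)) powr s)"
          by (rule sum_even_Ugrid[OF True])
        finally show ?thesis using C(2)[of "j - 1" t] by (simp add: lnorm_def)
      next
        case False
        then show ?thesis using C(1) by (simp add: lnorm_def b_def)
      qed
    qed
    finally show "lnorm s (Ugrid j) (\<lambda>u. norm (eta_kernel L j u t)) \<le> C + C" .
  qed (use C in auto)
qed

text \<open>The image of the exponential of frequency \<open>k\<close> under \<open>etaop L j\<close>.\<close>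

definition mode_response :: "nat \<Rightarrow> nat \<Rightarrow> int \<Rightarrow> real \<Rightarrow> complex" where
  "mode_response L j k t = (\<Sum>u\<in>Ugrid j. cis (k * node j u) * eta_kernel L j u t)"

lemma mode_response_diff:
  "j \<ge> 1 \<Longrightarrow> mode_response L j k t = (\<Sum>u\<in>Ugrid j. cis (k * node j u) * Kpi L j (t - node j u))
    - (\<Sum>u\<in>Ugrid (j - 1). cis (k * node (j - 1) u) * Kpi L (j - 1) (t - node (j - 1) u))"
  unfolding mode_response_def by (rule sum_eta_kernel)

text \<open>Both interpolation levels in the difference already reproduce the exponential.\<close>

lemma mode_response_zero:
  assumes "1 \<le> L" "\<bar>k\<bar> * 2 ^ (L + 1) \<le> 2 ^ l" "l < j"
  shows "mode_response L j k t = 0"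
proof -
  have "(2::int) ^ l \<le> 2 ^ (j - 1)" "(2::int) ^ l \<le> 2 ^ j" using assms(3) by (auto intro!: power_increasing)
  then have "\<bar>k\<bar> * 2 ^ (L + 1) \<le> 2 ^ (j - 1)" "\<bar>k\<bar> * 2 ^ (L + 1) \<le> 2 ^ j" using assms(2) by linarith+
  then show ?thesis using assms by (subst mode_response_diff) (auto simp: interpolation_reproduce simp del: power_Suc)
qed

text \<open>The differences telescope to interpolation at level \<open>l\<close>.\<close>

lemma mode_response_sum:
  assumes "1 \<le> L" "\<bar>k\<bar> * 2 ^ (L + 1) \<le> 2 ^ l"
  shows "(\<Sum>j\<le>l. mode_response L j k t) = cis (k * t)"
proof -
  have "(\<Sum>j\<le>n. mode_response L j k t) = (\<Sum>u\<in>Ugrid n. cis (k * node n u) * Kpi L n (t - node n u))" for n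
  proof (induction n)
    case 0 show ?case by (simp add: mode_response_def eta_kernel_def)
  next
    case (Suc n) then show ?case by (simp add: mode_response_diff)
  qed
  then show ?thesis using interpolation_reproduce[OF assms] by simp
qed

section \<open>Tensor products and their action on trigonometric polynomials\<close>

definition qpt :: "nat \<Rightarrow> (nat \<Rightarrow> nat) \<Rightarrow> (nat \<Rightarrow> int) \<Rightarrow> (nat \<Rightarrow> real) \<Rightarrow> nat \<Rightarrow> real" where
  "qpt d jj u x = (\<lambda>i. if i < d then node (jj i) (u i) else x i)"

lemma qop_formula:
  "qop d L jj f x = (\<Sum>u\<in>PiE {..<d} (\<lambda>i. Ugrid (jj i)). f (qpt d jj u x) * (\<Prod>i<d. eta_kernel L (jj i) (u i) (x i)))"
proof (induction d arbitrary: f)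
  case 0
  show ?case by (simp add: qop_def qpt_def)
next
  case (Suc d)
  have "qop (Suc d) L jj f x = qop d L jj (etaop L (jj d) d f) x"
    by (simp add: qop_def)
  also have "\<dots> = (\<Sum>u\<in>PiE {..<d} (\<lambda>i. Ugrid (jj i)). (\<Sum>w\<in>Ugrid (jj d). f ((qpt d jj u x)(d := node (jj d) w)) * eta_kernel L (jj d) w (x d)) * (\<Prod>i<d. eta_kernel L (jj i) (u i) (x i)))"
    unfolding Suc.IH etaop_formula by (simp add: qpt_def)
  also have "\<dots> = (\<Sum>w\<in>Ugrid (jj d). \<Sum>u\<in>PiE {..<d} (\<lambda>i. Ugrid (jj i)). f (qpt (Suc d) jj (u(d := w)) x) * (\<Prod>i<Suc d. eta_kernel L (jj i) ((u(d := w)) i) (x i)))"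
  proof -
    have "(qpt d jj u x)(d := node (jj d) w) = qpt (Suc d) jj (u(d := w)) x" for u w
      by (auto simp: qpt_def fun_eq_iff)
    then show ?thesis unfolding sum_distrib_right
      by (subst sum.swap) (simp add: mult_ac)
  qed
  also have "\<dots> = (\<Sum>u\<in>PiE {..<Suc d} (\<lambda>i. Ugrid (jj i)). f (qpt (Suc d) jj u x) * (\<Prod>i<Suc d. eta_kernel L (jj i) (u i) (x i)))"
    unfolding sum_PiE_Suc ..
  finally show ?case .
qed

lemma qop_texp: "qop d L jj (texp d k) x = (\<Prod>i<d. mode_response L (jj i) (k i) (x i))"
proof -
  have "qop d L jj (texp d k) x = (\<Sum>u\<in>PiE {..<d} (\<lambda>i. Ugrid (jj i)). \<Prod>i<d. cis (k i * node (jj i) (u i)) * eta_kernel L (jj i) (u i) (x i))"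
    unfolding qop_formula texp_prod prod.distrib by (simp add: qpt_def)
  also have "\<dots> = (\<Prod>i<d. mode_response L (jj i) (k i) (x i))"
    unfolding mode_response_def by (subst prod_sum_PiE) auto
  finally show ?thesis .
qed

lemma qop_sum: "qop d L jj (\<lambda>y. \<Sum>k\<in>K. c k * h k y) x = (\<Sum>k\<in>K. c k * qop d L jj (h k) x)"
  unfolding qop_formula sum_distrib_left sum_distrib_right by (subst sum.swap) (simp add: mult.assoc)

lemma has_sum_finite_sum:
  fixes f :: "'a \<Rightarrow> 'i \<Rightarrow> 'b::topological_comm_monoid_add"
  assumes "\<And>a. a \<in> A \<Longrightarrow> (f a has_sum S a) I"
  shows "((\<lambda>j. \<Sum>a\<in>A. f a j) has_sum (\<Sum>a\<in>A. S a)) I"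
  using assms by (induction A rule: infinite_finite_induct) (auto intro: has_sum_add has_sum_0)

definition ibox :: "nat \<Rightarrow> (nat \<Rightarrow> nat) \<Rightarrow> (nat \<Rightarrow> nat) set" where
  "ibox d l = {jj \<in> multi_idx d. \<forall>i<d. jj i \<le> l i}"

text \<open>Multi-indices are padded with 0 beyond \<open>d\<close>, elements of \<open>PiE\<close>
  with \<open>undefined\<close>. Restriction translates between the two so that sums of products
  factorise.\<close>

lemma ibox_bij: "bij_betw (\<lambda>jj. restrict jj {..<d}) (ibox d l) (PiE {..<d} (\<lambda>i. {..l i}))"
proof (rule bij_betw_byWitness[where f'="\<lambda>v i. if i < d then v i else 0"])
  show "\<forall>a\<in>ibox d l. (\<lambda>i. if i < d then restrict a {..<d} i else 0) = a"
    by (auto simp: ibox_def multi_idx_def fun_eq_iff)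
  show "\<forall>a'\<in>PiE {..<d} (\<lambda>i. {..l i}). restrict (\<lambda>i. if i < d then a' i else 0) {..<d} = a'"
    by (auto simp: fun_eq_iff PiE_def extensional_def)
  show "(\<lambda>jj. restrict jj {..<d}) ` ibox d l \<subseteq> PiE {..<d} (\<lambda>i. {..l i})"
    by (intro image_subsetI) (simp add: restrict_PiE_iff ibox_def)
  show "(\<lambda>v i. if i < d then v i else 0) ` PiE {..<d} (\<lambda>i. {..l i}) \<subseteq> ibox d l"
    by (intro image_subsetI) (simp add: ibox_def multi_idx_def PiE_iff)
qed

lemma finite_ibox [simp]: "finite (ibox d l)"
  using bij_betw_finite[OF ibox_bij[of d l]] by (auto intro: finite_PiE)

lemma sum_ibox_prod:
  fixes F :: "nat \<Rightarrow> nat \<Rightarrow> 'b::comm_semiring_1"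
  shows "(\<Sum>jj\<in>ibox d l. \<Prod>i<d. F i (jj i)) = (\<Prod>i<d. \<Sum>j\<le>l i. F i j)"
proof -
  have "(\<Sum>jj\<in>ibox d l. \<Prod>i<d. F i (jj i)) = (\<Sum>v\<in>PiE {..<d} (\<lambda>i. {..l i}). \<Prod>i<d. F i (v i))"
    by (subst sum.reindex_bij_betw[OF ibox_bij, symmetric]) simp
  then show ?thesis by (subst prod_sum_PiE) auto
qed

lemma trigpoly_mono: "trigpoly d N g \<Longrightarrow> (\<And>i. i < d \<Longrightarrow> N i \<le> N' i) \<Longrightarrow> trigpoly d N' g"
proof -
  assume "trigpoly d N g" and N: "\<And>i. i < d \<Longrightarrow> N i \<le> N' i"
  then obtain K c where "finite K" "\<forall>k\<in>K. \<forall>i<d. \<bar>k i\<bar> \<le> N i" "g = (\<lambda>x. \<Sum>k\<in>K. c k * texp d k x)"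
    unfolding trigpoly_def by blast
  moreover from this N have "\<forall>k\<in>K. \<forall>i<d. \<bar>k i\<bar> \<le> N' i" by (meson order_trans)
  ultimately show "trigpoly d N' g" unfolding trigpoly_def by blast
qed

lemma trigpoly_cong:
  assumes "trigpoly d N g" "\<And>i. i < d \<Longrightarrow> x i = y i"
  shows "g x = g y"
proof -
  from assms(1) obtain K c where "g = (\<lambda>x. \<Sum>k\<in>K. c k * texp d k x)" unfolding trigpoly_def by blast
  then show ?thesis using assms(2) by (simp add: texp_def)
qed

text \<open>The frequencies satisfy \<open>\<bar>k i\<bar> * 2 ^ (L + 1) \<le> 2 ^ l i\<close>, so
  in coordinate \<open>i\<close> all responses above \<open>l i\<close> vanish and those up to
  \<open>l i\<close> add up to the exponential. Both facts pass to products over the coordinates and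
  to linear combinations.\<close>

lemma
  assumes L: "1 \<le> L" and l: "\<And>i. i < d \<Longrightarrow> L + 1 \<le> l i"
    and g: "trigpoly d (\<lambda>i. 2 ^ (l i - (L + 1))) g"
  shows qop_trigpoly_zero: "\<And>i. i < d \<Longrightarrow> l i < jj i \<Longrightarrow> qop d L jj g x = 0"
    and qop_trigpoly_sum: "(\<Sum>jj\<in>ibox d l. qop d L jj g x) = g x"
proof -
  obtain K c where K: "finite K" "\<And>k i. k \<in> K \<Longrightarrow> i < d \<Longrightarrow> \<bar>k i\<bar> \<le> 2 ^ (l i - (L + 1))" and g: "g = (\<lambda>x. \<Sum>k\<in>K. c k * texp d k x)"
    using g unfolding trigpoly_def by blast
  have K2: "\<bar>k i\<bar> * 2 ^ (L + 1) \<le> 2 ^ l i" if "k \<in> K" "i < d" for k i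
  proof -
    have "\<bar>k i\<bar> * 2 ^ (L + 1) \<le> 2 ^ (l i - (L + 1)) * 2 ^ (L + 1)" using K(2)[OF that] by (rule mult_right_mono) simp
    also have "\<dots> = 2 ^ (l i - (L + 1) + (L + 1))" by (rule power_add[symmetric])
    also have "l i - (L + 1) + (L + 1) = l i" using l[OF that(2)] by simp
    finally show ?thesis .
  qed
  show "qop d L jj g x = 0" if "i < d" "l i < jj i" for i
  proof -
    have "(\<Prod>i<d. mode_response L (jj i) (k i) (x i)) = 0" if "k \<in> K" for k
      using mode_response_zero[OF L K2[OF that \<open>i < d\<close>] \<open>l i < jj i\<close>] \<open>i < d\<close> by (intro prod_zero) auto
    then show ?thesis unfolding g qop_sum qop_texp by (intro sum.neutral ballI) (simp only: mult_zero_right)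
  qed
  show "(\<Sum>jj\<in>ibox d l. qop d L jj g x) = g x"
  proof -
    have "(\<Sum>jj\<in>ibox d l. qop d L jj g x) = (\<Sum>k\<in>K. c k * (\<Sum>jj\<in>ibox d l. \<Prod>i<d. mode_response L (jj i) (k i) (x i)))"
      unfolding g qop_sum qop_texp sum_distrib_left by (rule sum.swap)
    also have "\<dots> = (\<Sum>k\<in>K. c k * texp d k x)"
    proof (rule sum.cong[OF refl])
      fix k assume k: "k \<in> K"
      have "(\<Sum>jj\<in>ibox d l. \<Prod>i<d. mode_response L (jj i) (k i) (x i)) = (\<Prod>i<d. \<Sum>j\<le>l i. mode_response L j (k i) (x i))"
        by (rule sum_ibox_prod[of "\<lambda>i j. mode_response L j (k i) (x i)"])
      also have "\<dots> = texp d k x"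
        unfolding texp_prod by (rule prod.cong) (use mode_response_sum[OF L K2[OF k]] in auto)
      finally show "c k * (\<Sum>jj\<in>ibox d l. \<Prod>i<d. mode_response L (jj i) (k i) (x i)) = c k * texp d k x" by simp
    qed
    finally show ?thesis by (simp add: g)
  qed
qed

text \<open>The nodes of level \<open>jj i\<close> form part of the grid of level
  \<open>l i\<close>, and \<tau> is the injective embedding of indices. The condition
  \<open>1 \<le> l i\<close> is needed for the node 0 of level 0, which belongs to the grids only
  from level 1 on.\<close>

lemma lnorm_grid_mono:
  assumes k: "\<And>i. i < d \<Longrightarrow> jj i \<le> l i" and l: "\<And>i. i < d \<Longrightarrow> 1 \<le> l i" and s: "s > 0"
    and dep: "\<And>x y. (\<And>i. i < d \<Longrightarrow> x i = y i) \<Longrightarrow> g x = g y"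
  shows "lnorm s (PiE {..<d} (\<lambda>i. Ugrid (jj i))) (\<lambda>u. norm (g (qpt d jj u x))) \<le> lnorm s (dgrid d l) (\<lambda>n. norm (g (gpt l n)))"
proof -
  define \<tau> where "\<tau> i u = nat (u * 2 ^ (l i - jj i) + 2 ^ (l i - 1))" for i u
  have \<tau>: "\<tau> i u < 2 ^ l i" "pt (l i) (\<tau> i u) = node (jj i) u" "int (\<tau> i u) = u * 2 ^ (l i - jj i) + 2 ^ (l i - 1)"
    if i: "i < d" and u: "u \<in> Ugrid (jj i)" for i u
  proof -
    have pl: "(2::int) ^ l i = 2 * 2 ^ (l i - 1)" using l[OF i] by (cases "l i") auto
    have "- (2 ^ (l i - 1)) \<le> u * 2 ^ (l i - jj i) \<and> u * 2 ^ (l i - jj i) < 2 ^ (l i - 1)"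
    proof (cases "jj i = 0")
      case True then show ?thesis using u by (simp add: Ugrid_def)
    next
      case False
      then have u': "- (2 ^ (jj i - 1)) \<le> u" "u < 2 ^ (jj i - 1)" using u by (auto simp: Ugrid_def)
      have p: "(2::int) ^ (l i - 1) = 2 ^ (jj i - 1) * 2 ^ (l i - jj i)"
        using False k[OF i] by (simp flip: power_add)
      show ?thesis unfolding p using u' mult_right_mono[of "- (2 ^ (jj i - 1))" u "2 ^ (l i - jj i)"] by simp
    qed
    then show t3: "int (\<tau> i u) = u * 2 ^ (l i - jj i) + 2 ^ (l i - 1)" and "\<tau> i u < 2 ^ l i"
      unfolding \<tau>_def by (auto simp: nat_less_iff pl)
    have r: "real (\<tau> i u) = real_of_int u * 2 ^ (l i - jj i) + 2 ^ (l i - 1)"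
      using arg_cong[OF t3, of real_of_int] by simp
    have q: "(2::real) ^ l i = 2 ^ jj i * 2 ^ (l i - jj i)" using k[OF i] by (simp flip: power_add)
    have q': "(2::real) ^ l i = 2 * 2 ^ (l i - 1)" using l[OF i] by (cases "l i") auto
    have "pt (l i) (\<tau> i u) = - pi + 2 * pi * (real_of_int u * 2 ^ (l i - jj i)) / 2 ^ l i + 2 * pi * 2 ^ (l i - 1) / 2 ^ l i"
      by (simp add: pt_def r field_simps)
    also have "2 * pi * 2 ^ (l i - 1) / 2 ^ l i = pi" unfolding q' by simp
    also have "2 * pi * (real_of_int u * 2 ^ (l i - jj i)) / 2 ^ l i = node (jj i) u" unfolding q node_def by simp
    finally show "pt (l i) (\<tau> i u) = node (jj i) u" by simp
  qed
  define T where "T u = restrict (\<lambda>i. \<tau> i (u i)) {..<d}" for u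
  let ?P = "PiE {..<d} (\<lambda>i. Ugrid (jj i))"
  have Tm: "T u \<in> dgrid d l" if "u \<in> ?P" for u
    using that \<tau>(1) by (auto simp: T_def dgrid_def)
  have inj: "inj_on T ?P"
  proof (rule inj_onI)
    fix u v assume u: "u \<in> ?P" and v: "v \<in> ?P" and eq: "T u = T v"
    show "u = v"
    proof (rule PiE_ext[OF u v])
      fix i assume i: "i \<in> {..<d}"
      have eqi: "\<tau> i (u i) = \<tau> i (v i)" using fun_cong[OF eq, of i] i by (simp add: T_def)
      have "i < d" "u i \<in> Ugrid (jj i)" "v i \<in> Ugrid (jj i)" using u v i by (auto dest: PiE_mem)
      then have "u i * 2 ^ (l i - jj i) + 2 ^ (l i - 1) = v i * 2 ^ (l i - jj i) + 2 ^ (l i - 1)"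
        by (simp only: \<tau>(3)[symmetric] eqi)
      then show "u i = v i" by simp
    qed
  qed
  have "(\<Sum>u\<in>?P. norm (g (qpt d jj u x)) powr s) = (\<Sum>u\<in>?P. norm (g (gpt l (T u))) powr s)"
  proof (rule sum.cong)
    fix u assume u: "u \<in> ?P"
    have "g (qpt d jj u x) = g (gpt l (T u))"
      by (rule dep) (use u \<tau>(2) in \<open>auto simp: qpt_def gpt_def T_def dest: PiE_mem\<close>)
    then show "norm (g (qpt d jj u x)) powr s = norm (g (gpt l (T u))) powr s" by simp
  qed simp
  also have "\<dots> = (\<Sum>n\<in>T ` ?P. norm (g (gpt l n)) powr s)" by (simp add: sum.reindex[OF inj])
  also have "\<dots> \<le> (\<Sum>n\<in>dgrid d l. norm (g (gpt l n)) powr s)"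
    by (rule sum_mono2) (use Tm in auto)
  finally show ?thesis unfolding lnorm_def
    by (rule powr_mono2[rotated 2]) (simp_all add: sum_nonneg s less_imp_le)
qed

text \<open>Hoelder separates the samples from the kernels; the kernel norm factorises over the
  coordinates, and each factor is bounded uniformly in the level. All \<open>jj\<close> below the
  same \<open>l\<close> are controlled by one and the same sample norm, that of the grid of level
  \<open>l\<close>.\<close>

lemma qop_bound:
  fixes q :: real
  assumes L: "1 \<le> L" and q: "q > 1"
  obtains C where "C > 0" "\<And>jj l g x. (\<And>i. i < d \<Longrightarrow> jj i \<le> l i) \<Longrightarrow> (\<And>i. i < d \<Longrightarrow> 1 \<le> l i) \<Longrightarrow>
     (\<And>x y. (\<forall>i<d. x i = y i) \<Longrightarrow> g x = g y) \<Longrightarrow>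
     norm (qop d L jj g x) \<le> C * lnorm q (dgrid d l) (\<lambda>n. norm (g (gpt l n)))"
proof -
  define s where "s = q / (q - 1)"
  have s: "s > 1" "1/q + 1/s = 1" using q by (auto simp: s_def field_simps)
  obtain C where C: "C > 0" "\<And>j t. lnorm s (Ugrid j) (\<lambda>u. norm (eta_kernel L j u t)) \<le> C"
    using eta_kernel_bound[OF L s(1)] by blast
  show ?thesis
  proof (rule that)
    show "C ^ d > 0" using C by simp
    fix jj l :: "nat \<Rightarrow> nat" and g :: "(nat \<Rightarrow> real) \<Rightarrow> complex" and x
    assume k: "\<And>i. i < d \<Longrightarrow> jj i \<le> l i" and l: "\<And>i. i < d \<Longrightarrow> 1 \<le> l i"
      and dep: "\<And>x y. (\<forall>i<d. x i = y i) \<Longrightarrow> g x = g y"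
    let ?P = "PiE {..<d} (\<lambda>i. Ugrid (jj i))"
    have fP: "finite ?P" by (rule finite_PiE) auto
    have "norm (qop d L jj g x) \<le> (\<Sum>u\<in>?P. norm (g (qpt d jj u x)) * (\<Prod>i<d. norm (eta_kernel L (jj i) (u i) (x i))))"
      unfolding qop_formula by (rule order_trans[OF norm_sum]) (simp only: norm_mult prod_norm order_refl)
    also have "\<dots> \<le> lnorm q ?P (\<lambda>u. norm (g (qpt d jj u x))) * lnorm s ?P (\<lambda>u. \<Prod>i<d. norm (eta_kernel L (jj i) (u i) (x i)))"
      unfolding lnorm_def by (rule holder_sum) (simp_all add: fP q s prod_nonneg)
    also have "lnorm s ?P (\<lambda>u. \<Prod>i<d. norm (eta_kernel L (jj i) (u i) (x i))) = (\<Prod>i<d. lnorm s (Ugrid (jj i)) (\<lambda>u. norm (eta_kernel L (jj i) u (x i))))"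
    proof -
      have "(\<Sum>u\<in>?P. (\<Prod>i<d. norm (eta_kernel L (jj i) (u i) (x i))) powr s) = (\<Prod>i<d. \<Sum>u\<in>Ugrid (jj i). norm (eta_kernel L (jj i) u (x i)) powr s)"
        by (subst prod_sum_PiE) (auto simp: prod_powr_distrib)
      then show ?thesis by (simp add: lnorm_def prod_powr_distrib sum_nonneg)
    qed
    also have "\<dots> \<le> (\<Prod>i<d. C)" by (intro prod_mono conjI C lnorm_nonneg)
    also have "lnorm q ?P (\<lambda>u. norm (g (qpt d jj u x))) \<le> lnorm q (dgrid d l) (\<lambda>n. norm (g (gpt l n)))"
      by (rule lnorm_grid_mono) (use k l q dep in auto)
    finally show "norm (qop d L jj g x) \<le> C ^ d * lnorm q (dgrid d l) (\<lambda>n. norm (g (gpt l n)))"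
      using C by (simp add: mult_left_mono mult_right_mono mult.commute)
  qed
qed

section \<open>Sums over hyperbolic layers\<close>

lemma geometric_sum_le:
  fixes q :: real
  assumes "0 \<le> q" "q < 1"
  shows "(\<Sum>t\<le>n. q ^ t) \<le> 1 / (1 - q)"
proof -
  have "(\<Sum>t\<le>n. q ^ t) = (1 - q ^ Suc n) / (1 - q)"
    using assms sum_gp_basic[of q n] by (simp add: eq_divide_eq mult.commute)
  also have "\<dots> \<le> 1 / (1 - q)" using assms by (intro divide_right_mono) auto
  finally show ?thesis .
qed

lemma powr_geometric_sum_le:
  fixes a :: real
  assumes "a > 0"
  shows "(\<Sum>t\<le>n. 2 powr (- a * real t)) \<le> 1 / (1 - 2 powr (- a))"
proof -
  have "2 powr (- a * real t) = (2 powr (- a)) ^ t" for t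
    by (simp add: powr_realpow[symmetric] powr_powr)
  moreover have "2 powr (- a) < 1" using assms by (simp add: powr_less_one)
  ultimately show ?thesis using geometric_sum_le[of "2 powr (- a)" n] by simp
qed

text \<open>The sum is geometric from its first admissible index \<open>t0\<close>, and there the
  exponent \<open>a * t0 + s\<close> is at least \<open>max 0 s - c\<close>: for
  \<open>s \<ge> 0\<close> trivially, otherwise by admissibility.\<close>

lemma shifted_geometric_sum_le:
  fixes a \<beta> c s :: real
  assumes a: "a > 0" and \<beta>: "\<beta> > 0" and c: "c \<ge> 0"
  shows "(\<Sum>t\<le>n. if a * real t + s > - c then 2 powr (- \<beta> * (a * real t + s)) else 0)
     \<le> 2 powr (\<beta> * c) / (1 - 2 powr (- (\<beta> * a))) * 2 powr (- \<beta> * max 0 s)"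
proof -
  define q where "q = 2 powr (- (\<beta> * a))"
  have q: "0 < q" "q < 1" using a \<beta> by (auto simp: q_def powr_less_one)
  define T where "T = {t. t \<le> n \<and> a * real t + s > - c}"
  have fT: "finite T" unfolding T_def by auto
  have eq: "(\<Sum>t\<le>n. if a * real t + s > - c then 2 powr (- \<beta> * (a * real t + s)) else 0) = (\<Sum>t\<in>T. 2 powr (- \<beta> * (a * real t + s)))"
    unfolding T_def using sum.inter_filter[of "{..n}" "\<lambda>t. 2 powr (- \<beta> * (a * real t + s))" "\<lambda>t. a * real t + s > - c"] by simp
  show ?thesis
  proof (cases "T = {}")
    case True
    then show ?thesis unfolding eq using q by (simp add: q_def)
  next
    case False
    define t0 where "t0 = Min T"
    have t0: "t0 \<in> T" "\<And>t. t \<in> T \<Longrightarrow> t0 \<le> t" unfolding t0_def using fT False by auto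
    have "(\<Sum>t\<in>T. 2 powr (- \<beta> * (a * real t + s))) \<le> (\<Sum>t\<in>(\<lambda>k. t0 + k) ` {..n}. 2 powr (- \<beta> * (a * real t + s)))"
    proof (rule sum_mono2)
      show "T \<subseteq> (\<lambda>k. t0 + k) ` {..n}"
      proof
        fix t assume "t \<in> T"
        then have "t = t0 + (t - t0)" "t - t0 \<le> n" using t0(2)[of t] by (auto simp: T_def)
        then show "t \<in> (\<lambda>k. t0 + k) ` {..n}" by blast
      qed
    qed auto
    also have "\<dots> = (\<Sum>k\<le>n. 2 powr (- \<beta> * (a * real t0 + s)) * 2 powr (- (\<beta> * a) * real k))"
      by (subst sum.reindex) (auto simp: inj_on_def algebra_simps simp flip: powr_add)
    also have "\<dots> = 2 powr (- \<beta> * (a * real t0 + s)) * (\<Sum>k\<le>n. 2 powr (- (\<beta> * a) * real k))"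
      by (rule sum_distrib_left[symmetric])
    also have "\<dots> \<le> 2 powr (- \<beta> * (a * real t0 + s)) * (1 / (1 - q))"
      unfolding q_def using a \<beta> by (intro mult_left_mono powr_geometric_sum_le) auto
    also have "2 powr (- \<beta> * (a * real t0 + s)) \<le> 2 powr (\<beta> * c) * 2 powr (- \<beta> * max 0 s)"
    proof -
      have "max 0 s - c \<le> a * real t0 + s"
      proof (cases "s \<ge> 0")
        case True
        have "0 \<le> a * real t0" using a by simp
        then show ?thesis using True c by simp
      next
        case False
        then show ?thesis using t0(1) by (simp add: T_def)
      qed
      then have "\<beta> * (max 0 s - c) \<le> \<beta> * (a * real t0 + s)" using \<beta> by (intro mult_left_mono) auto
      then have "- \<beta> * (a * real t0 + s) \<le> \<beta> * c + (- \<beta> * max 0 s)" by (simp add: algebra_simps)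
      then have "2 powr (- \<beta> * (a * real t0 + s)) \<le> 2 powr (\<beta> * c + (- \<beta> * max 0 s))" by (rule powr_mono) simp
      then show ?thesis by (simp only: powr_add)
    qed
    finally show ?thesis unfolding eq q_def[symmetric] using q by (simp add: mult_ac divide_right_mono)
  qed
qed

text \<open>The terms with \<open>t < m\<close> equal 1 and number at most \<open>m\<close>; the
  rest is a geometric tail, absorbed because \<open>m \<ge> 1\<close>.\<close>

lemma truncated_geometric_sum_le:
  fixes a :: real
  assumes a: "a > 0" and m: "m \<ge> 1"
  shows "(\<Sum>t\<le>n. 2 powr (- a * max 0 (real t - real m))) \<le> (1 + 1 / (1 - 2 powr (- a))) * real m"
proof -
  have q: "2 powr (- a) < 1" using a by (simp add: powr_less_one)
  have "(\<Sum>t\<le>n. 2 powr (- a * max 0 (real t - real m))) \<le> (\<Sum>t\<in>{..<m} \<union> (\<lambda>k. m + k) ` {..n}. 2 powr (- a * max 0 (real t - real m)))"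
  proof (rule sum_mono2)
    show "{..n} \<subseteq> {..<m} \<union> (\<lambda>k. m + k) ` {..n}"
    proof
      fix t assume "t \<in> {..n}"
      then show "t \<in> {..<m} \<union> (\<lambda>k. m + k) ` {..n}"
        by (cases "t < m") (auto intro!: image_eqI[of _ _ "t - m"])
    qed
  qed auto
  also have "\<dots> = (\<Sum>t<m. 2 powr (- a * max 0 (real t - real m))) + (\<Sum>k\<le>n. 2 powr (- a * real k))"
    by (subst sum.union_disjoint) (auto simp: sum.reindex inj_on_def)
  also have "(\<Sum>t<m. 2 powr (- a * max 0 (real t - real m))) = real m" by simp
  also have "(\<Sum>k\<le>n. 2 powr (- a * real k)) \<le> 1 / (1 - 2 powr (- a)) * real m"
    using powr_geometric_sum_le[OF a, of n] m q
    by (smt (verit, best) divide_nonneg_nonneg mult_le_cancel_left1 of_nat_1 of_nat_le_iff)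
  finally show ?thesis by (simp add: distrib_right)
qed

text \<open>The sum over \<open>v 0\<close> is geometric and leaves \<open>2 powr (- \<beta> * max 0 s)\<close>, where \<open>s\<close> is the excess of the
  remaining coordinates; its decay is distributed evenly over the coordinates below \<open>\<mu>\<close>. Each of the
  \<open>\<mu> - 1\<close> coordinates left there contributes a factor of order \<open>m\<close>.\<close>

lemma hyperbolic_layer_sum:
  fixes a \<beta> c :: real and \<eta> \<sigma> :: "nat \<Rightarrow> real"
  assumes \<mu>: "1 \<le> \<mu>" "\<mu> \<le> d" and a: "a > 0" and \<beta>: "\<beta> > 0" and c: "c \<ge> 0"
    and \<eta>: "\<And>i. i < d \<Longrightarrow> \<eta> i > 0" "\<And>i. i < \<mu> \<Longrightarrow> \<eta> i = a"
    and \<sigma>: "\<And>i. i < \<mu> \<Longrightarrow> \<sigma> i = 0" "\<And>i. \<mu> \<le> i \<Longrightarrow> i < d \<Longrightarrow> \<sigma> i > 0"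
  obtains C where "C > 0" "\<And>m n. m \<ge> 1 \<Longrightarrow>
    (\<Sum>v\<in>PiE {..<d} (\<lambda>_. {..n}). if (\<Sum>i<d. \<eta> i * real (v i)) - a * real m > - c
       then 2 powr (- \<beta> * ((\<Sum>i<d. \<eta> i * real (v i)) - a * real m)) * 2 powr (- (\<Sum>i<d. \<sigma> i * real (v i))) else 0)
     \<le> C * real m ^ (\<mu> - 1)"
proof -
  define K where "K = 2 powr (\<beta> * c) / (1 - 2 powr (- (\<beta> * a)))"
  have "2 powr (- (\<beta> * a)) < 1" using a \<beta> by (simp add: powr_less_one)
  then have K: "K > 0" by (simp add: K_def)
  \<comment> \<open>The decay is shared by \<open>\<mu> - 1\<close> coordinates. Dividing by
    \<open>d\<close> instead also makes sense when \<open>\<mu> - 1\<close> is 0, and is enough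
    since \<open>\<mu> - 1 \<le> d\<close>.\<close>
  define b where "b = \<beta> * a / d"
  have d: "d \<ge> 1" using \<mu> by simp
  have b: "b > 0" using a \<beta> d by (simp add: b_def)
  define D where "D i = (if i < \<mu> then 1 + 1 / (1 - 2 powr (- b)) else 1 / (1 - 2 powr (- \<sigma> i)))" for i
  have D: "D i > 0" if "i < d" for i
  proof -
    have "2 powr (- b) < 1" using b by (simp add: powr_less_one)
    moreover have "2 powr (- \<sigma> i) < 1" if "\<not> i < \<mu>" using \<sigma>(2)[of i] that \<open>i < d\<close> by (simp add: powr_less_one)
    ultimately show ?thesis by (auto simp: D_def add_pos_pos)
  qed
  define g where "g m i t = (if i < \<mu> then 2 powr (- b * max 0 (real t - real m)) else 2 powr (- \<sigma> i * real t))" for m i t :: nat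
  have g: "(\<Sum>t\<le>n. g m i t) \<le> D i * (if i < \<mu> then real m else 1)" if "i < d" "m \<ge> 1" for m n i
    using truncated_geometric_sum_le[OF b that(2), of n] powr_geometric_sum_le[OF \<sigma>(2), of i n] that
    by (auto simp: g_def D_def)
  have g0: "g m i t \<ge> 0" for m i t by (simp add: g_def)
  have set: "{..<d} = insert 0 {1..<d}" using d by auto
  show ?thesis
  proof (rule that)
    show "K * (\<Prod>i\<in>{1..<d}. D i) > 0" using K D by (intro mult_pos_pos prod_pos) auto
    fix m n :: nat assume m: "m \<ge> 1"
    define W where "W v = (if (\<Sum>i<d. \<eta> i * real (v i)) - a * real m > - c
       then 2 powr (- \<beta> * ((\<Sum>i<d. \<eta> i * real (v i)) - a * real m)) * 2 powr (- (\<Sum>i<d. \<sigma> i * real (v i))) else 0)" for v :: "nat \<Rightarrow> nat"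
    have inner: "(\<Sum>t\<le>n. W (v(0 := t))) \<le> K * (\<Prod>i\<in>{1..<d}. g m i (v i))" for v
    proof -
      define s where "s = (\<Sum>i\<in>{1..<d}. \<eta> i * real (v i)) - a * real m"
      define z where "z = (\<Sum>i\<in>{1..<d}. \<sigma> i * real (v i))"
      have e: "(\<Sum>i<d. \<eta> i * real ((v(0 := t)) i)) - a * real m = a * real t + s"
        "(\<Sum>i<d. \<sigma> i * real ((v(0 := t)) i)) = z" for t
        unfolding set s_def z_def using \<eta>(2)[of 0] \<sigma>(1)[of 0] \<mu> by (auto intro!: sum.cong)
      have "(\<Sum>t\<le>n. W (v(0 := t))) = (\<Sum>t\<le>n. if a * real t + s > - c then 2 powr (- \<beta> * (a * real t + s)) else 0) * 2 powr (- z)"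
        unfolding W_def e sum_distrib_right by (intro sum.cong) auto
      also have "\<dots> \<le> (K * 2 powr (- \<beta> * max 0 s)) * 2 powr (- z)"
        unfolding K_def by (intro mult_right_mono shifted_geometric_sum_le a \<beta> c) auto
      also have "\<dots> \<le> K * (\<Prod>i\<in>{1..<d}. g m i (v i))"
      proof -
        have lo: "(\<Sum>i\<in>{1..<\<mu>}. b * max 0 (real (v i) - real m)) \<le> \<beta> * max 0 s"
        proof -
          have "b * max 0 (real (v i) - real m) \<le> \<beta> / d * max 0 s" if i: "i \<in> {1..<\<mu>}" for i
          proof -
            have "a * real (v i) \<le> (\<Sum>i\<in>{1..<d}. \<eta> i * real (v i))"
              using i \<mu> \<eta>(2)[of i] member_le_sum[of i "{1..<d}" "\<lambda>i. \<eta> i * real (v i)"] \<eta>(1) by (auto simp: less_imp_le)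
            then have "a * (real (v i) - real m) \<le> s" by (simp add: s_def right_diff_distrib)
            then have "a * max 0 (real (v i) - real m) \<le> max 0 s" by (auto simp: max_def)
            then have "\<beta> / d * (a * max 0 (real (v i) - real m)) \<le> \<beta> / d * max 0 s"
              using \<beta> by (intro mult_left_mono) auto
            then show ?thesis by (simp add: b_def mult_ac)
          qed
          then have "(\<Sum>i\<in>{1..<\<mu>}. b * max 0 (real (v i) - real m)) \<le> (\<Sum>i\<in>{1..<\<mu>}. \<beta> / d * max 0 s)" by (rule sum_mono)
          also have "\<dots> = real (\<mu> - 1) / d * (\<beta> * max 0 s)" by simp
          also have "\<dots> \<le> 1 * (\<beta> * max 0 s)" using \<mu> d \<beta> by (intro mult_right_mono) (auto simp: divide_le_eq)
          finally show ?thesis by simp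
        qed
        have zz: "z = (\<Sum>i\<in>{\<mu>..<d}. \<sigma> i * real (v i))"
          unfolding z_def using \<mu> \<sigma>(1) by (intro sum.mono_neutral_right) auto
        have un: "{1..<d} = {1..<\<mu>} \<union> {\<mu>..<d}" "{1..<\<mu>} \<inter> {\<mu>..<d} = {}" using \<mu> by auto
        have "(\<Prod>i\<in>{1..<d}. g m i (v i)) = (\<Prod>i\<in>{1..<\<mu>}. 2 powr (- (b * max 0 (real (v i) - real m)))) * (\<Prod>i\<in>{\<mu>..<d}. 2 powr (- (\<sigma> i * real (v i))))"
          unfolding un(1) by (subst prod.union_disjoint) (auto simp: un(2) g_def intro!: arg_cong2[where f=times] prod.cong)
        also have "\<dots> = 2 powr (- (\<Sum>i\<in>{1..<\<mu>}. b * max 0 (real (v i) - real m))) * 2 powr (- z)"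
          by (simp add: zz powr_sum flip: sum_negf)
        finally have p: "(\<Prod>i\<in>{1..<d}. g m i (v i)) = 2 powr (- (\<Sum>i\<in>{1..<\<mu>}. b * max 0 (real (v i) - real m))) * 2 powr (- z)" .
        have "2 powr (- \<beta> * max 0 s) \<le> 2 powr (- (\<Sum>i\<in>{1..<\<mu>}. b * max 0 (real (v i) - real m)))"
          using lo by (intro powr_mono) auto
        then show ?thesis unfolding p mult.assoc using K by (intro mult_left_mono mult_right_mono) auto
      qed
      finally show ?thesis .
    qed
    have "(\<Sum>v\<in>PiE {..<d} (\<lambda>_. {..n}). W v) = (\<Sum>v\<in>PiE {1..<d} (\<lambda>_. {..n}). \<Sum>t\<le>n. W (v(0 := t)))"
      unfolding set by (subst sum_PiE_insert) (auto intro: sum.swap)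
    also have "\<dots> \<le> (\<Sum>v\<in>PiE {1..<d} (\<lambda>_. {..n}). K * (\<Prod>i\<in>{1..<d}. g m i (v i)))"
      by (intro sum_mono inner)
    also have "\<dots> = K * (\<Prod>i\<in>{1..<d}. \<Sum>t\<le>n. g m i t)"
      by (subst prod_sum_PiE) (auto simp: sum_distrib_left)
    also have "\<dots> \<le> K * (\<Prod>i\<in>{1..<d}. D i * (if i < \<mu> then real m else 1))"
      using K m g0 by (intro mult_left_mono prod_mono conjI g sum_nonneg) auto
    also have "\<dots> = K * (\<Prod>i\<in>{1..<d}. D i) * real m ^ (\<mu> - 1)"
    proof -
      have "(\<Prod>i\<in>{1..<d}. if i < \<mu> then real m else 1) = (\<Prod>i\<in>{1..<\<mu>}. real m)"
        using \<mu> by (intro prod.mono_neutral_cong_right) auto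
      then show ?thesis by (simp add: prod.distrib)
    qed
    finally show "(\<Sum>v\<in>PiE {..<d} (\<lambda>_. {..n}). if (\<Sum>i<d. \<eta> i * real (v i)) - a * real m > - c
       then 2 powr (- \<beta> * ((\<Sum>i<d. \<eta> i * real (v i)) - a * real m)) * 2 powr (- (\<Sum>i<d. \<sigma> i * real (v i))) else 0)
     \<le> K * (\<Prod>i\<in>{1..<d}. D i) * real m ^ (\<mu> - 1)" unfolding W_def .
  qed
qed

section \<open>The Jawerth embedding for Littlewood-Paley blocks\<close>

definition zbox :: "nat \<Rightarrow> (nat \<Rightarrow> int) \<Rightarrow> (nat \<Rightarrow> int) set" where
  "zbox d N = {k. (\<forall>i\<ge>d. k i = 0) \<and> (\<forall>i<d. \<bar>k i\<bar> \<le> N i)}"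

lemma finite_zbox [simp]: "finite (zbox d N)"
proof (rule finite_subset)
  show "zbox d N \<subseteq> (\<lambda>v i. if i < d then v i else 0) ` PiE {..<d} (\<lambda>i. {- N i..N i})"
  proof
    fix k assume k: "k \<in> zbox d N"
    then have "k = (\<lambda>i. if i < d then restrict k {..<d} i else 0)" by (auto simp: zbox_def fun_eq_iff)
    moreover have "restrict k {..<d} \<in> PiE {..<d} (\<lambda>i. {- N i..N i})"
    proof -
      have "- N i \<le> k i \<and> k i \<le> N i" if "i < d" for i
      proof -
        have "\<bar>k i\<bar> \<le> N i" using k that by (simp add: zbox_def)
        then show ?thesis by linarith
      qed
      then show ?thesis by (simp add: restrict_PiE_iff)
    qed
    ultimately show "k \<in> (\<lambda>v i. if i < d then v i else 0) ` PiE {..<d} (\<lambda>i. {- N i..N i})" by blast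
  qed
qed (auto intro: finite_PiE)

lemma delta_op_eq_sum:
  assumes "\<And>i k. i < d \<Longrightarrow> \<bar>k\<bar> > N i \<Longrightarrow> phi (jj i) (real_of_int k) = 0"
  shows "delta_op phi d jj f = (\<lambda>x. \<Sum>k\<in>zbox d N. (of_real (\<Prod>i<d. phi (jj i) (real_of_int (k i))) * fourier_coeff d f k) * texp d k x)"
proof
  fix x
  have "delta_op phi d jj f x = (\<Sum>\<^sub>\<infinity>k\<in>zbox d N. (of_real (\<Prod>i<d. phi (jj i) (real_of_int (k i))) * fourier_coeff d f k) * texp d k x)"
    unfolding delta_op_def
  proof (rule infsum_cong_neutral)
    fix k assume "k \<in> {k::nat\<Rightarrow>int. \<forall>i\<ge>d. k i = 0} - zbox d N"
    then obtain i where "i < d" "\<bar>k i\<bar> > N i" by (auto simp: zbox_def not_le)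
    then have "(\<Prod>i<d. phi (jj i) (real_of_int (k i))) = 0" using assms by (intro prod_zero) auto
    then show "of_real (\<Prod>i<d. phi (jj i) (real_of_int (k i))) * fourier_coeff d f k * exp (\<i> * of_real (\<Sum>i<d. real_of_int (k i) * x i)) = 0" by simp
  next
    fix k assume "k \<in> zbox d N - {k::nat\<Rightarrow>int. \<forall>i\<ge>d. k i = 0}"
    then show "of_real (\<Prod>i<d. phi (jj i) (real_of_int (k i))) * fourier_coeff d f k * texp d k x = 0" by (auto simp: zbox_def)
  qed (simp add: texp_def cis_conv_exp)
  then show "delta_op phi d jj f x = (\<Sum>k\<in>zbox d N. (of_real (\<Prod>i<d. phi (jj i) (real_of_int (k i))) * fourier_coeff d f k) * texp d k x)"
    by simp
qed

text \<open>On the grid of level \<open>jj + c\<close>, the block \<open>delta_op phi d jj f\<close> is oversampled by the factor \<open>2 ^ e\<close>.\<close>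

definition freq_shift :: "(nat \<Rightarrow> real \<Rightarrow> real) \<Rightarrow> nat \<Rightarrow> nat \<Rightarrow> bool" where
  "freq_shift phi e c \<longleftrightarrow> e \<le> c \<and> (\<forall>j k. phi j (real_of_int k) \<noteq> 0 \<longrightarrow> \<bar>k\<bar> \<le> 2 ^ (j + c - e))"

lemma admissible_freq_shift:
  assumes "admissible phi"
  obtains c where "freq_shift phi e c"
proof -
  have "\<exists>A C. A > 0 \<and> (\<forall>x. phi 0 x \<noteq> 0 \<longrightarrow> \<bar>x\<bar> \<le> A) \<and> C > 0 \<and> (\<forall>j\<ge>1. \<forall>x. phi j x \<noteq> 0 \<longrightarrow> \<bar>x\<bar> \<le> C * 2 ^ j)"
    using assms unfolding admissible_def by meson
  then obtain A C where A: "A > 0" "\<And>x. phi 0 x \<noteq> 0 \<Longrightarrow> \<bar>x\<bar> \<le> A" and C: "C > 0" "\<And>j x. j \<ge> 1 \<Longrightarrow> phi j x \<noteq> 0 \<Longrightarrow> \<bar>x\<bar> \<le> C * 2 ^ j"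
    by blast
  obtain n where n: "max A C < 2 ^ n" using real_arch_pow[of 2 "max A C"] by auto
  have "freq_shift phi e (n + e)"
    unfolding freq_shift_def
  proof (intro conjI allI impI)
    fix j :: nat and k :: int assume nz: "phi j (real_of_int k) \<noteq> 0"
    have "\<bar>real_of_int k\<bar> \<le> max A C * 2 ^ j"
    proof (cases "j = 0")
      case True then show ?thesis using A(2)[of "real_of_int k"] nz by simp
    next
      case False
      then have "\<bar>real_of_int k\<bar> \<le> C * 2 ^ j" using C(2) nz by simp
      also have "\<dots> \<le> max A C * 2 ^ j" by (intro mult_right_mono) auto
      finally show ?thesis .
    qed
    also have "\<dots> \<le> 2 ^ n * 2 ^ j" using n by (intro mult_right_mono) auto
    also have "\<dots> = 2 ^ (j + (n + e) - e)" by (simp add: power_add)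
    finally have "real_of_int \<bar>k\<bar> \<le> real_of_int (2 ^ (j + (n + e) - e))" by simp
    then show "\<bar>k\<bar> \<le> 2 ^ (j + (n + e) - e)" by (simp only: of_int_le_iff)
  qed simp
  then show ?thesis by (rule that)
qed

lemma delta_op_eq:
  assumes "freq_shift phi e c"
  shows "delta_op phi d jj f = (\<lambda>x. \<Sum>k\<in>zbox d (\<lambda>i. 2 ^ (jj i + c - e)). (of_real (\<Prod>i<d. phi (jj i) (real_of_int (k i))) * fourier_coeff d f k) * texp d k x)"
  by (rule delta_op_eq_sum) (use assms in \<open>force simp: freq_shift_def not_le\<close>)

lemma delta_op_trigpoly:
  assumes "freq_shift phi e c"
  shows "trigpoly d (\<lambda>i. 2 ^ (jj i + c - e)) (delta_op phi d jj f)"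
  unfolding trigpoly_def delta_op_eq[OF assms]
  by (intro exI[of _ "zbox d (\<lambda>i. 2 ^ (jj i + c - e))"] exI conjI finite_zbox) (auto simp: zbox_def)

lemma trigpoly_continuous: "trigpoly d N g \<Longrightarrow> continuous_on UNIV g"
  unfolding trigpoly_def texp_def
  by (elim exE conjE, simp) (intro continuous_intros continuous_on_product_coordinates)

lemma trigpoly_bounded:
  assumes "trigpoly d N g" obtains B where "\<And>x. norm (g x) \<le> B"
proof -
  obtain K c where g: "g = (\<lambda>x. \<Sum>k\<in>K. c k * texp d k x)" using assms unfolding trigpoly_def by blast
  have "norm (g x) \<le> (\<Sum>k\<in>K. norm (c k))" for x
    unfolding g by (rule order_trans[OF norm_sum]) (simp add: norm_mult)
  then show ?thesis by (rule that)
qed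

lemma trigpoly_cmult: "trigpoly d N g \<Longrightarrow> trigpoly d N (\<lambda>x. a * g x)"
proof -
  assume "trigpoly d N g"
  then obtain K c where K: "finite K" "\<forall>k\<in>K. \<forall>i<d. \<bar>k i\<bar> \<le> N i" "g = (\<lambda>x. \<Sum>k\<in>K. c k * texp d k x)"
    unfolding trigpoly_def by blast
  then have "(\<lambda>x. a * g x) = (\<lambda>x. \<Sum>k\<in>K. (a * c k) * texp d k x)" by (simp add: sum_distrib_left mult.assoc)
  with K show ?thesis unfolding trigpoly_def by (intro exI[of _ K] exI[of _ "\<lambda>k. a * c k"] conjI)
qed

lemma epow_ennreal: "0 \<le> u \<Longrightarrow> epow (ennreal u) e = ennreal (u powr e)"
  by (simp add: epow_def)

lemma epow_mono: "a \<le> b \<Longrightarrow> 0 \<le> e \<Longrightarrow> epow a e \<le> epow b e"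
proof -
  assume ab: "a \<le> b" and e: "0 \<le> e"
  show ?thesis
  proof (cases "b = \<infinity>")
    case False
    then have "b < top" by (simp add: less_top)
    then have "enn2real a \<le> enn2real b" using ab by (rule enn2real_mono[rotated])
    moreover have "a \<noteq> \<infinity>" using ab False by (auto simp: top_unique)
    ultimately show ?thesis using False e by (auto simp: epow_def intro!: ennreal_leI powr_mono2)
  qed (simp add: epow_def)
qed

lemma Fsq_ge:
  assumes \<theta>: "0 < \<theta>" and jj: "jj \<in> multi_idx d"
  shows "ennreal (2 powr (\<Sum>i<d. r i * real (jj i)) * norm (delta_op phi d jj f x)) \<le> Fsq phi d r \<theta> f x"
proof (cases "\<theta> = \<infinity>")
  case True
  then show ?thesis unfolding Fsq_def using jj by (auto intro: SUP_upper2)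
next
  case False
  define t where "t = enn2real \<theta>"
  have t: "t > 0" using \<theta> False by (simp add: t_def enn2real_positive_iff less_top)
  define u where "u jj = 2 powr (\<Sum>i<d. r i * real (jj i)) * norm (delta_op phi d jj f x)" for jj
  have u0: "u jj \<ge> 0" for jj by (simp add: u_def)
  have "ennreal (u jj powr t) \<le> (\<Sum>\<^sub>\<infinity>jj\<in>multi_idx d. ennreal (u jj powr t))"
    using jj by (subst nonneg_infsum_complete) (auto intro!: SUP_upper2[of "{jj}"])
  then have "epow (ennreal (u jj powr t)) (1/t) \<le> epow (\<Sum>\<^sub>\<infinity>jj\<in>multi_idx d. ennreal (u jj powr t)) (1/t)"
    using t by (intro epow_mono) auto
  moreover have "epow (ennreal (u jj powr t)) (1/t) = ennreal (u jj)"
    using t u0 by (simp add: epow_ennreal powr_powr)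
  ultimately show ?thesis using False by (simp add: Fsq_def u_def t_def)
qed

lemma continuous_on_Max_finite:
  fixes h :: "'a \<Rightarrow> 'b::topological_space \<Rightarrow> real"
  assumes "finite F" "F \<noteq> {}" "\<And>j. j \<in> F \<Longrightarrow> continuous_on S (h j)"
  shows "continuous_on S (\<lambda>x. Max ((\<lambda>j. h j x) ` F))"
  using assms by (induction F rule: finite_ne_induct) (auto intro!: continuous_on_max)

text \<open>The exponents are matched by \<open>(p / 2) * (2 * q / p) = q\<close>; squaring then
  leaves the outer power \<open>p\<close>.\<close>

lemma lnorm_half_power:
  fixes p q :: real
  assumes p: "p > 0" and q: "q > 0" and u: "\<And>n. n \<in> A \<Longrightarrow> 0 \<le> u n"
  shows "(lnorm (2 * q / p) A (\<lambda>n. u n powr (p / 2)))\<^sup>2 = lnorm q A u powr p"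
proof -
  have "(\<Sum>n\<in>A. (u n powr (p / 2)) powr (2 * q / p)) = (\<Sum>n\<in>A. u n powr q)"
    using p by (simp add: powr_powr)
  then have "lnorm (2 * q / p) A (\<lambda>n. u n powr (p / 2)) = (\<Sum>n\<in>A. u n powr q) powr (p / (2 * q))"
    by (simp add: lnorm_def)
  then have "(lnorm (2 * q / p) A (\<lambda>n. u n powr (p / 2)))\<^sup>2 = ((\<Sum>n\<in>A. u n powr q) powr (p / (2 * q))) powr 2"
    by simp
  also have "\<dots> = lnorm q A u powr p" using q by (simp add: lnorm_def powr_powr)
  finally show ?thesis .
qed

text \<open>\<open>discrete_jawerth\<close> with \<open>\<rho> = p / 2\<close> turns the power \<open>p\<close> of \<open>F\<close>-norms into squares. Of the \<open>\<ell>\<^sub>\<theta>\<close> norm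
  only its lower bound by the maximum over finitely many blocks is used.\<close>

lemma jawerth_embedding:
  fixes p q :: real and r :: "nat \<Rightarrow> real"
  assumes p: "p > 0" and q: "q > p" and \<theta>: "0 < \<theta>" and fs: "freq_shift phi e c"
  obtains C where "C > 0" "\<And>f F. SF_norm phi d r p \<theta> f < \<infinity> \<Longrightarrow> finite F \<Longrightarrow> F \<subseteq> multi_idx d \<Longrightarrow>
    (\<Sum>jj\<in>F. (2 powr (\<Sum>i<d. (r i - 1/p) * real (jj i)) * lnorm q (dgrid d (\<lambda>i. jj i + c)) (\<lambda>n. norm (delta_op phi d jj f (gpt (\<lambda>i. jj i + c) n)))) powr p)
     \<le> C * (enn2real (SF_norm phi d r p \<theta> f)) powr p"
proof (rule discrete_jawerth[where d=d and \<rho>="p/2" and \<kappa>="2 * q / p"])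
  show "p / 2 > 0" using p by simp
  show "2 * q / p > 2" using p q by (simp add: less_divide_eq)
next
  fix C b
  assume C: "C > 0" and dj: "\<And>F J g A. F \<subseteq> PiE {..<d} (\<lambda>_. {..J}) \<Longrightarrow> (\<And>l i. l \<in> F \<Longrightarrow> i < d \<Longrightarrow> l i + b \<le> J) \<Longrightarrow>
     (\<And>l. l \<in> F \<Longrightarrow> trigpoly d (\<lambda>i. 2 ^ l i) (g l)) \<Longrightarrow>
     (\<And>v. 0 \<le> A v) \<Longrightarrow> (\<And>l v. l \<in> F \<Longrightarrow> norm (g l (gpt (\<lambda>_. J) v)) powr (p/2) \<le> A v) \<Longrightarrow>
     (\<Sum>l\<in>F. (lnorm (2 * q / p) (dgrid d l) (\<lambda>n. norm (g l (gpt l n)) powr (p/2)))\<^sup>2 / 2 ^ (\<Sum>i<d. l i))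
       \<le> C * ((\<Sum>v\<in>dgrid d (\<lambda>_. J). (A v)\<^sup>2) / 2 ^ (J * d))"
  \<comment> \<open>\<open>2 ^ (d * c)\<close> undoes the offset \<open>c\<close> of the grid levels
    in the volume factor, and \<open>(2 * pi) ^ d\<close> is the total mass of the unnormalised
    torus measure.\<close>
  define C' where "C' = 2 ^ (d * c) * C / (2 * pi) ^ d"
  have C': "C' > 0" using C by (simp add: C'_def)
  show thesis
  proof (rule that[OF C'])
    fix f and F :: "(nat \<Rightarrow> nat) set"
    assume fin: "SF_norm phi d r p \<theta> f < \<infinity>" and F: "finite F" "F \<subseteq> multi_idx d"
    define \<delta> where "\<delta> jj = delta_op phi d jj f" for jj
    have dt: "trigpoly d (\<lambda>i. 2 ^ (jj i + c)) (\<delta> jj)" for jj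
      unfolding \<delta>_def by (rule trigpoly_mono[OF delta_op_trigpoly[OF fs]]) (auto intro!: power_increasing)
    define wt where "wt jj = 2 powr (\<Sum>i<d. r i * real (jj i))" for jj :: "nat \<Rightarrow> nat"
    have wt0: "wt jj > 0" for jj by (simp add: wt_def)
    define Q where "Q jj = lnorm q (dgrid d (\<lambda>i. jj i + c)) (\<lambda>n. norm (\<delta> jj (gpt (\<lambda>i. jj i + c) n)))" for jj
    have Q0: "Q jj \<ge> 0" for jj by (simp add: Q_def)
    define S where "S = (\<Sum>jj\<in>F. (2 powr (\<Sum>i<d. (r i - 1/p) * real (jj i)) * Q jj) powr p)"
    have "S \<le> C' * enn2real (SF_norm phi d r p \<theta> f) powr p"
    proof (cases "F = {}")
      case True
      then show ?thesis using C' by (simp add: S_def)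
    next
      case False
      define u where "u jj x = (wt jj * norm (\<delta> jj x)) powr p" for jj x
      define G where "G x = Max ((\<lambda>jj. u jj x) ` F)" for x
      have uG: "u jj x \<le> G x" if "jj \<in> F" for jj x
        unfolding G_def by (rule Max_ge) (use F that in auto)
      have G0: "G x \<ge> 0" for x
      proof -
        obtain jj where "jj \<in> F" using False by blast
        have "0 \<le> u jj x" by (simp add: u_def)
        also have "\<dots> \<le> G x" by (rule uG[OF \<open>jj \<in> F\<close>])
        finally show ?thesis .
      qed
      have Gin: "\<exists>jj\<in>F. G x = u jj x" for x
      proof -
        have "G x \<in> (\<lambda>jj. u jj x) ` F" unfolding G_def by (rule Max_in) (use F False in auto)
        then show ?thesis by auto
      qed
      have Gc: "continuous_on UNIV G" unfolding G_def
      proof (rule continuous_on_Max_finite[OF F(1) False])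
        fix jj
        have "continuous_on UNIV (\<lambda>x. wt jj * norm (\<delta> jj x))"
          by (intro continuous_intros trigpoly_continuous[OF dt])
        then show "continuous_on UNIV (u jj)" unfolding u_def[abs_def]
          using p wt0 by (intro continuous_on_powr' continuous_on_const) (auto simp: less_imp_le)
      qed
      have Gd: "G x = G y" if "\<And>i. i < d \<Longrightarrow> x i = y i" for x y
        unfolding G_def u_def using trigpoly_cong[OF dt that] by simp
      have "\<exists>B. \<forall>x. norm (\<delta> jj x) \<le> B" for jj
        by (rule trigpoly_bounded[OF dt[of jj]]) blast
      then obtain B where B: "\<And>jj x. norm (\<delta> jj x) \<le> B jj" by metis
      have Gb: "\<bar>G x\<bar> \<le> (\<Sum>jj\<in>F. (wt jj * B jj) powr p)" for x
      proof -
        obtain jj where jj: "jj \<in> F" "G x = u jj x" using Gin by blast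
        have "u jj x \<le> (wt jj * B jj) powr p"
          unfolding u_def using p B wt0[of jj] by (intro powr_mono2 mult_left_mono) (auto simp: less_imp_le)
        also have "\<dots> \<le> (\<Sum>jj\<in>F. (wt jj * B jj) powr p)" by (rule member_le_sum) (use jj F in auto)
        finally show ?thesis using jj G0[of x] by simp
      qed
      \<comment> \<open>A level fine enough, with the offset \<open>b\<close>, for all blocks in the
        finite set \<open>F\<close>; every larger \<open>J\<close> is admissible, so
        \<open>J\<close> may tend to infinity with \<open>F\<close> fixed.\<close>
      define J0 where "J0 = (\<Sum>jj\<in>F. \<Sum>i<d. jj i) + c + b"
      \<comment> \<open>\<open>discrete_jawerth\<close> labels blocks by grid levels in a
        \<open>PiE\<close>; \<open>T\<close> passes from the block index to its grid level, and
        \<open>U\<close> recovers the index.\<close>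
      define T where "T jj = restrict (\<lambda>i. jj i + c) {..<d}" for jj :: "nat \<Rightarrow> nat"
      define U where "U l = (\<lambda>i. if i < d then l i - c else 0)" for l :: "nat \<Rightarrow> nat"
      have UT: "U (T jj) = jj" if "jj \<in> F" for jj
        using that F by (auto simp: U_def T_def fun_eq_iff multi_idx_def)
      have injT: "inj_on T F" by (rule inj_on_inverseI[of _ U]) (rule UT)
      have sumle: "S \<le> 2 ^ (d * c) * C * ((\<Sum>v\<in>dgrid d (\<lambda>_. J). G (gpt (\<lambda>_. J) v)) / 2 ^ (J * d))" if J: "J \<ge> J0" for J
      proof -
        define g where "g l x = complex_of_real (wt (U l)) * \<delta> (U l) x" for l x
        have "(\<Sum>l\<in>T ` F. (lnorm (2 * q / p) (dgrid d l) (\<lambda>n. norm (g l (gpt l n)) powr (p/2)))\<^sup>2 / 2 ^ (\<Sum>i<d. l i))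
           \<le> C * ((\<Sum>v\<in>dgrid d (\<lambda>_. J). (G (gpt (\<lambda>_. J) v) powr (1/2))\<^sup>2) / 2 ^ (J * d))"
        proof (rule dj[where F="T ` F" and J=J and g=g and A="\<lambda>v. G (gpt (\<lambda>_. J) v) powr (1/2)"])
          have le: "jj i + c + b \<le> J" if "jj \<in> F" "i < d" for jj i
          proof -
            have "jj i \<le> (\<Sum>i<d. jj i)" by (rule member_le_sum) (use that in auto)
            also have "\<dots> \<le> (\<Sum>jj\<in>F. \<Sum>i<d. jj i)" by (rule member_le_sum) (use that F in auto)
            finally show ?thesis using J by (simp add: J0_def)
          qed
          show "T ` F \<subseteq> PiE {..<d} (\<lambda>_. {..J})"
          proof (intro image_subsetI)
            fix jj assume "jj \<in> F"
            have "\<forall>i\<in>{..<d}. jj i + c \<in> {..J}"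
            proof
              fix i assume "i \<in> {..<d}"
              then show "jj i + c \<in> {..J}" using le[OF \<open>jj \<in> F\<close>, of i] by simp
            qed
            then show "T jj \<in> PiE {..<d} (\<lambda>_. {..J})" unfolding T_def by (simp only: restrict_PiE_iff)
          qed
          show "l i + b \<le> J" if "l \<in> T ` F" "i < d" for l i
            using that le by (auto simp: T_def)
          show "trigpoly d (\<lambda>i. 2 ^ l i) (g l)" if "l \<in> T ` F" for l
          proof -
            from that obtain jj where jj: "jj \<in> F" "l = T jj" by blast
            have "trigpoly d (\<lambda>i. 2 ^ (jj i + c)) (g l)"
              unfolding g_def jj(2) UT[OF jj(1)] by (intro trigpoly_cmult dt)
            then show ?thesis by (rule trigpoly_mono) (simp add: jj(2) T_def)
          qed
          show "norm (g l (gpt (\<lambda>_. J) v)) powr (p/2) \<le> G (gpt (\<lambda>_. J) v) powr (1/2)" if "l \<in> T ` F" for l v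
          proof -
            from that obtain jj where jj: "jj \<in> F" "l = T jj" by blast
            have "norm (g l (gpt (\<lambda>_. J) v)) powr (p/2) = u jj (gpt (\<lambda>_. J) v) powr (1/2)"
              using wt0[of jj] by (simp add: g_def jj(2) UT[OF jj(1)] u_def powr_powr norm_mult)
            also have "\<dots> \<le> G (gpt (\<lambda>_. J) v) powr (1/2)"
              by (rule powr_mono2) (use uG[OF jj(1)] in \<open>auto simp: u_def\<close>)
            finally show ?thesis .
          qed
        qed simp
        also have "(\<Sum>v\<in>dgrid d (\<lambda>_. J). (G (gpt (\<lambda>_. J) v) powr (1/2))\<^sup>2) = (\<Sum>v\<in>dgrid d (\<lambda>_. J). G (gpt (\<lambda>_. J) v))"
          using G0 by (simp add: powr_half_sqrt)
        also have "(\<Sum>l\<in>T ` F. (lnorm (2 * q / p) (dgrid d l) (\<lambda>n. norm (g l (gpt l n)) powr (p/2)))\<^sup>2 / 2 ^ (\<Sum>i<d. l i)) = S / 2 ^ (d * c)"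
        proof -
          have "(lnorm (2 * q / p) (dgrid d (T jj)) (\<lambda>n. norm (g (T jj) (gpt (T jj) n)) powr (p/2)))\<^sup>2 / 2 ^ (\<Sum>i<d. T jj i)
             = (2 powr (\<Sum>i<d. (r i - 1/p) * real (jj i)) * Q jj) powr p / 2 ^ (d * c)" if jj: "jj \<in> F" for jj
          proof -
            have dg: "dgrid d (T jj) = dgrid d (\<lambda>i. jj i + c)" by (rule dgrid_cong) (simp add: T_def)
            have \<delta>eq: "\<delta> jj (gpt (T jj) n) = \<delta> jj (gpt (\<lambda>i. jj i + c) n)" for n
              by (rule trigpoly_cong[OF dt]) (simp add: gpt_def T_def)
            have "(lnorm (2 * q / p) (dgrid d (T jj)) (\<lambda>n. norm (g (T jj) (gpt (T jj) n)) powr (p/2)))\<^sup>2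
               = lnorm q (dgrid d (\<lambda>i. jj i + c)) (\<lambda>n. wt jj * norm (\<delta> jj (gpt (\<lambda>i. jj i + c) n))) powr p"
              unfolding dg g_def UT[OF jj] \<delta>eq using p q wt0[of jj] by (subst lnorm_half_power) (auto simp: norm_mult)
            also have "\<dots> = (wt jj * Q jj) powr p"
              unfolding Q_def using p q wt0[of jj] by (subst lnorm_scale) auto
            finally have l: "(lnorm (2 * q / p) (dgrid d (T jj)) (\<lambda>n. norm (g (T jj) (gpt (T jj) n)) powr (p/2)))\<^sup>2 = (wt jj * Q jj) powr p" .
            have s: "(\<Sum>i<d. T jj i) = (\<Sum>i<d. jj i) + d * c" by (simp add: T_def sum.distrib)
            \<comment> \<open>Raised to the power \<open>p\<close>, the shift \<open>- 1/p\<close>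
              of the smoothness is exactly the volume factor
              \<open>1 / 2 ^ (\<Sum>i<d. jj i)\<close> of the dyadic boxes.\<close>
            have "(2 powr (\<Sum>i<d. (r i - 1/p) * real (jj i)) * Q jj) powr p = (wt jj * Q jj) powr p / 2 ^ (\<Sum>i<d. jj i)"
            proof -
              have "(\<Sum>i<d. (r i - 1/p) * real (jj i)) = (\<Sum>i<d. r i * real (jj i)) - (\<Sum>i<d. real (jj i)) / p"
                by (simp add: left_diff_distrib sum_subtractf sum_divide_distrib)
              then have "(\<Sum>i<d. (r i - 1/p) * real (jj i)) * p = (\<Sum>i<d. r i * real (jj i)) * p - real (\<Sum>i<d. jj i)"
                using p by (simp add: left_diff_distrib)
              then have "(2 powr (\<Sum>i<d. (r i - 1/p) * real (jj i))) powr p = wt jj powr p / 2 powr real (\<Sum>i<d. jj i)"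
                by (simp only: wt_def powr_powr powr_diff)
              then show ?thesis using wt0[of jj] Q0[of jj] by (simp add: powr_mult powr_realpow del: of_nat_sum)
            qed
            then show ?thesis unfolding l s by (simp add: power_add)
          qed
          then show ?thesis unfolding sum.reindex[OF injT] o_def S_def by (simp add: sum_divide_distrib)
        qed
        finally show ?thesis by (simp add: divide_le_eq mult_ac)
      qed
      define I where "I = (\<integral>x. G x \<partial>torus_measure d)"
      have "(\<lambda>J. 2 ^ (d * c) * C / (2 * pi) ^ d * ((2 * pi) ^ d * ((\<Sum>v\<in>dgrid d (\<lambda>_. J). G (gpt (\<lambda>_. J) v)) / 2 ^ (J * d)))) \<longlonglongrightarrow> 2 ^ (d * c) * C / (2 * pi) ^ d * I"
        unfolding I_def by (intro tendsto_mult tendsto_const riemann_sum_tendsto[OF Gc Gd Gb])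
      then have SI: "S \<le> C' * I" unfolding C'_def
        by (rule LIMSEQ_le_const) (use sumle in \<open>auto simp: mult.assoc intro!: exI[of _ J0]\<close>)
      define N where "N = (\<integral>\<^sup>+ x. epow (Fsq phi d r \<theta> f x) p \<partial>torus_measure d)"
      have Nfin: "N \<noteq> \<infinity>" using fin unfolding SF_norm_def N_def[symmetric] by (auto simp: epow_def)
      have Gm: "G \<in> borel_measurable (torus_measure d)" by (rule torus_measurable[OF Gc Gd])
      have Gi: "integrable (torus_measure d) G"
        by (rule torus_bounded_integrable[OF Gm]) (use Gb in auto)
      have "ennreal I = (\<integral>\<^sup>+ x. ennreal (G x) \<partial>torus_measure d)"
        unfolding I_def by (rule nn_integral_eq_integral[symmetric, OF Gi]) (use G0 in auto)
      also have "\<dots> \<le> N" unfolding N_def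
      proof (rule nn_integral_mono)
        fix x
        obtain jj where jj: "jj \<in> F" "G x = u jj x" using Gin by blast
        have "ennreal (wt jj * norm (\<delta> jj x)) \<le> Fsq phi d r \<theta> f x"
          unfolding wt_def \<delta>_def using jj F by (intro Fsq_ge \<theta>) auto
        then have "epow (ennreal (wt jj * norm (\<delta> jj x))) p \<le> epow (Fsq phi d r \<theta> f x) p"
          using p by (intro epow_mono) auto
        then show "ennreal (G x) \<le> epow (Fsq phi d r \<theta> f x) p"
          using wt0[of jj] by (simp add: jj(2) u_def epow_ennreal)
      qed
      finally have IN: "ennreal I \<le> N" .
      have "I \<ge> 0" unfolding I_def using G0 by simp
      then have "I = enn2real (ennreal I)" by simp
      also have "\<dots> \<le> enn2real N" using IN Nfin by (intro enn2real_mono) (simp_all add: less_top)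
      also have "enn2real N = enn2real (SF_norm phi d r p \<theta> f) powr p"
        unfolding SF_norm_def N_def[symmetric] epow_def[of N] using Nfin p by (simp add: powr_powr)
      finally show ?thesis using SI C' by (intro order_trans[OF SI] mult_left_mono) auto
    qed
    then show "(\<Sum>jj\<in>F. (2 powr (\<Sum>i<d. (r i - 1/p) * real (jj i)) * lnorm q (dgrid d (\<lambda>i. jj i + c)) (\<lambda>n. norm (delta_op phi d jj f (gpt (\<lambda>i. jj i + c) n)))) powr p)
     \<le> C' * (enn2real (SF_norm phi d r p \<theta> f)) powr p"
      by (simp only: S_def Q_def \<delta>_def)
  qed
qed

section \<open>The error of the Smolyak operator\<close>

lemma torus_fun_bounded:
  assumes "torus_fun d f"
  obtains B where "\<And>x. (\<And>i. i < d \<Longrightarrow> x i \<in> {-pi..pi}) \<Longrightarrow> norm (f x) \<le> B"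
proof -
  \<comment> \<open>Pinning the remaining coordinates to 0 gives a product of compact sets, compact
    by Tychonoff.\<close>
  define S where "S = PiE UNIV (\<lambda>i. if i < d then {-pi..pi} else {0::real})"
  have "compactin (product_topology (\<lambda>_. euclidean) UNIV) S"
    unfolding S_def by (subst compactin_PiE) auto
  then have "compact S" by (simp add: euclidean_product_topology compactin_euclidean_iff)
  moreover have "continuous_on S f" using assms unfolding torus_fun_def by (auto intro: continuous_on_subset)
  ultimately have "bounded (f ` S)" by (intro compact_imp_bounded compact_continuous_image)
  then obtain B where B: "\<And>y. y \<in> S \<Longrightarrow> norm (f y) \<le> B" unfolding bounded_iff by auto
  show ?thesis
  proof (rule that[of B])
    fix x :: "nat \<Rightarrow> real" assume x: "\<And>i. i < d \<Longrightarrow> x i \<in> {-pi..pi}"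
    have "extz d x \<in> S" using x by (auto simp: S_def extz_def)
    moreover have "f (extz d x) = f x" using assms unfolding torus_fun_def by (auto simp: extz_def)
    ultimately show "norm (f x) \<le> B" using B by metis
  qed
qed

section \<open>Pointwise reconstruction from the blocks\<close>

lemma fourier_coeff_cong:
  assumes "\<And>i. i < d \<Longrightarrow> k i = k' i" shows "fourier_coeff d f k = fourier_coeff d f k'"
  using assms by (simp add: fourier_coeff_texp texp_def)

lemma fourier_coeff_delta_op:
  assumes fs: "freq_shift phi e c"
  shows "fourier_coeff d (delta_op phi d jj f) k = of_real (\<Prod>i<d. phi (jj i) (real_of_int (k i))) * fourier_coeff d f k"
proof -
  \<comment> \<open>The box is enlarged so as to contain \<open>k\<close>, whose coefficient can
    then be read off even if \<open>k\<close> lies outside the spectrum of the block.\<close>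
  define N where "N i = 2 ^ (jj i + c - e) + \<bar>k i\<bar>" for i
  define a where "a k = of_real (\<Prod>i<d. phi (jj i) (real_of_int (k i))) * fourier_coeff d f k" for k :: "nat \<Rightarrow> int"
  define k' where "k' i = (if i < d then k i else 0)" for i
  have d: "delta_op phi d jj f = (\<lambda>x. \<Sum>k\<in>zbox d N. a k * texp d k x)"
    unfolding a_def
  proof (rule delta_op_eq_sum)
    fix i and n :: int assume "i < d" "\<bar>n\<bar> > N i"
    then have "\<not> \<bar>n\<bar> \<le> 2 ^ (jj i + c - e)" by (simp add: N_def)
    then show "phi (jj i) (real_of_int n) = 0" using fs unfolding freq_shift_def by blast
  qed
  have "fourier_coeff d (delta_op phi d jj f) k = (\<Sum>n\<in>zbox d N. fourier_coeff d (\<lambda>x. a n * texp d n x) k)"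
    unfolding d
    by (rule fourier_coeff_sum[where B="\<lambda>n. norm (a n)"]) (auto simp: norm_mult intro!: borel_measurable_times texp_measurable)
  also have "\<dots> = (\<Sum>n\<in>zbox d N. if n = k' then a k' else 0)"
  proof (rule sum.cong)
    fix n assume "n \<in> zbox d N"
    then have "(\<forall>i<d. n i = k i) \<longleftrightarrow> n = k'" by (auto simp: zbox_def k'_def fun_eq_iff)
    then show "fourier_coeff d (\<lambda>x. a n * texp d n x) k = (if n = k' then a k' else 0)"
      by (simp add: fourier_coeff_cmult fourier_coeff_of_texp)
  qed simp
  also have "\<dots> = a k'"
  proof -
    have "k' \<in> zbox d N" by (auto simp: zbox_def k'_def N_def)
    then show ?thesis by simp
  qed
  also have "a k' = a k"
    unfolding a_def using fourier_coeff_cong[of d k' k f] by (simp add: k'_def)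
  finally show ?thesis by (simp add: a_def)
qed

text \<open>At a fixed frequency the lower support bound \<open>B * 2 ^ j\<close> leaves only
  finitely many \<open>j\<close> in each coordinate, so the sum is a finite product of finite sums,
  each equal to 1.\<close>

lemma admissible_partition:
  assumes "admissible phi"
  shows "((\<lambda>jj. \<Prod>i<d. phi (jj i) (real_of_int (k i))) has_sum 1) (multi_idx d)"
proof -
  have "\<exists>B>0. \<forall>j\<ge>1. \<forall>x. phi j x \<noteq> 0 \<longrightarrow> B * 2 ^ j \<le> \<bar>x\<bar>"
    using assms unfolding admissible_def by meson
  then obtain B where B: "B > 0" "\<And>j x. j \<ge> 1 \<Longrightarrow> phi j x \<noteq> 0 \<Longrightarrow> B * 2 ^ j \<le> \<bar>x\<bar>" by blast
  have s1: "(\<lambda>j. phi j x) sums 1" for x using assms unfolding admissible_def by blast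
  define X where "X = (\<Sum>i<d. \<bar>real_of_int (k i)\<bar>)"
  obtain n where n: "X / B < 2 ^ n" using real_arch_pow[of 2 "X / B"] by auto
  have z: "phi j (real_of_int (k i)) = 0" if "j > n" "i < d" for i j
  proof (rule ccontr)
    assume "phi j (real_of_int (k i)) \<noteq> 0"
    then have "B * 2 ^ j \<le> \<bar>real_of_int (k i)\<bar>" using that B(2) by simp
    also have "\<dots> \<le> X" unfolding X_def by (rule member_le_sum) (use that in auto)
    also have "X < B * 2 ^ n" using n B(1) by (simp add: divide_less_eq mult.commute)
    also have "\<dots> \<le> B * 2 ^ j" using that B(1) by (intro mult_left_mono power_increasing) auto
    finally show False by simp
  qed
  have one: "(\<Sum>j\<le>n. phi j (real_of_int (k i))) = 1" if "i < d" for i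
    using sums_unique2[OF sums_finite[of "{..n}" "\<lambda>j. phi j (real_of_int (k i))"] s1] z[OF _ that] by (auto simp: not_le)
  show ?thesis
  proof (rule has_sum_finite_neutralI[of "ibox d (\<lambda>_. n)"])
    show "ibox d (\<lambda>_. n) \<subseteq> multi_idx d" by (auto simp: ibox_def)
    show "(\<Prod>i<d. phi (jj i) (real_of_int (k i))) = 0" if "jj \<in> multi_idx d - ibox d (\<lambda>_. n)" for jj
    proof -
      from that obtain i where "i < d" "jj i > n" by (auto simp: ibox_def not_le)
      then show ?thesis using z by (intro prod_zero) auto
    qed
    have "(\<Sum>jj\<in>ibox d (\<lambda>_. n). \<Prod>i<d. phi (jj i) (real_of_int (k i))) = (\<Prod>i<d. \<Sum>j\<le>n. phi j (real_of_int (k i)))"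
      by (rule sum_ibox_prod[of "\<lambda>i j. phi j (real_of_int (k i))"])
    then show "1 = (\<Sum>jj\<in>ibox d (\<lambda>_. n). \<Prod>i<d. phi (jj i) (real_of_int (k i)))" by (simp add: one)
  qed simp
qed

text \<open>The series converges uniformly to a continuous \<open>G\<close> with the Fourier
  coefficients of \<open>f\<close>, since the cut-offs sum to 1 at every frequency. Uniqueness
  identifies \<open>f\<close> and \<open>G\<close> in the open cube, and continuity extends this to
  the faces.\<close>

lemma torus_representation:
  assumes adm: "admissible phi" and tf: "torus_fun d f" and fs: "freq_shift phi e c"
    and bd: "\<And>jj x. jj \<in> multi_idx d \<Longrightarrow> norm (delta_op phi d jj f x) \<le> b jj" and b: "b summable_on multi_idx d"
    and x: "\<And>i. i < d \<Longrightarrow> x i \<in> {-pi..pi}"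
  shows "((\<lambda>jj. delta_op phi d jj f x) has_sum f x) (multi_idx d)"
proof -
  define \<delta> where "\<delta> jj = delta_op phi d jj f" for jj
  define G where "G = (\<lambda>x. \<Sum>\<^sub>\<infinity>jj\<in>multi_idx d. \<delta> jj x)"
  have t: "trigpoly d (\<lambda>i. 2 ^ (jj i + c - e)) (\<delta> jj)" for jj unfolding \<delta>_def by (rule delta_op_trigpoly[OF fs])
  have gd: "\<delta> jj x = \<delta> jj y" if "\<forall>i<d. x i = y i" for jj x y
    by (rule trigpoly_cong[OF t]) (use that in auto)
  have gb: "norm (\<delta> jj x) \<le> b jj" if "jj \<in> multi_idx d" for jj x unfolding \<delta>_def by (rule bd[OF that])
  note fsi = fourier_series_infsum[where g=\<delta> and d=d and I="multi_idx d" and b=b, OF trigpoly_continuous[OF t] gd gb b]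
  have Gc: "continuous_on UNIV G" unfolding G_def by (rule fsi(1)) auto
  have Gd: "G x = G y" if "\<And>i. i < d \<Longrightarrow> x i = y i" for x y unfolding G_def by (rule fsi(2)) (use that in auto)
  have Gb: "norm (G x) \<le> (\<Sum>\<^sub>\<infinity>jj\<in>multi_idx d. b jj)" for x unfolding G_def by (rule fsi(4)) auto
  have Gs: "((\<lambda>jj. \<delta> jj x) has_sum G x) (multi_idx d)" for x unfolding G_def by (rule fsi(5)) auto
  have Gf: "fourier_coeff d G k = fourier_coeff d f k" for k
  proof -
    have "((\<lambda>jj. fourier_coeff d (\<delta> jj) k) has_sum fourier_coeff d G k) (multi_idx d)"
      unfolding G_def by (rule fsi(3)) auto
    moreover have hp: "((\<lambda>jj. complex_of_real (\<Prod>i<d. phi (jj i) (real_of_int (k i)))) has_sum of_real 1) (multi_idx d)"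
      by (rule has_sum_of_real[OF admissible_partition[OF adm]])
    have "((\<lambda>jj. fourier_coeff d (\<delta> jj) k) has_sum (1 * fourier_coeff d f k)) (multi_idx d)"
      unfolding \<delta>_def fourier_coeff_delta_op[OF fs]
      using has_sum_cmult_left[OF hp, of "fourier_coeff d f k"] by (simp only: of_real_1)
    ultimately show ?thesis using has_sum_unique by fastforce
  qed
  have fc: "continuous_on UNIV f" and fd: "\<And>x y. (\<And>i. i < d \<Longrightarrow> x i = y i) \<Longrightarrow> f x = f y"
    using tf unfolding torus_fun_def by auto
  obtain B where B: "\<And>x. (\<And>i. i < d \<Longrightarrow> x i \<in> {-pi..pi}) \<Longrightarrow> norm (f x) \<le> B"
    using torus_fun_bounded[OF tf] by blast
  have fB: "norm (f x) \<le> B" if "x \<in> space (torus_measure d)" for x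
  proof (rule B)
    fix i assume "i < d"
    then show "x i \<in> {-pi..pi}"
      using PiE_mem[of x "{..<d}" "\<lambda>_. {-pi..pi}" i] that by (simp only: space_torus lessThan_iff)
  qed
  have mf: "f \<in> borel_measurable (torus_measure d)" by (rule torus_measurable[OF fc fd])
  have mG: "G \<in> borel_measurable (torus_measure d)" by (rule torus_measurable[OF Gc Gd])
  define h where "h x = f x - G x" for x
  have hc: "continuous_on UNIV h" unfolding h_def using fc Gc by (rule continuous_on_diff)
  have hd: "h x = h y" if "\<And>i. i < d \<Longrightarrow> x i = y i" for x y unfolding h_def using fd[OF that] Gd[OF that] by simp
  have int: "h y = 0" if y: "\<And>i. i < d \<Longrightarrow> \<bar>y i\<bar> < pi" for y
  proof (rule fourier_unique_interior[where f=h and d=d and B="B + (\<Sum>\<^sub>\<infinity>jj\<in>multi_idx d. b jj)"])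
    show "h \<in> borel_measurable (torus_measure d)" unfolding h_def using mf mG by (rule borel_measurable_diff)
    show "norm (h x) \<le> B + (\<Sum>\<^sub>\<infinity>jj\<in>multi_idx d. b jj)" if "x \<in> space (torus_measure d)" for x
      unfolding h_def using fB[OF that] Gb[of x] norm_triangle_ineq4[of "f x" "G x"] by linarith
    show "fourier_coeff d h k = 0" for k
      unfolding h_def by (subst fourier_coeff_diff[OF mf fB mG Gb]) (simp_all only: Gf diff_self)
    show "\<exists>\<delta>>0. \<forall>x\<in>space (torus_measure d). (\<forall>i<d. \<bar>x i - y i\<bar> < \<delta>) \<longrightarrow> norm (h x - h y) < e" if "e > 0" for e
      by (rule continuous_delta[where F=h and ?x0.0=y, OF hc hd that]) (auto simp: dist_norm)
  qed (rule y)
  have "h x = 0"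
  proof (rule ccontr)
    assume nz: "h x \<noteq> 0"
    then have e: "norm (h x) > 0" by simp
    obtain \<epsilon> where \<epsilon>: "\<epsilon> > 0" "\<And>y. (\<And>i. i < d \<Longrightarrow> \<bar>y i - x i\<bar> < \<epsilon>) \<Longrightarrow> dist (h y) (h x) < norm (h x)"
      using continuous_delta[where F=h and ?x0.0=x, OF hc hd e] by blast
    \<comment> \<open>Contracting \<open>x\<close> towards the origin by \<open>1 - s\<close> leads
      into the open cube and moves each coordinate by at most \<open>s * pi < \<epsilon>\<close>, as
      \<open>pi < 4\<close>.\<close>
    define s where "s = min (1/2) (\<epsilon> / 4)"
    have s: "0 < s" "s \<le> 1/2" "s \<le> \<epsilon> / 4" using \<epsilon>(1) by (auto simp: s_def)
    define y where "y i = (1 - s) * x i" for i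
    have xi: "\<bar>x i\<bar> \<le> pi" if "i < d" for i using x[OF that] by (auto simp: abs_le_iff)
    have "\<bar>y i\<bar> < pi" if "i < d" for i
    proof -
      have "\<bar>y i\<bar> \<le> (1 - s) * pi" unfolding y_def abs_mult using s xi[OF that] by (intro mult_mono) auto
      also have "\<dots> < pi" using s by simp
      finally show ?thesis .
    qed
    then have "h y = 0" by (rule int)
    moreover have "\<bar>y i - x i\<bar> < \<epsilon>" if "i < d" for i
    proof -
      have "y i - x i = - (s * x i)" by (simp add: y_def algebra_simps)
      then have "\<bar>y i - x i\<bar> = s * \<bar>x i\<bar>" using s by (simp add: abs_mult)
      also have "\<dots> \<le> (\<epsilon> / 4) * pi" using s xi[OF that] by (intro mult_mono) auto
      also have "\<dots> < (\<epsilon> / 4) * 4" using \<epsilon>(1) pi_less_4 by (intro mult_strict_left_mono) auto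
      finally show ?thesis by simp
    qed
    ultimately show False using \<epsilon>(2)[of y] by (simp add: dist_norm)
  qed
  then show ?thesis using Gs[of x] by (simp add: h_def \<delta>_def)
qed

lemma node_in_cube: "u \<in> Ugrid j \<Longrightarrow> node j u \<in> {-pi..pi}"
proof (cases "j = 0")
  case True
  assume "u \<in> Ugrid j" with True show ?thesis by (simp add: Ugrid_def node_def)
next
  case False
  assume "u \<in> Ugrid j"
  with False have u: "- (2 ^ (j - 1)) \<le> u" "u \<le> 2 ^ (j - 1)" by (auto simp: Ugrid_def)
  have p: "(2::real) ^ j = 2 * 2 ^ (j - 1)" using False by (cases j) auto
  have "real_of_int (- (2 ^ (j - 1))) \<le> real_of_int u" "real_of_int u \<le> real_of_int (2 ^ (j - 1))"
    using u by (simp_all only: of_int_le_iff)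
  then have "- 1 \<le> real_of_int u / 2 ^ (j - 1)" "real_of_int u / 2 ^ (j - 1) \<le> 1" by (simp_all add: divide_le_eq le_divide_eq)
  then have "pi * (- 1) \<le> pi * (real_of_int u / 2 ^ (j - 1))" "pi * (real_of_int u / 2 ^ (j - 1)) \<le> pi * 1"
    by (intro mult_left_mono, simp_all only: pi_ge_zero)+
  moreover have "node j u = pi * (real_of_int u / 2 ^ (j - 1))" by (simp add: node_def p)
  ultimately show ?thesis by simp
qed

text \<open>The operator evaluates its argument at finitely many points, whose first
  \<open>d\<close> coordinates are nodes in the cube; convergence there suffices, wherever
  \<open>x\<close> lies.\<close>

lemma qop_has_sum_cube:
  assumes "\<And>y. (\<And>i. i < d \<Longrightarrow> y i \<in> {-pi..pi}) \<Longrightarrow> ((\<lambda>j. g j y) has_sum f y) I"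
  shows "((\<lambda>j. qop d L jj (g j) x) has_sum qop d L jj f x) I"
  unfolding qop_formula
proof (intro has_sum_finite_sum has_sum_cmult_left assms)
  fix u i assume "u \<in> PiE {..<d} (\<lambda>i. Ugrid (jj i))" "i < d"
  then have "u i \<in> Ugrid (jj i)" by (auto dest: PiE_mem)
  then show "qpt d jj u x i \<in> {-pi..pi}" using \<open>i < d\<close> node_in_cube by (simp add: qpt_def)
qed

text \<open>An exponential Markov bound: on the set counted, 1 is at most
  \<open>2 powr ((\<eta> k - M) / 2)\<close>, where \<open>\<eta> k\<close> abbreviates the weighted
  sum. Over the whole box this factorises into geometric sums dominated by their top terms. The
  exponent \<open>1 / 2\<close> spends only half of the decay \<open>2 powr (- \<eta> jj)\<close> of
  the blocks; any fraction strictly between 0 and 1 would do.\<close>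

lemma ibox_count:
  fixes \<eta> :: "nat \<Rightarrow> real"
  assumes \<eta>: "\<And>i. i < d \<Longrightarrow> \<eta> i > 0"
  obtains C where "C > 0" "\<And>jj M. real (card {k \<in> ibox d (\<lambda>i. jj i + c). (\<Sum>i<d. \<eta> i * real (k i)) > M})
     \<le> C * 2 powr (((\<Sum>i<d. \<eta> i * real (jj i)) - M) / 2)"
proof -
  define D where "D i = 2 powr (\<eta> i / 2 * real c) / (1 - 2 powr (- (\<eta> i / 2)))" for i
  have D: "D i > 0" if "i < d" for i
  proof -
    have "2 powr (- (\<eta> i / 2)) < 1" using \<eta>[OF that] by (simp add: powr_less_one)
    then show ?thesis by (simp add: D_def)
  qed
  show ?thesis
  proof (rule that)
    show "(\<Prod>i<d. D i) > 0" using D by (intro prod_pos) auto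
    fix jj :: "nat \<Rightarrow> nat" and M :: real
    let ?S = "{k \<in> ibox d (\<lambda>i. jj i + c). (\<Sum>i<d. \<eta> i * real (k i)) > M}"
    have one: "(\<Sum>j\<le>n + c. 2 powr (\<eta> i / 2 * real j)) \<le> D i * 2 powr (\<eta> i / 2 * real n)" if i: "i < d" for i n
    proof -
      have "(\<Sum>j\<le>n + c. 2 powr (\<eta> i / 2 * real j)) = (\<Sum>t\<le>n + c. 2 powr (\<eta> i / 2 * real (n + c - t)))"
        by (rule sum.nat_diff_reindex[symmetric, of _ "Suc (n + c)", unfolded lessThan_Suc_atMost, simplified])
      also have "\<dots> = (\<Sum>t\<le>n + c. 2 powr (\<eta> i / 2 * real (n + c)) * 2 powr (- (\<eta> i / 2) * real t))"
        by (rule sum.cong) (auto simp: of_nat_diff algebra_simps simp flip: powr_add)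
      also have "\<dots> = 2 powr (\<eta> i / 2 * real (n + c)) * (\<Sum>t\<le>n + c. 2 powr (- (\<eta> i / 2) * real t))"
        by (rule sum_distrib_left[symmetric])
      also have "\<dots> \<le> 2 powr (\<eta> i / 2 * real (n + c)) * (1 / (1 - 2 powr (- (\<eta> i / 2))))"
        using \<eta>[OF i] by (intro mult_left_mono powr_geometric_sum_le) auto
      also have "\<dots> = D i * 2 powr (\<eta> i / 2 * real n)"
        by (simp add: D_def powr_add distrib_left)
      finally show ?thesis .
    qed
    have "real (card ?S) = (\<Sum>k\<in>?S. 1)" by simp
    also have "\<dots> \<le> (\<Sum>k\<in>?S. 2 powr (((\<Sum>i<d. \<eta> i * real (k i)) - M) / 2))"
      by (rule sum_mono) (auto intro!: ge_one_powr_ge_zero)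
    also have "\<dots> \<le> (\<Sum>k\<in>ibox d (\<lambda>i. jj i + c). 2 powr (((\<Sum>i<d. \<eta> i * real (k i)) - M) / 2))"
      by (rule sum_mono2) auto
    also have "\<dots> = (\<Sum>k\<in>ibox d (\<lambda>i. jj i + c). 2 powr (- M / 2) * (\<Prod>i<d. 2 powr (\<eta> i / 2 * real (k i))))"
    proof (rule sum.cong)
      fix k :: "nat \<Rightarrow> nat"
      have "((\<Sum>i<d. \<eta> i * real (k i)) - M) / 2 = - M / 2 + (\<Sum>i<d. \<eta> i / 2 * real (k i))"
        by (simp add: diff_divide_distrib sum_divide_distrib)
      show "2 powr (((\<Sum>i<d. \<eta> i * real (k i)) - M) / 2) = 2 powr (- M / 2) * (\<Prod>i<d. 2 powr (\<eta> i / 2 * real (k i)))"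
        unfolding \<open>_ = - M / 2 + _\<close> powr_add by (subst powr_sum) auto
    qed simp
    also have "\<dots> = 2 powr (- M / 2) * (\<Prod>i<d. \<Sum>j\<le>jj i + c. 2 powr (\<eta> i / 2 * real j))"
      unfolding sum_distrib_left[symmetric] by (simp only: sum_ibox_prod[of "\<lambda>i j. 2 powr (\<eta> i / 2 * real j)"])
    also have "\<dots> \<le> 2 powr (- M / 2) * (\<Prod>i<d. D i * 2 powr (\<eta> i / 2 * real (jj i)))"
      by (intro mult_left_mono prod_mono conjI one sum_nonneg) auto
    also have "\<dots> = (\<Prod>i<d. D i) * 2 powr (((\<Sum>i<d. \<eta> i * real (jj i)) - M) / 2)"
    proof -
      have "((\<Sum>i<d. \<eta> i * real (jj i)) - M) / 2 = - M / 2 + (\<Sum>i<d. \<eta> i / 2 * real (jj i))"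
        by (simp add: diff_divide_distrib sum_divide_distrib)
      then have "2 powr (((\<Sum>i<d. \<eta> i * real (jj i)) - M) / 2) = 2 powr (- M / 2) * (\<Prod>i<d. 2 powr (\<eta> i / 2 * real (jj i)))"
        by (simp only: powr_add) (subst powr_sum, auto)
      then show ?thesis by (simp only: prod.distrib mult_ac)
    qed
    finally show "real (card ?S) \<le> (\<Prod>i<d. D i) * 2 powr (((\<Sum>i<d. \<eta> i * real (jj i)) - M) / 2)" .
  qed
qed

lemma finite_subset_ibox:
  assumes "finite F" "F \<subseteq> multi_idx d"
  obtains n where "F \<subseteq> ibox d (\<lambda>_. n)"
proof
  show "F \<subseteq> ibox d (\<lambda>_. \<Sum>jj\<in>F. \<Sum>i<d. jj i)"
  proof
    fix jj assume jj: "jj \<in> F"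
    have "jj i \<le> (\<Sum>jj\<in>F. \<Sum>i<d. jj i)" if "i < d" for i
    proof -
      have "jj i \<le> (\<Sum>i<d. jj i)" by (rule member_le_sum) (use that in auto)
      also have "\<dots> \<le> (\<Sum>jj\<in>F. \<Sum>i<d. jj i)" by (rule member_le_sum) (use jj assms in auto)
      finally show ?thesis .
    qed
    then show "jj \<in> ibox d (\<lambda>_. \<Sum>jj\<in>F. \<Sum>i<d. jj i)" using jj assms by (auto simp: ibox_def)
  qed
qed

text \<open>For \<open>p \<le> 1\<close> the weights are bounded by \<open>2 powr (c / 2)\<close>
  and \<ell>_p embeds into \<ell>_1, so \<open>m\<close> does not appear. For \<open>p > 1\<close>
  Hoelder takes the weights in \<ell>_s with the conjugate exponent; their layer sum is of order
  \<open>m ^ (\<mu> - 1)\<close>, and its root \<open>1/s = 1 - 1/p\<close> is the exponent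
  sought.\<close>

lemma layer_holder:
  fixes a c p :: real and \<eta> \<sigma> :: "nat \<Rightarrow> real"
  assumes p: "p > 0" and \<mu>: "1 \<le> \<mu>" "\<mu> \<le> d" and a: "a > 0" and c: "c \<ge> 0"
    and \<eta>: "\<And>i. i < d \<Longrightarrow> \<eta> i > 0" "\<And>i. i < \<mu> \<Longrightarrow> \<eta> i = a"
    and \<sigma>: "\<And>i. i < \<mu> \<Longrightarrow> \<sigma> i = 0" "\<And>i. \<mu> \<le> i \<Longrightarrow> i < d \<Longrightarrow> \<sigma> i > 0"
  defines "V \<equiv> \<lambda>m jj. if (\<Sum>i<d. \<eta> i * real (jj i)) - a * real m > - c
       then 2 powr (- (((\<Sum>i<d. \<eta> i * real (jj i)) - a * real m) / 2)) * 2 powr (- (\<Sum>i<d. \<sigma> i * real (jj i))) else 0"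
  obtains C where "C > 0" "\<And>m F B. m \<ge> 1 \<Longrightarrow> finite F \<Longrightarrow> F \<subseteq> multi_idx d \<Longrightarrow> (\<And>jj. 0 \<le> B jj) \<Longrightarrow>
    (\<Sum>jj\<in>F. V m jj * B jj) \<le> C * real m powr (real (\<mu> - 1) * max (1 - 1/p) 0) * lnorm p F B"
proof (cases "p \<le> 1")
  case True
  have \<sigma>0: "\<sigma> i \<ge> 0" if "i < d" for i using \<sigma>(1)[of i] \<sigma>(2)[of i] that by (cases "i < \<mu>") auto
  have V: "0 \<le> V m jj" "V m jj \<le> 2 powr (c / 2)" for m jj
  proof -
    show "0 \<le> V m jj" by (simp add: V_def)
    have "(\<Sum>i<d. \<sigma> i * real (jj i)) \<ge> 0" using \<sigma>0 by (intro sum_nonneg) auto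
    then have "2 powr (- (\<Sum>i<d. \<sigma> i * real (jj i))) \<le> 2 powr 0" by (intro powr_mono) auto
    moreover have "2 powr (- (((\<Sum>i<d. \<eta> i * real (jj i)) - a * real m) / 2)) \<le> 2 powr (c / 2)"
      if "(\<Sum>i<d. \<eta> i * real (jj i)) - a * real m > - c"
    proof -
      have "- (X / 2) \<le> c / 2" if "X > - c" for X :: real using that by simp
      from this[OF that] show ?thesis by (intro powr_mono) auto
    qed
    ultimately show "V m jj \<le> 2 powr (c / 2)"
      unfolding V_def using mult_mono[of _ "2 powr (c/2)" _ "1::real"] by auto
  qed
  show ?thesis
  proof (rule that[of "2 powr (c / 2)"])
    fix m :: nat and F :: "(nat \<Rightarrow> nat) set" and B :: "(nat \<Rightarrow> nat) \<Rightarrow> real"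
    assume m: "m \<ge> 1" and F: "finite F" and B: "\<And>jj. 0 \<le> B jj"
    have "(\<Sum>jj\<in>F. V m jj * B jj) \<le> (\<Sum>jj\<in>F. 2 powr (c / 2) * B jj)"
      by (intro sum_mono mult_right_mono V B)
    also have "\<dots> = 2 powr (c / 2) * lnorm 1 F B" using B by (simp add: lnorm_def sum_nonneg sum_distrib_left)
    also have "\<dots> \<le> 2 powr (c / 2) * lnorm p F B" using True p F B by (intro mult_left_mono lnorm_antimono) auto
    finally show "(\<Sum>jj\<in>F. V m jj * B jj) \<le> 2 powr (c / 2) * real m powr (real (\<mu> - 1) * max (1 - 1/p) 0) * lnorm p F B"
      using True p m by (simp add: max_def)
  qed simp
next
  case False
  then have p1: "p > 1" by simp
  define s where "s = p / (p - 1)"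
  have s: "s > 0" "1/p + 1/s = 1" "1/s = 1 - 1/p" using p1 by (auto simp: s_def field_simps)
  have s2: "s / 2 > 0" using s by simp
  have \<sigma>': "s * \<sigma> i = 0" if "i < \<mu>" for i using \<sigma>(1) that by simp
  have \<sigma>'': "s * \<sigma> i > 0" if "\<mu> \<le> i" "i < d" for i using \<sigma>(2) that s by simp
  show ?thesis
  proof (rule hyperbolic_layer_sum[where d=d and \<mu>=\<mu> and a=a and \<beta>="s/2" and c=c and \<eta>=\<eta> and \<sigma>="\<lambda>i. s * \<sigma> i", OF \<mu> a s2 c \<eta> \<sigma>' \<sigma>''])
    fix C assume C: "C > 0" and hl: "\<And>m n. m \<ge> 1 \<Longrightarrow>
      (\<Sum>v\<in>PiE {..<d} (\<lambda>_. {..n}). if (\<Sum>i<d. \<eta> i * real (v i)) - a * real m > - c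
       then 2 powr (- (s/2) * ((\<Sum>i<d. \<eta> i * real (v i)) - a * real m)) * 2 powr (- (\<Sum>i<d. s * \<sigma> i * real (v i))) else 0)
     \<le> C * real m ^ (\<mu> - 1)"
    show thesis
    proof (rule that[of "C powr (1/s)"])
      show "C powr (1/s) > 0" using C by simp
      fix m :: nat and F :: "(nat \<Rightarrow> nat) set" and B :: "(nat \<Rightarrow> nat) \<Rightarrow> real"
      assume m: "m \<ge> 1" and F: "finite F" "F \<subseteq> multi_idx d" and B: "\<And>jj. 0 \<le> B jj"
      have V0: "0 \<le> V m jj" for jj by (simp add: V_def)
      obtain n where n: "F \<subseteq> ibox d (\<lambda>_. n)" using finite_subset_ibox[OF F] by blast
      have Vs: "V m jj powr s = (if (\<Sum>i<d. \<eta> i * real (jj i)) - a * real m > - c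
       then 2 powr (- (s/2) * ((\<Sum>i<d. \<eta> i * real (jj i)) - a * real m)) * 2 powr (- (\<Sum>i<d. s * \<sigma> i * real (jj i))) else 0)" for jj
      proof -
        have "(2 powr (- (X / 2)) * 2 powr (- Y)) powr s = 2 powr (- (s/2) * X) * 2 powr (- (s * Y))" for X Y :: real
          by (simp add: powr_mult powr_powr mult.commute)
        then show ?thesis by (simp add: V_def sum_distrib_left mult.assoc)
      qed
      have "(\<Sum>jj\<in>F. V m jj powr s) \<le> (\<Sum>jj\<in>ibox d (\<lambda>_. n). V m jj powr s)"
        by (rule sum_mono2) (use n in auto)
      also have "\<dots> = (\<Sum>jj\<in>ibox d (\<lambda>_. n). V m (restrict jj {..<d}) powr s)"
        by (rule sum.cong) (auto simp: V_def)
      also have "\<dots> = (\<Sum>v\<in>PiE {..<d} (\<lambda>_. {..n}). V m v powr s)"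
        by (rule sum.reindex_bij_betw[OF ibox_bij])
      also have "\<dots> \<le> C * real m ^ (\<mu> - 1)" unfolding Vs by (rule hl[OF m])
      finally have Vsum: "(\<Sum>jj\<in>F. V m jj powr s) powr (1/s) \<le> (C * real m ^ (\<mu> - 1)) powr (1/s)"
        using s(1) by (intro powr_mono2) (auto intro!: sum_nonneg)
      have mp: "(C * real m ^ (\<mu> - 1)) powr (1/s) = C powr (1/s) * real m powr (real (\<mu> - 1) * max (1 - 1/p) 0)"
      proof -
        have "real m ^ (\<mu> - 1) = real m powr real (\<mu> - 1)" using m by (simp add: powr_realpow)
        moreover have "max (1 - 1/p) 0 = 1/s" using p1 s by (simp add: max_def)
        ultimately show ?thesis by (simp add: powr_mult powr_powr)
      qed
      have "(\<Sum>jj\<in>F. V m jj * B jj) = (\<Sum>jj\<in>F. B jj * V m jj)" by (simp add: mult.commute)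
      also have "\<dots> \<le> (\<Sum>jj\<in>F. B jj powr p) powr (1/p) * (\<Sum>jj\<in>F. V m jj powr s) powr (1/s)"
        by (rule holder_sum) (use F p1 s B V0 in auto)
      also have "\<dots> \<le> lnorm p F B * (C * real m ^ (\<mu> - 1)) powr (1/s)"
        unfolding lnorm_def by (intro mult_left_mono Vsum) auto
      finally show "(\<Sum>jj\<in>F. V m jj * B jj) \<le> C powr (1/s) * real m powr (real (\<mu> - 1) * max (1 - 1/p) 0) * lnorm p F B"
        unfolding mp by (simp add: mult_ac)
    qed
  qed
qed

theorem theorem6:
  fixes d \<mu> L :: nat and p :: real and \<theta> :: ennreal and r \<nu> :: "nat \<Rightarrow> real"
    and phi :: "nat \<Rightarrow> real \<Rightarrow> real"
  assumes "0 < p" and "0 < \<theta>" and "1 \<le> L"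
    and "1 \<le> \<mu>" and "\<mu> \<le> d"
    and "\<forall>s<\<mu>. r s = r 0"
    and "\<forall>s. \<mu> \<le> s \<and> s < d \<longrightarrow> r 0 < r s"
    and "\<forall>s t. s \<le> t \<and> t < d \<longrightarrow> r s \<le> r t"
    and "r 0 > 1 / p"
    and "\<forall>s<\<mu>. \<nu> s = r s"
    and "\<forall>s. \<mu> \<le> s \<and> s < d \<longrightarrow> r 0 < \<nu> s \<and> \<nu> s < r s"
    and "admissible phi"
  shows "\<exists>C>0. \<forall>m\<ge>1. \<forall>f. torus_fun d f \<and> SF_norm phi d r p \<theta> f < \<infinity> \<longrightarrow>
           Linf_norm d (\<lambda>x. f x - smolyak d L (\<lambda>s. \<nu> s - 1 / p) m f x)
             \<le> ennreal (C * real m powr (real (\<mu> - 1) * max (1 - 1 / p) 0)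
                         * 2 powr (- real m * (r 0 - 1 / p))) * SF_norm phi d r p \<theta> f"
proof -
  define \<eta> where "\<eta> = (\<lambda>s. \<nu> s - 1 / p)"
  \<comment> \<open>The embedding provides decay at the rates
    \<open>r i - 1/p = \<eta> i + \<sigma> i\<close>: \<eta> shapes the layers, \<sigma> is the
    surplus in the directions beyond \<mu>.\<close>
  define \<sigma> where "\<sigma> s = r s - \<nu> s" for s
  define a where "a = r 0 - 1 / p"
  have a: "a > 0" using assms(9) by (simp add: a_def)
  have \<eta>a: "\<eta> i = a" if "i < \<mu>" for i
  proof -
    have "\<nu> i = r i" "r i = r 0" using assms(6,10) that by blast+
    then show ?thesis by (simp add: \<eta>_def a_def)
  qed
  have \<eta>0: "\<eta> i > 0" if "i < d" for i
  proof (cases "i < \<mu>")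
    case True then show ?thesis using \<eta>a a by simp
  next
    case False
    then have "r 0 < \<nu> i" using assms(11) that by simp
    then show ?thesis using a by (simp add: \<eta>_def a_def)
  qed
  have \<sigma>: "\<And>i. i < \<mu> \<Longrightarrow> \<sigma> i = 0" "\<And>i. \<mu> \<le> i \<Longrightarrow> i < d \<Longrightarrow> \<sigma> i > 0"
    using assms(10,11) by (auto simp: \<sigma>_def)
  have \<sigma>0: "\<sigma> i \<ge> 0" if "i < d" for i using \<sigma>(1)[of i] \<sigma>(2)[of i] that by (cases "i < \<mu>") auto
  \<comment> \<open>\<open>q > p\<close> is required by the embedding and \<open>q > 1\<close> by
    Hoelder against the kernels.\<close>
  define q where "q = max p 1 + 1"
  have q: "q > 1" "q > p" by (auto simp: q_def)
  \<comment> \<open>Oversampling by \<open>L + 1\<close> levels is what interpolation at level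
    \<open>jj i + c\<close> needs in order to reproduce the block.\<close>
  obtain c where fs: "freq_shift phi (L + 1) c" using admissible_freq_shift[OF assms(12)] by blast
  have cL: "L + 1 \<le> c" using fs by (simp add: freq_shift_def)
  define \<eta>s where "\<eta>s jj = (\<Sum>i<d. \<eta> i * real (jj i))" for jj :: "nat \<Rightarrow> nat"
  define \<sigma>s where "\<sigma>s jj = (\<Sum>i<d. \<sigma> i * real (jj i))" for jj :: "nat \<Rightarrow> nat"
  have \<eta>s0: "\<eta>s jj \<ge> 0" for jj unfolding \<eta>s_def using \<eta>0 by (intro sum_nonneg) (auto simp: less_imp_le)
  have \<sigma>s0: "\<sigma>s jj \<ge> 0" for jj unfolding \<sigma>s_def using \<sigma>0 by (intro sum_nonneg) auto
  \<comment> \<open>The amount by which the index sum can grow from \<open>jj\<close> to any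
    \<open>k \<le> jj + c\<close>. Blocks lying deeper than \<open>c'\<close> below the layer are
    reproduced exactly.\<close>
  define c' where "c' = (\<Sum>i<d. \<eta> i * real c)"
  have c': "c' \<ge> 0" unfolding c'_def using \<eta>0 by (intro sum_nonneg) (auto simp: less_imp_le)
  define V where "V m jj = (if \<eta>s jj - a * real m > - c' then 2 powr (- ((\<eta>s jj - a * real m) / 2)) * 2 powr (- \<sigma>s jj) else 0)"
    for m :: nat and jj
  define \<delta> where "\<delta> f jj = delta_op phi d jj f" for f jj
  define Q where "Q f jj = lnorm q (dgrid d (\<lambda>i. jj i + c)) (\<lambda>n. norm (\<delta> f jj (gpt (\<lambda>i. jj i + c) n)))" for f jj
  define B where "B f jj = 2 powr (\<Sum>i<d. (r i - 1/p) * real (jj i)) * Q f jj" for f jj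
  have Q0: "Q f jj \<ge> 0" and B0: "B f jj \<ge> 0" for f jj by (simp_all add: Q_def B_def)
  have QB: "Q f jj = 2 powr (- (\<eta>s jj + \<sigma>s jj)) * B f jj" for f jj
  proof -
    have "(\<Sum>i<d. (r i - 1/p) * real (jj i)) = \<eta>s jj + \<sigma>s jj"
      unfolding \<eta>s_def \<sigma>s_def \<eta>_def \<sigma>_def sum.distrib[symmetric] by (rule sum.cong) (auto simp: algebra_simps)
    then have "B f jj = 2 powr (\<eta>s jj + \<sigma>s jj) * Q f jj" by (simp only: B_def)
    then show ?thesis
      by (simp add: mult.assoc[symmetric] powr_add[symmetric] del: minus_add_distrib)
  qed
  have tp: "trigpoly d (\<lambda>i. 2 ^ (jj i + c - (L + 1))) (\<delta> f jj)" for f jj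
    unfolding \<delta>_def by (rule delta_op_trigpoly[OF fs])
  have lc: "L + 1 \<le> jj i + c" for jj :: "nat \<Rightarrow> nat" and i using cL by simp
  show ?thesis
  proof (rule jawerth_embedding[OF assms(1) q(2) assms(2) fs, where d=d and r=r])
    fix C1 :: real
    assume C1: "C1 > 0" and "\<And>f F. SF_norm phi d r p \<theta> f < \<infinity> \<Longrightarrow> finite F \<Longrightarrow> F \<subseteq> multi_idx d \<Longrightarrow>
      (\<Sum>jj\<in>F. (2 powr (\<Sum>i<d. (r i - 1/p) * real (jj i)) * lnorm q (dgrid d (\<lambda>i. jj i + c)) (\<lambda>n. norm (delta_op phi d jj f (gpt (\<lambda>i. jj i + c) n)))) powr p)
      \<le> C1 * (enn2real (SF_norm phi d r p \<theta> f)) powr p"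
    then have jaw: "(\<Sum>jj\<in>F. B f jj powr p) \<le> C1 * (enn2real (SF_norm phi d r p \<theta> f)) powr p"
      if "SF_norm phi d r p \<theta> f < \<infinity>" "finite F" "F \<subseteq> multi_idx d" for f F
      unfolding B_def Q_def \<delta>_def using that by blast
    show ?thesis
    proof (rule qop_bound[OF assms(3) q(1), where d=d])
      fix C2 :: real
      assume C2: "C2 > 0" and qb: "\<And>jj l g x. (\<And>i. i < d \<Longrightarrow> jj i \<le> l i) \<Longrightarrow> (\<And>i. i < d \<Longrightarrow> 1 \<le> l i) \<Longrightarrow>
        (\<And>x y. (\<forall>i<d. x i = y i) \<Longrightarrow> g x = g y) \<Longrightarrow>
        norm (qop d L jj g x) \<le> C2 * lnorm q (dgrid d l) (\<lambda>n. norm (g (gpt l n)))"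
      obtain C3 where C3: "C3 > 0" and "\<And>jj M. real (card {k \<in> ibox d (\<lambda>i. jj i + c). (\<Sum>i<d. \<eta> i * real (k i)) > M})
        \<le> C3 * 2 powr (((\<Sum>i<d. \<eta> i * real (jj i)) - M) / 2)"
        using ibox_count[of d \<eta> c] \<eta>0 by blast
      then have cnt: "real (card {k \<in> ibox d (\<lambda>i. jj i + c). \<eta>s k > M}) \<le> C3 * 2 powr ((\<eta>s jj - M) / 2)" for jj M
        by (simp add: \<eta>s_def)
      show ?thesis
      proof (rule layer_holder[where \<eta>=\<eta> and \<sigma>=\<sigma> and d=d and c=c' and a=a, OF assms(1,4,5) a c' \<eta>0 \<eta>a \<sigma>])
        fix C4 :: real
        assume C4: "C4 > 0" and "\<And>m F B. m \<ge> 1 \<Longrightarrow> finite F \<Longrightarrow> F \<subseteq> multi_idx d \<Longrightarrow> (\<And>jj. 0 \<le> B jj) \<Longrightarrow>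
          (\<Sum>jj\<in>F. (if (\<Sum>i<d. \<eta> i * real (jj i)) - a * real m > - c'
             then 2 powr (- (((\<Sum>i<d. \<eta> i * real (jj i)) - a * real m) / 2)) * 2 powr (- (\<Sum>i<d. \<sigma> i * real (jj i))) else 0) * B jj)
          \<le> C4 * real m powr (real (\<mu> - 1) * max (1 - 1/p) 0) * lnorm p F B"
        then have lay: "(\<Sum>jj\<in>F. V m jj * B f jj) \<le> C4 * real m powr (real (\<mu> - 1) * max (1 - 1/p) 0) * lnorm p F (B f)"
          if "m \<ge> 1" "finite F" "F \<subseteq> multi_idx d" for m F f
          unfolding V_def \<eta>s_def \<sigma>s_def using that B0 by blast
        define C where "C = C2 * C3 * C4 * C1 powr (1/p)"
        have C: "C > 0" using C1 C2 C3 C4 by (simp add: C_def)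
        have main: "norm (f x - smolyak d L \<eta> m f x) \<le> C * real m powr (real (\<mu> - 1) * max (1 - 1/p) 0) * 2 powr (- real m * a) * enn2real (SF_norm phi d r p \<theta> f)"
          if m: "m \<ge> 1" and tf: "torus_fun d f" and fin: "SF_norm phi d r p \<theta> f < \<infinity>" and x: "x \<in> torus_cube d" for m f x
        proof -
          define N where "N = enn2real (SF_norm phi d r p \<theta> f)"
          have N0: "N \<ge> 0" by (simp add: N_def)
          have BN: "lnorm p F (B f) \<le> C1 powr (1/p) * N" if "finite F" "F \<subseteq> multi_idx d" for F
          proof -
            have "lnorm p F (B f) \<le> (C1 * N powr p) powr (1/p)"
              unfolding lnorm_def N_def using jaw[OF fin that] assms(1) by (intro powr_mono2) (auto intro!: sum_nonneg)
            also have "\<dots> = C1 powr (1/p) * N" using C1 N0 assms(1) by (simp add: powr_mult powr_powr)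
            finally show ?thesis .
          qed
          have B1: "B f jj \<le> C1 powr (1/p) * N" if "jj \<in> multi_idx d" for jj
            using BN[of "{jj}"] that assms(1) B0 by (simp add: lnorm_def powr_powr)
          define \<Delta> where "\<Delta> = {jj \<in> multi_idx d. \<eta>s jj \<le> a * real m}"
          have \<eta>00: "\<eta> 0 = a" using \<eta>a assms(4) by simp
          have sm: "smolyak d L \<eta> m g x = (\<Sum>kk\<in>\<Delta>. qop d L kk g x)" for g
            unfolding smolyak_def \<Delta>_def \<eta>s_def \<eta>00 ..
          have f\<Delta>: "finite \<Delta>"
          proof (rule finite_subset)
            show "\<Delta> \<subseteq> ibox d (\<lambda>i. nat \<lceil>a * real m / \<eta> i\<rceil>)"
            proof
              fix jj assume jj: "jj \<in> \<Delta>"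
              have "jj i \<le> nat \<lceil>a * real m / \<eta> i\<rceil>" if i: "i < d" for i
              proof -
                have "\<eta> i * real (jj i) \<le> \<eta>s jj" unfolding \<eta>s_def
                  by (rule member_le_sum) (use i \<eta>0 in \<open>auto simp: less_imp_le\<close>)
                also have "\<dots> \<le> a * real m" using jj by (simp add: \<Delta>_def)
                finally have "real (jj i) \<le> a * real m / \<eta> i" using \<eta>0[OF i] by (simp add: pos_le_divide_eq mult.commute)
                then show ?thesis by linarith
              qed
              then show "jj \<in> ibox d (\<lambda>i. nat \<lceil>a * real m / \<eta> i\<rceil>)" using jj by (simp add: ibox_def \<Delta>_def)
            qed
          qed simp
          have qb': "norm (qop d L kk (\<delta> f jj) y) \<le> C2 * Q f jj" if "kk \<in> ibox d (\<lambda>i. jj i + c)" for kk jj y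
            unfolding Q_def
          proof (rule qb)
            show "kk i \<le> jj i + c" if "i < d" for i using that \<open>kk \<in> _\<close> by (simp add: ibox_def)
            show "1 \<le> jj i + c" if "i < d" for i using cL by simp
            show "\<delta> f jj x = \<delta> f jj y" if "\<forall>i<d. x i = y i" for x y by (rule trigpoly_cong[OF tp]) (use that in auto)
          qed
          have full: "(\<Sum>kk\<in>ibox d (\<lambda>i. jj i + c). qop d L kk (\<delta> f jj) y) = \<delta> f jj y" for jj y
            by (rule qop_trigpoly_sum[OF assms(3) lc tp])
          have tailb: "norm (\<Sum>kk\<in>{k \<in> ibox d (\<lambda>i. jj i + c). \<eta>s k > M}. qop d L kk (\<delta> f jj) y)
            \<le> real (card {k \<in> ibox d (\<lambda>i. jj i + c). \<eta>s k > M}) * (C2 * Q f jj)" for jj y M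
            by (rule sum_norm_bound) (use qb' in auto)
          \<comment> \<open>Indices of \<open>\<Delta>\<close> outside the box of the block
            contribute 0, and the full box reproduces the block; the error is thus the sum over the
            part of the box beyond the layer.\<close>
          have err: "norm (\<delta> f jj x - (\<Sum>kk\<in>\<Delta>. qop d L kk (\<delta> f jj) x)) \<le> real (card {k \<in> ibox d (\<lambda>i. jj i + c). \<eta>s k > a * real m}) * (C2 * Q f jj)" for jj
          proof -
            let ?I = "ibox d (\<lambda>i. jj i + c)"
            have "(\<Sum>kk\<in>\<Delta>. qop d L kk (\<delta> f jj) x) = (\<Sum>kk\<in>?I \<inter> \<Delta>. qop d L kk (\<delta> f jj) x)"
            proof (rule sum.mono_neutral_right[OF f\<Delta>])
              show "\<forall>kk\<in>\<Delta> - ?I \<inter> \<Delta>. qop d L kk (\<delta> f jj) x = 0"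
              proof
                fix kk assume "kk \<in> \<Delta> - ?I \<inter> \<Delta>"
                then obtain i where "i < d" "jj i + c < kk i" by (auto simp: \<Delta>_def ibox_def not_le)
                then show "qop d L kk (\<delta> f jj) x = 0" by (rule qop_trigpoly_zero[OF assms(3) lc tp])
              qed
            qed auto
            moreover have "(\<Sum>kk\<in>?I. qop d L kk (\<delta> f jj) x) = (\<Sum>kk\<in>?I \<inter> \<Delta>. qop d L kk (\<delta> f jj) x) + (\<Sum>kk\<in>?I - \<Delta>. qop d L kk (\<delta> f jj) x)"
              by (subst sum.union_disjoint[symmetric]) (auto intro!: sum.cong)
            moreover have "?I - \<Delta> = {k \<in> ?I. \<eta>s k > a * real m}" by (auto simp: \<Delta>_def ibox_def)
            ultimately have "\<delta> f jj x - (\<Sum>kk\<in>\<Delta>. qop d L kk (\<delta> f jj) x) = (\<Sum>kk\<in>{k \<in> ?I. \<eta>s k > a * real m}. qop d L kk (\<delta> f jj) x)"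
              using full[of jj x] by simp
            then show ?thesis using tailb by simp
          qed
          \<comment> \<open>A crude summable bound for the blocks: up to constants, a box of at most
            \<open>2 powr (\<eta>s jj / 2)\<close> indices times the sample bound
            \<open>2 powr (- \<eta>s jj)\<close>. Its only purpose is absolute convergence of the
            series of blocks; it does not involve \<open>m\<close>.\<close>
          define K where "K = C3 * 2 powr (1/2) * C2 * (C1 powr (1/p) * N)"
          define b where "b jj = K * (\<Prod>i<d. 2 powr (- (\<eta> i / 2) * real (jj i)))" for jj :: "nat \<Rightarrow> nat"
          have K0: "K \<ge> 0" using C1 C2 C3 N0 by (simp add: K_def)
          have b_eq: "b jj = K * 2 powr (- (\<eta>s jj / 2))" for jj
          proof -
            have "- (\<eta>s jj / 2) = (\<Sum>i<d. - (\<eta> i / 2) * real (jj i))"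
              by (simp add: \<eta>s_def sum_divide_distrib sum_negf)
            then show ?thesis unfolding b_def by (simp only:) (subst powr_sum, auto)
          qed
          have bnd: "norm (delta_op phi d jj f y) \<le> b jj" if jj: "jj \<in> multi_idx d" for jj y
          proof -
            \<comment> \<open>With the negative threshold \<open>- 1\<close> the strict condition
              holds for every index, so the tail bounds apply to the complete box.\<close>
            have all: "{k \<in> ibox d (\<lambda>i. jj i + c). \<eta>s k > - 1} = ibox d (\<lambda>i. jj i + c)"
            proof -
              have "- 1 < \<eta>s k" for k using \<eta>s0[of k] by linarith
              then show ?thesis by auto
            qed
            have "norm (delta_op phi d jj f y) \<le> real (card {k \<in> ibox d (\<lambda>i. jj i + c). \<eta>s k > - 1}) * (C2 * Q f jj)"
              using tailb[where jj=jj and M="-1" and y=y] unfolding all full by (simp add: \<delta>_def)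
            also have "\<dots> \<le> (C3 * 2 powr ((\<eta>s jj - (- 1)) / 2)) * (C2 * Q f jj)"
              using C2 Q0 by (intro mult_right_mono cnt) auto
            also have "Q f jj \<le> 2 powr (- \<eta>s jj) * (C1 powr (1/p) * N)"
              unfolding QB using B1[OF jj] B0 \<sigma>s0[of jj] by (intro mult_mono powr_mono) auto
            also have "(C3 * 2 powr ((\<eta>s jj - (- 1)) / 2)) * (C2 * (2 powr (- \<eta>s jj) * (C1 powr (1/p) * N))) = b jj"
            proof -
              have "2 powr ((\<eta>s jj - (- 1)) / 2) * 2 powr (- \<eta>s jj) = 2 powr (1/2) * 2 powr (- (\<eta>s jj / 2))"
                unfolding powr_add[symmetric] by (simp add: field_simps)
              then have "C3 * C2 * (C1 powr (1/p) * N) * (2 powr ((\<eta>s jj - (- 1)) / 2) * 2 powr (- \<eta>s jj)) = b jj"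
                unfolding b_eq K_def by (simp only: mult_ac)
              then show ?thesis by (simp only: mult_ac)
            qed
            finally show ?thesis using C2 C3 by (simp add: mult_left_mono)
          qed
          have bs: "b summable_on multi_idx d"
          proof (rule nonneg_bdd_above_summable_on)
            show "b jj \<ge> 0" for jj unfolding b_eq using K0 by simp
            show "bdd_above (sum b ` {F. F \<subseteq> multi_idx d \<and> finite F})"
            proof (rule bdd_aboveI2)
              fix F assume "F \<in> {F. F \<subseteq> multi_idx d \<and> finite F}"
              then have F: "finite F" "F \<subseteq> multi_idx d" by auto
              obtain n where n: "F \<subseteq> ibox d (\<lambda>_. n)" using finite_subset_ibox[OF F] by blast
              have "sum b F \<le> sum b (ibox d (\<lambda>_. n))"
                by (rule sum_mono2) (use n K0 in \<open>auto simp: b_eq\<close>)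
              also have "\<dots> = K * (\<Prod>i<d. \<Sum>j\<le>n. 2 powr (- (\<eta> i / 2) * real j))"
                unfolding b_def sum_distrib_left[symmetric] by (simp only: sum_ibox_prod[of "\<lambda>i j. 2 powr (- (\<eta> i / 2) * real j)"])
              also have "\<dots> \<le> K * (\<Prod>i<d. 1 / (1 - 2 powr (- (\<eta> i / 2))))"
                using K0 \<eta>0 by (intro mult_left_mono prod_mono conjI powr_geometric_sum_le sum_nonneg) auto
              finally show "sum b F \<le> K * (\<Prod>i<d. 1 / (1 - 2 powr (- (\<eta> i / 2))))" .
            qed
          qed
          have rep: "((\<lambda>jj. \<delta> f jj y) has_sum f y) (multi_idx d)" if "\<And>i. i < d \<Longrightarrow> y i \<in> {-pi..pi}" for y
            unfolding \<delta>_def by (rule torus_representation[OF assms(12) tf fs bnd bs that])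
          \<comment> \<open>Half of the decay beyond the layer compensates the number of operators
            that miss the block; the other half together with the surplus \<sigma> is
            \<open>V\<close>, and the rate \<open>2 powr (- real m * a)\<close> splits off.\<close>
          have term_bound: "norm (\<delta> f jj x - (\<Sum>kk\<in>\<Delta>. qop d L kk (\<delta> f jj) x)) \<le> C2 * C3 * 2 powr (- real m * a) * (V m jj * B f jj)" for jj
          proof (cases "\<eta>s jj - a * real m > - c'")
            case True
            have "norm (\<delta> f jj x - (\<Sum>kk\<in>\<Delta>. qop d L kk (\<delta> f jj) x)) \<le> (C3 * 2 powr ((\<eta>s jj - a * real m) / 2)) * (C2 * Q f jj)"
              using C2 Q0 by (intro order_trans[OF err] mult_right_mono cnt) auto
            also have "\<dots> = C2 * C3 * (2 powr ((\<eta>s jj - a * real m) / 2) * 2 powr (- (\<eta>s jj + \<sigma>s jj))) * B f jj"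
              unfolding QB by (simp add: mult_ac)
            also have "2 powr ((\<eta>s jj - a * real m) / 2) * 2 powr (- (\<eta>s jj + \<sigma>s jj)) = 2 powr (- real m * a) * V m jj"
              using True unfolding V_def by (simp add: field_simps flip: powr_add)
            finally show ?thesis by (simp add: mult_ac)
          next
            case False
            have em: "{k \<in> ibox d (\<lambda>i. jj i + c). \<eta>s k > a * real m} = {}"
            proof (rule ccontr)
              assume "\<not> ?thesis"
              then obtain k where k: "k \<in> ibox d (\<lambda>i. jj i + c)" "\<eta>s k > a * real m" by blast
              have "\<eta>s k \<le> (\<Sum>i<d. \<eta> i * (real (jj i) + real c))"
                unfolding \<eta>s_def using k(1) \<eta>0 by (intro sum_mono mult_left_mono) (auto simp: ibox_def less_imp_le simp flip: of_nat_add)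
              also have "\<dots> = \<eta>s jj + c'" by (simp add: \<eta>s_def c'_def distrib_left sum.distrib)
              finally show False using False k(2) by simp
            qed
            show ?thesis using False err[of jj] unfolding em by (simp add: V_def)
          qed
          have xc: "x i \<in> {-pi..pi}" if "i < d" for i using x that by (simp add: torus_cube_def)
          \<comment> \<open>The Smolyak operator is a finite combination of point evaluations in the
            cube, so it may be applied to the series termwise.\<close>
          have hs: "((\<lambda>jj. \<delta> f jj x - (\<Sum>kk\<in>\<Delta>. qop d L kk (\<delta> f jj) x)) has_sum (f x - (\<Sum>kk\<in>\<Delta>. qop d L kk f x))) (multi_idx d)"
            unfolding diff_conv_add_uminus
            by (intro has_sum_add rep[OF xc] iffD2[OF has_sum_uminus]) (simp_all, intro has_sum_finite_sum qop_has_sum_cube rep)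
          define R where "R = C * real m powr (real (\<mu> - 1) * max (1 - 1/p) 0) * 2 powr (- real m * a) * N"
          have part: "norm (\<Sum>jj\<in>F. \<delta> f jj x - (\<Sum>kk\<in>\<Delta>. qop d L kk (\<delta> f jj) x)) \<le> R" if F: "finite F" "F \<subseteq> multi_idx d" for F
          proof -
            have "norm (\<Sum>jj\<in>F. \<delta> f jj x - (\<Sum>kk\<in>\<Delta>. qop d L kk (\<delta> f jj) x)) \<le> (\<Sum>jj\<in>F. C2 * C3 * 2 powr (- real m * a) * (V m jj * B f jj))"
              by (rule order_trans[OF norm_sum]) (intro sum_mono term_bound)
            also have "\<dots> = C2 * C3 * 2 powr (- real m * a) * (\<Sum>jj\<in>F. V m jj * B f jj)" by (rule sum_distrib_left[symmetric])
            also have "\<dots> \<le> C2 * C3 * 2 powr (- real m * a) * (C4 * real m powr (real (\<mu> - 1) * max (1 - 1/p) 0) * (C1 powr (1/p) * N))"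
              using C2 C3 C4 by (intro mult_left_mono order_trans[OF lay[OF m F]] BN F) auto
            also have "\<dots> = R" by (simp add: R_def C_def mult_ac)
            finally show ?thesis .
          qed
          \<comment> \<open>The bound \<open>R\<close> is uniform over finite sets of blocks, hence
            passes to the limit; this is why the embedding is needed only for finite
            families.\<close>
          have "norm (f x - (\<Sum>kk\<in>\<Delta>. qop d L kk f x)) \<le> R"
          proof (rule Lim_norm_ubound[OF _ hs[unfolded has_sum_def]])
            show "\<forall>\<^sub>F F in finite_subsets_at_top (multi_idx d). norm (\<Sum>jj\<in>F. \<delta> f jj x - (\<Sum>kk\<in>\<Delta>. qop d L kk (\<delta> f jj) x)) \<le> R"
              by (rule eventually_finite_subsets_at_top_weakI) (rule part)
          qed simp
          then show ?thesis by (simp only: sm R_def N_def)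
        qed
        show ?thesis
        proof (intro exI[of _ C] conjI allI impI, rule C)
          fix m :: nat and f
          assume m: "1 \<le> m" and f: "torus_fun d f \<and> SF_norm phi d r p \<theta> f < \<infinity>"
          let ?S = "SF_norm phi d r p \<theta> f"
          have S: "?S = ennreal (enn2real ?S)" using f by (simp add: less_top)
          have "Linf_norm d (\<lambda>x. f x - smolyak d L \<eta> m f x)
             \<le> ennreal (C * real m powr (real (\<mu> - 1) * max (1 - 1 / p) 0) * 2 powr (- real m * a) * enn2real ?S)"
            unfolding Linf_norm_def using main[OF m] f by (intro SUP_least ennreal_leI) auto
          also have "\<dots> = ennreal (C * real m powr (real (\<mu> - 1) * max (1 - 1 / p) 0) * 2 powr (- real m * a)) * ennreal (enn2real ?S)"
            using C by (intro ennreal_mult) auto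
          finally show "Linf_norm d (\<lambda>x. f x - smolyak d L (\<lambda>s. \<nu> s - 1 / p) m f x)
             \<le> ennreal (C * real m powr (real (\<mu> - 1) * max (1 - 1 / p) 0) * 2 powr (- real m * (r 0 - 1 / p))) * ?S"
            unfolding S[symmetric] a_def \<eta>_def .
        qed
      qed
    qed
  qed
qed

end
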